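(* For every integer $n\ge1$, with $\check{n}:=\frac{n-1}{2}$, $$\det(\Delta_n)=e^{f_{n,1}(\check{n})}\prod^{n-1}_{l=1}\bigl(\Gamma_l(n)\Gamma_l(1)\bigr)^{-1}\cdot\bigl(\Gamma_n(n)\Gamma_n(1)\bigr)^{-2},$$ $$\det(Y_n)=\Bigl(\frac{n(n-2)}{4}\Bigr)^{\delta_{n\ge 3}}\cdot e^{f_{n,1}(\frac12)}\prod^{n-1}_{l=1}\Bigl(\Gamma_l\bigl(\tfrac n2+1\bigr)\Gamma_l\bigl(\tfrac n2\bigr)\Bigr)^{-1}\cdot\Bigl(\Gamma_n\bigl(\tfrac n2+1\bigr)\Gamma_n\bigl(\tfrac n2\bigr)\Bigr)^{-2},$$ where $\delta_{n\ge3}:=1$ if $n\ge3$ and $0$ otherwise.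
   Context: $\Delta_n$ denotes the (nonnegative) Laplacian on the unit sphere $S^n\subset\mathbb{R}^{n+1}$ with the standard metric: its eigenvalues are $k(k+n-1)$, $k=0,1,2,\dots$, where $0$ has multiplicity $1$ and, for $k\ge1$, $k(k+n-1)$ has multiplicity $\binom{n+k}{n}-\binom{n+k-2}{n}$. $Y_n:=\Delta_n+\frac{n(n-2)}{4}$ is the conformal Laplacian. For an operator $A$ with real discrete spectrum, $\zeta_A(w):=\sum_{\lambda}\lambda^{-w}$, the sum being over all (strictly) positive eigenvalues counted with multiplicity, and $\det(A):=\exp(-\zeta_A'(0))$, using the meromorphic continuation of $\zeta_A$ (for $A=\Delta_n,Y_n$ it exists and is holomorphic at $0$). The Barnes multiple gamma function is $\Gamma_l(z):=\exp\bigl(\frac{\partial}{\partial w}\zeta_l(w,z)\big|_{w=0}\bigr)$, where $\zeta_l(w,z):=\sum_{m_1,\dots,m_l\ge0}(m_1+\cdots+m_l+z)^{-w}$ ($\mathrm{Re}(w)>l$), continued meromorphically in $w$. The polynomial $f_{n,1}$ is $$f_{n,1}(s):=\sum_{d=1}^{n-1}\frac{(-1)^{1+d}}{2(d+1)}\Bigl(\sum_{j=1}^{d}\frac1j\Bigr)(2s)^{d+1}T_{n,d}(s),$$ where the polynomials $T_{n,d}(s)$ ($0\le d\le n-1$) are determined by $P_n(z)=\sum_{d=0}^{n-1}T_{n,d}(s)(z-s)^d$ with $P_n(z):=\binom{z+\check n+1}{n}-\binom{z+\check n-1}{n}$. A quantity raised to the power $\delta_{n\ge3}=0$ is read as $1$;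 empty sums are $0$ and empty products are $1$. *)

theory Defs
  imports "HOL-Complex_Analysis.Complex_Analysis" "HOL-Library.Function_Algebras"
begin

text \<open>\<open>Ck_on k f U\<close> and \<open>smooth_on U f\<close> are only meant for open sets \<open>U\<close>.\<close>

primrec Ck_on :: "nat \<Rightarrow> ('a::euclidean_space \<Rightarrow> 'b::real_normed_vector) \<Rightarrow> 'a set \<Rightarrow> bool" where
  "Ck_on 0 f U \<longleftrightarrow> continuous_on U f"
| "Ck_on (Suc k) f U \<longleftrightarrow>
     f differentiable_on U \<and> (\<forall>v. Ck_on k (\<lambda>x. frechet_derivative f (at x) v) U)"

definition smooth_on :: "'a::euclidean_space set \<Rightarrow> ('a \<Rightarrow> 'b::real_normed_vector) \<Rightarrow> bool" where
  "smooth_on U f \<longleftrightarrow> (\<forall>k. Ck_on k f U)"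

text \<open>
  A function on the unit sphere of \<open>'a\<close> is represented by a function on \<open>'a\<close> that vanishes
  off the sphere, so that distinct representatives are distinct functions on the sphere.
  Composing with \<^const>\<open>sgn\<close>, i.e. \<open>x \<mapsto> x / norm x\<close>, extends it to all of \<open>'a\<close> minus
  the origin, constantly along rays.
\<close>

definition radial_ext :: "('a::euclidean_space \<Rightarrow> 'b) \<Rightarrow> 'a \<Rightarrow> 'b" where
  "radial_ext u = (\<lambda>x. u (sgn x))"

definition smooth_sphere :: "('a::euclidean_space \<Rightarrow> real) set" where
  "smooth_sphere = {u. (\<forall>x. x \<notin> sphere 0 1 \<longrightarrow> u x = 0) \<and> smooth_on (- {0}) (radial_ext u)}"

text \<open>
  The Riemannian gradient and divergence for the metric induced from \<open>'a\<close>. At a point \<open>x\<close> of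
  the sphere, the derivative of a radial extension vanishes in the normal direction \<open>x\<close> and
  is the derivative along the sphere in tangent directions. So the gradient below is tangent, and
  the trace over an orthonormal basis of \<open>'a\<close> is the trace over an orthonormal basis
  \<open>e\<^sub>1, \<dots>, e\<^sub>n\<close> of the tangent space, i.e. the sum of the \<open>\<langle>\<nabla>\<^bsub>e\<^sub>i\<^esub> V, e\<^sub>i\<rangle>\<close>, where the
  Levi-Civita connection \<open>\<nabla>\<close> is the tangential part of the ambient derivative.
\<close>

definition sphere_grad :: "('a::euclidean_space \<Rightarrow> real) \<Rightarrow> 'a \<Rightarrow> 'a" where
  "sphere_grad u x = (\<Sum>b\<in>Basis. frechet_derivative (radial_ext u) (at x) b *\<^sub>R b)"

definition sphere_div :: "('a::euclidean_space \<Rightarrow> 'a) \<Rightarrow> 'a \<Rightarrow> real" where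
  "sphere_div V x = (\<Sum>b\<in>Basis. frechet_derivative (radial_ext V) (at x) b \<bullet> b)"

definition sphere_laplacian :: "('a::euclidean_space \<Rightarrow> real) \<Rightarrow> 'a \<Rightarrow> real" where
  "sphere_laplacian u x = (if x \<in> sphere 0 1 then - sphere_div (sphere_grad u) x else 0)"

definition conformal_laplacian :: "('a::euclidean_space \<Rightarrow> real) \<Rightarrow> 'a \<Rightarrow> real" where
  "conformal_laplacian u x =
     (let n = real DIM('a) - 1 in sphere_laplacian u x + n * (n - 2) / 4 * u x)"

text \<open>
  The meromorphic continuation to the whole plane of \<open>w \<mapsto> \<Sum>i\<in>I. f i w\<close>, which is required to
  converge absolutely on some right half-plane (the continuation does not depend on which).
  A nicely meromorphic function has no removable singularities and takes the value \<open>0\<close> at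
  its poles, which makes the continuation unique.
\<close>

definition series_continuation :: "'i set \<Rightarrow> ('i \<Rightarrow> complex \<Rightarrow> complex) \<Rightarrow> complex \<Rightarrow> complex" where
  "series_continuation I f =
     (THE Z. Z nicely_meromorphic_on UNIV \<and>
             (\<exists>\<sigma>::real. \<forall>w. Re w > \<sigma> \<longrightarrow> ((\<lambda>i. f i w) has_sum Z w) I))"

text \<open>
  Below, \<open>D\<close> is the domain of the operator \<open>A\<close>, a linear subspace of the functions
  \<open>'a \<Rightarrow> real\<close>. All eigenspaces are supposed to be finite-dimensional (\<open>dim\<close> is \<open>0\<close> on
  infinite-dimensional spaces).
\<close>

definition eigenspace ::
  "('a \<Rightarrow> real) set \<Rightarrow> (('a \<Rightarrow> real) \<Rightarrow> 'a \<Rightarrow> real) \<Rightarrow> real \<Rightarrow> ('a \<Rightarrow> real) set" where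
  "eigenspace D A \<mu> = {u \<in> D. A u = (\<lambda>x. \<mu> * u x)}"

lemma vector_space_fun: "vector_space (\<lambda>(c::real) (u::'a \<Rightarrow> real) x. c * u x)"
  by standard (auto simp: fun_eq_iff algebra_simps)

definition multiplicity_of ::
  "('a \<Rightarrow> real) set \<Rightarrow> (('a \<Rightarrow> real) \<Rightarrow> 'a \<Rightarrow> real) \<Rightarrow> real \<Rightarrow> nat" where
  "multiplicity_of D A \<mu> = vector_space.dim (\<lambda>(c::real) u x. c * u x) (eigenspace D A \<mu>)"

definition positive_eigenvalues ::
  "('a \<Rightarrow> real) set \<Rightarrow> (('a \<Rightarrow> real) \<Rightarrow> 'a \<Rightarrow> real) \<Rightarrow> real set" where
  "positive_eigenvalues D A = {\<mu>. \<mu> > 0 \<and> (\<exists>u\<in>eigenspace D A \<mu>. u \<noteq> (\<lambda>x. 0))}"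

definition operator_zeta ::
  "('a \<Rightarrow> real) set \<Rightarrow> (('a \<Rightarrow> real) \<Rightarrow> 'a \<Rightarrow> real) \<Rightarrow> complex \<Rightarrow> complex" where
  "operator_zeta D A =
     series_continuation (positive_eigenvalues D A)
       (\<lambda>\<mu> w. of_nat (multiplicity_of D A \<mu>) * of_real \<mu> powr (- w))"

definition operator_det :: "('a \<Rightarrow> real) set \<Rightarrow> (('a \<Rightarrow> real) \<Rightarrow> 'a \<Rightarrow> real) \<Rightarrow> complex" where
  "operator_det D A = exp (- deriv (operator_zeta D A) 0)"

text \<open>The lists of length \<open>l\<close> are the tuples \<open>(m\<^sub>1, \<dots>, m\<^sub>l)\<close>.\<close>

definition barnes_zeta :: "nat \<Rightarrow> complex \<Rightarrow> complex \<Rightarrow> complex" where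
  "barnes_zeta l w z =
     series_continuation {m :: nat list. length m = l}
       (\<lambda>m w. (of_nat (sum_list m) + z) powr (- w)) w"

definition barnes_Gamma :: "nat \<Rightarrow> complex \<Rightarrow> complex" where
  "barnes_Gamma l z = exp (deriv (\<lambda>w. barnes_zeta l w z) 0)"

definition check :: "nat \<Rightarrow> complex" where
  "check n = (of_nat n - 1) / 2"

definition P_poly :: "nat \<Rightarrow> complex \<Rightarrow> complex" where
  "P_poly n z = ((z + check n + 1) gchoose n) - ((z + check n - 1) gchoose n)"

definition T_coeff :: "nat \<Rightarrow> nat \<Rightarrow> complex \<Rightarrow> complex" where
  "T_coeff n d s =
     (THE T. (\<forall>k\<ge>n. T k = 0) \<and> (\<forall>z. P_poly n z = (\<Sum>k=0..<n. T k * (z - s) ^ k))) d"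

definition f_exponent :: "nat \<Rightarrow> complex \<Rightarrow> complex" where
  "f_exponent n s =
     (\<Sum>d=1..<n. (- 1) ^ (1 + d) / (2 * (of_nat d + 1)) * (\<Sum>j=1..d. 1 / of_nat j) *
                  (2 * s) ^ (d + 1) * T_coeff n d s)"

end

theory Submission
  imports Defs
begin

text \<open>
  \<^emph>\<open>Spectrum.\<close> An eigenfunction \<open>u\<close> with eigenvalue \<open>\<alpha>(\<alpha> + n - 1)\<close> extends to the harmonic function
  \<open>F(x) = |x|\<^sup>\<alpha> u(x/|x|)\<close> off the origin. Partial derivatives of \<open>F\<close> are again harmonic and homogeneous,
  with the degree lowered by one. A maximum principle on the sphere kills the degrees in \<open>(1 - n, 0)\<close>
  and Bochner's argument shows that in degree \<open>0\<close> there are only constants (the circle is settled by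
  solving an ODE). Integrating back by Euler's identity, \<open>\<alpha>\<close> is an integer \<open>k\<close> and \<open>F\<close> is a
  harmonic polynomial of degree \<open>k\<close>; no integration over the sphere is needed.

  \<^emph>\<open>Determinant.\<close> The eigenvalues are \<open>u\<^sub>k (u\<^sub>k + b)\<close> with \<open>u\<^sub>k = k + a\<close> and \<open>b = 2 s\<close>, and the
  multiplicity is a polynomial in \<open>u\<^sub>k\<close>. Expanding \<open>(1 + b/u)\<close> to the power \<open>-w\<close> in powers of \<open>b/u\<close> reduces
  \<open>\<Sum>\<^sub>k u\<^sub>k\<^sup>d u\<^sub>k\<^sup>-\<^sup>c\<^sup>w (1 + b/u\<^sub>k)\<^sup>-\<^sup>w\<close> to Hurwitz zeta functions, and its derivative at \<open>w = 0\<close> is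
  \<open>c A + B + E/c\<close> with \<open>A\<close>, \<open>B\<close>, \<open>E\<close> independent of \<open>c\<close>; \<open>E\<close> comes from the pole of the Hurwitz zeta
  function. The case \<open>c = 2\<close> is the zeta function of the operator, and \<open>c = 1\<close> together with \<open>b = 0\<close> gives the
  Barnes zeta functions at \<open>a + b\<close> and at \<open>a\<close>, so that the two differ by \<open>E/2\<close>, which sums up to the exponent.
\<close>

subsection \<open>Meromorphic continuation of series\<close>

text \<open>The obstacle is the multiplicative anomaly: zeta regularization does not respect
  products, so the determinant of the \<open>u_k * (u_k + b)\<close> cannot be split directly into
  those of the two factors. Comparing \<open>c = 2\<close>, \<open>c = 1\<close> and
  \<open>b = 0\<close> isolates the anomaly without evaluating \<open>A\<close> or \<open>B\<close>;
  Barnes values enter only because the continuation of a Dirichlet series is unique. The exponents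
  -1 and -2 of the gamma factors come from the hockey-stick identity, which writes the multiplicity
  as a sum of numbers of tuples of length 1, ..., n with given sum, length n counted twice. The
  harmonic numbers are derivatives at \<open>w = 0\<close> of the binomial coefficient that is left
  after its zero has cancelled the pole. The prefactor n(n-2)/4 is the eigenvalue of the constants,
  positive exactly for n at least 3. On the spectral side an eigenfunction is just a smooth
  function, so every real number outside the list has to be excluded directly. Bochner's argument
  degenerates on the circle, which forces the separate treatment there.\<close>

lemma nicely_meromorphic_remove_sings_eq:
  assumes "f nicely_meromorphic_on A" "z \<in> A"
  shows "remove_sings f z = f z"
  using assms unfolding nicely_meromorphic_on_def
  by (metis remove_sings_at_pole remove_sings_eqI)

lemma nicely_meromorphic_eq_at:
  assumes "f nicely_meromorphic_on A" "g nicely_meromorphic_on A" "z \<in> A"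
    and "eventually (\<lambda>z. f z = g z) (at z)"
  shows "f z = g z"
  using nicely_meromorphic_remove_sings_eq assms remove_sings_cong by metis

text \<open>A difference of nicely meromorphic functions may have removable singularities where
  poles cancel, so the identity theorem is applied to its normalization \<open>h\<close>; equality
  near \<open>w\<close> then passes to \<open>w\<close> itself because \<open>f\<close> and
  \<open>g\<close> are normalized.\<close>

lemma nicely_meromorphic_eq:
  assumes f: "f nicely_meromorphic_on A" and g: "g nicely_meromorphic_on A"
    and A: "open A" "connected A" "z0 \<in> A" "w \<in> A"
    and ev: "eventually (\<lambda>z. f z = g z) (at z0)"
  shows "f w = g w"
proof -
  define h where "h = remove_sings (\<lambda>z. f z - g z)"
  have m: "(\<lambda>z. f z - g z) meromorphic_on A"
    using f g unfolding nicely_meromorphic_on_def by (auto intro!: meromorphic_intros)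
  have hn: "h nicely_meromorphic_on A"
    unfolding h_def by (rule remove_sings_nicely_meromorphic[OF m])
  have evh: "eventually (\<lambda>z. h z = f z - g z) (at y)" if "y \<in> A" for y
    unfolding h_def using m that
    by (intro eventually_remove_sings_eq_at) (auto intro: meromorphic_on_isolated_singularity meromorphic_on_subset)
  have "eventually (\<lambda>z. h z = 0) (at z0)"
    using ev evh[OF A(3)] by eventually_elim auto
  then have fr: "frequently (\<lambda>z. h z = 0) (at z0)"
    by (simp add: eventually_frequently)
  have h0: "h y = 0" if "y \<in> A" for y
    using frequently_eq_meromorphic_imp_constant[OF fr hn A(1-3)] that by auto
  have "eventually (\<lambda>z. z \<in> A) (at w)"
    using A by (simp add: eventually_at_in_open')
  with evh[OF A(4)] have "eventually (\<lambda>z. f z = g z) (at w)"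
    by eventually_elim (use h0 in auto)
  then show ?thesis
    using nicely_meromorphic_eq_at[OF f g A(4)] by auto
qed

lemma open_halfplane: "open {w. Re w > r}"
  by (simp add: open_halfspace_Re_gt)

lemma connected_halfplane: "connected {w. Re w > r}"
  by (simp add: convex_connected convex_halfspace_Re_gt)

lemma nicely_meromorphic_eq_halfplane:
  assumes f: "f nicely_meromorphic_on A" and g: "g nicely_meromorphic_on A"
    and A: "open A" "connected A" "w \<in> A"
    and sub: "{w. Re w > r} \<subseteq> A" and eq: "\<And>z. Re z > r \<Longrightarrow> f z = g z"
  shows "f w = g w"
proof (rule nicely_meromorphic_eq[OF f g A(1,2) _ A(3)])
  show "of_real (r + 1) \<in> A"
    using sub by auto
  have "eventually (\<lambda>z. z \<in> {w. Re w > r}) (at (of_real (r + 1)))"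
    by (rule eventually_at_in_open') (auto simp: open_halfplane)
  then show "eventually (\<lambda>z. f z = g z) (at (of_real (r + 1)))"
    by eventually_elim (use eq in auto)
qed

lemma series_continuation_eqI:
  assumes "Z nicely_meromorphic_on UNIV"
    and "\<And>w. Re w > \<sigma> \<Longrightarrow> ((\<lambda>i. f i w) has_sum Z w) I"
  shows "series_continuation I f = Z"
  unfolding series_continuation_def
proof (rule the_equality)
  fix Y assume Y: "Y nicely_meromorphic_on UNIV \<and> (\<exists>\<sigma>::real. \<forall>w. Re w > \<sigma> \<longrightarrow> ((\<lambda>i. f i w) has_sum Y w) I)"
  then obtain \<tau> where \<tau>: "\<And>w. Re w > \<tau> \<Longrightarrow> ((\<lambda>i. f i w) has_sum Y w) I" by auto
  show "Y = Z"
  proof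
    fix w
    show "Y w = Z w"
      by (rule nicely_meromorphic_eq_halfplane[of Y UNIV Z w "max \<sigma> \<tau>"])
         (use Y assms \<tau> in \<open>auto intro: has_sum_unique\<close>)
  qed
qed (use assms in auto)

lemma nicely_meromorphic_transform_open:
  assumes g: "g nicely_meromorphic_on A" and A: "open A" "z \<in> A"
    and eq: "\<And>w. w \<in> A \<Longrightarrow> f w = g w"
  shows "f nicely_meromorphic_on {z}"
proof -
  have ev: "eventually (\<lambda>w. w \<in> A) (nhds z)"
    using A by (simp add: eventually_nhds_in_open)
  have ev': "eventually (\<lambda>w. f w = g w) (nhds z)"
    using ev by eventually_elim (use eq in auto)
  then have ev'': "eventually (\<lambda>w. f w = g w) (at z)"
    by (simp add: eventually_nhds_conv_at)
  have "g meromorphic_on {z}"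
    using g A by (auto simp: nicely_meromorphic_on_def intro: meromorphic_on_subset)
  then have "f meromorphic_on {z}"
    using meromorphic_on_cong[of "{z}" f g] ev'' by auto
  moreover have "is_pole f z \<longleftrightarrow> is_pole g z"
    using ev'' by (intro is_pole_cong) auto
  moreover have "(f \<midarrow>z\<rightarrow> g z) \<longleftrightarrow> (g \<midarrow>z\<rightarrow> g z)"
    using ev'' by (intro filterlim_cong) auto
  ultimately show ?thesis
    using g A eq[OF A(2)] unfolding nicely_meromorphic_on_def by auto
qed

text \<open>Each cut of an asymptotic expansion continues a series only into some half-plane. Two
  such continuations agree on the overlap, since both coincide with \<open>F\<close> far to the
  right and half-planes are connected.\<close>

lemma nicely_meromorphic_glue:
  fixes Z :: "nat \<Rightarrow> complex \<Rightarrow> complex"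
  assumes Z: "\<And>J. Z J nicely_meromorphic_on {w. Re w > - real J}"
    and F: "\<And>J w. Re w > \<sigma> J \<Longrightarrow> Z J w = F w"
  obtains Y where "Y nicely_meromorphic_on UNIV" "\<And>J w. Re w > - real J \<Longrightarrow> Y w = Z J w"
proof -
  have agree: "Z J w = Z J' w" if "J \<le> J'" "Re w > - real J" for J J' w
  proof (rule nicely_meromorphic_eq_halfplane[of "Z J" "{w. Re w > - real J}" "Z J'" w "Max {\<sigma> J, \<sigma> J', - real J}"])
    show "Z J' nicely_meromorphic_on {w. - real J < Re w}"
      by (rule nicely_meromorphic_on_subset[OF Z]) (use that in auto)
  qed (use that Z F in \<open>auto simp: open_halfplane connected_halfplane\<close>)
  have agree': "Z J w = Z J' w" if "Re w > - real J" "Re w > - real J'" for J J' w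
    using agree[of J J' w] agree[of J' J w] that linear[of J J'] by metis
  \<comment> \<open>Some half-plane that contains \<open>w\<close>; by \<open>agree'\<close> the
    choice does not matter.\<close>
  define N where "N w = nat \<lceil>- Re w\<rceil> + 1" for w
  have N: "Re w > - real (N w)" for w
    unfolding N_def by linarith
  define Y where "Y w = Z (N w) w" for w
  have Y: "Y w = Z J w" if "Re w > - real J" for J w
    unfolding Y_def using agree'[OF N that] .
  have "Y nicely_meromorphic_on {w}" for w
    by (rule nicely_meromorphic_transform_open[OF Z[of "N w"] open_halfplane])
       (use N Y[of "N w"] in auto)
  then have "Y nicely_meromorphic_on UNIV"
    unfolding nicely_meromorphic_on_def by (auto simp: meromorphic_on_meromorphic_at[of Y UNIV])
  with Y show ?thesis using that by blast
qed

text \<open>Plain meromorphy keeps the notion stable under sums, where normalization could be lost.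
  Analyticity on a right half-plane ensures that a later \<open>remove_sings\<close> leaves the sum
  of the series unchanged there.\<close>

definition zeta_deriv :: "'i set \<Rightarrow> ('i \<Rightarrow> complex \<Rightarrow> complex) \<Rightarrow> complex \<Rightarrow> bool" where
  "zeta_deriv I g D \<longleftrightarrow>
     (\<exists>Z \<sigma>. Z meromorphic_on UNIV \<and> Z analytic_on {w. Re w > \<sigma>} \<and>
            (\<forall>w. Re w > \<sigma> \<longrightarrow> ((\<lambda>i. g i w) has_sum Z w) I) \<and>
            Z analytic_on {0} \<and> deriv Z 0 = D)"

lemma zeta_deriv_series_continuation:
  assumes "zeta_deriv I g D"
  shows "deriv (series_continuation I g) 0 = D"
proof -
  obtain Z \<sigma> where Z: "Z meromorphic_on UNIV" "Z analytic_on {w. Re w > \<sigma>}"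
      "\<And>w. Re w > \<sigma> \<Longrightarrow> ((\<lambda>i. g i w) has_sum Z w) I" "Z analytic_on {0}" "deriv Z 0 = D"
    using assms unfolding zeta_deriv_def by auto
  have eq: "remove_sings Z w = Z w" if "Re w > \<sigma>" for w
    using Z(2) that by (intro remove_sings_at_analytic) (auto intro: analytic_on_subset)
  have "series_continuation I g = remove_sings Z"
    by (rule series_continuation_eqI[where \<sigma> = \<sigma>])
       (use Z eq remove_sings_nicely_meromorphic in auto)
  then show ?thesis
    using Z by simp
qed

text \<open>Turns two different continuations of one Dirichlet series into an identity between
  constants; this is how Barnes values are recognised later.\<close>

lemma zeta_deriv_unique:
  "zeta_deriv I g D \<Longrightarrow> zeta_deriv I g D' \<Longrightarrow> D = D'"
  using zeta_deriv_series_continuation[of I g D]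
    zeta_deriv_series_continuation[of I g D'] by simp

lemma zeta_deriv_transfer:
  assumes "zeta_deriv I g D"
    and "\<And>w S. ((\<lambda>i. g i w) has_sum S) I \<Longrightarrow> ((\<lambda>i. h i w) has_sum S) J"
  shows "zeta_deriv J h D"
  using assms unfolding zeta_deriv_def by blast

lemma zeta_deriv_cong:
  assumes "zeta_deriv I g D" "\<And>i w. i \<in> I \<Longrightarrow> g i w = h i w"
  shows "zeta_deriv I h D"
  using assms(1)
proof (rule zeta_deriv_transfer)
  fix w S assume "((\<lambda>i. g i w) has_sum S) I"
  then show "((\<lambda>i. h i w) has_sum S) I"
    using assms(2) by (subst has_sum_cong[of I _ "\<lambda>i. g i w"]) auto
qed

lemma zeta_deriv_add:
  assumes "zeta_deriv I g D" "zeta_deriv I h E"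
  shows "zeta_deriv I (\<lambda>i w. g i w + h i w) (D + E)"
proof -
  obtain Z \<sigma> where Z: "Z meromorphic_on UNIV" "Z analytic_on {w. Re w > \<sigma>}"
      "\<And>w. Re w > \<sigma> \<Longrightarrow> ((\<lambda>i. g i w) has_sum Z w) I" "Z analytic_on {0}" "deriv Z 0 = D"
    using assms(1) unfolding zeta_deriv_def by auto
  obtain Y \<tau> where Y: "Y meromorphic_on UNIV" "Y analytic_on {w. Re w > \<tau>}"
      "\<And>w. Re w > \<tau> \<Longrightarrow> ((\<lambda>i. h i w) has_sum Y w) I" "Y analytic_on {0}" "deriv Y 0 = E"
    using assms(2) unfolding zeta_deriv_def by auto
  have "(\<lambda>w. Z w + Y w) analytic_on {w. Re w > max \<sigma> \<tau>}"
    by (intro analytic_intros analytic_on_subset[OF Z(2)] analytic_on_subset[OF Y(2)]) auto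
  moreover have "deriv (\<lambda>w. Z w + Y w) 0 = D + E"
    using Z Y by (subst deriv_add) (auto intro: analytic_on_imp_differentiable_at)
  ultimately show ?thesis
    unfolding zeta_deriv_def
    by (intro exI[of _ "\<lambda>w. Z w + Y w"] exI[of _ "max \<sigma> \<tau>"])
       (use Z Y in \<open>auto intro!: meromorphic_intros analytic_intros has_sum_add\<close>)
qed

lemma zeta_deriv_cmult:
  assumes "zeta_deriv I g D"
  shows "zeta_deriv I (\<lambda>i w. c * g i w) (c * D)"
proof -
  obtain Z \<sigma> where Z: "Z meromorphic_on UNIV" "Z analytic_on {w. Re w > \<sigma>}"
      "\<And>w. Re w > \<sigma> \<Longrightarrow> ((\<lambda>i. g i w) has_sum Z w) I" "Z analytic_on {0}" "deriv Z 0 = D"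
    using assms(1) unfolding zeta_deriv_def by auto
  have "deriv (\<lambda>w. c * Z w) 0 = c * D"
    using Z by (subst deriv_cmult) (auto intro: analytic_on_imp_differentiable_at)
  then show ?thesis
    unfolding zeta_deriv_def
    by (intro exI[of _ "\<lambda>w. c * Z w"] exI[of _ \<sigma>])
       (use Z in \<open>auto intro!: meromorphic_intros analytic_intros has_sum_cmult_right\<close>)
qed

lemma zeta_deriv_0: "zeta_deriv I (\<lambda>i w. 0) 0"
  unfolding zeta_deriv_def
  by (intro exI[of _ "\<lambda>_. 0"] exI[of _ 0]) auto

lemma zeta_deriv_sum:
  assumes "\<And>x. x \<in> A \<Longrightarrow> zeta_deriv I (g x) (D x)"
  shows "zeta_deriv I (\<lambda>i w. \<Sum>x\<in>A. g x i w) (\<Sum>x\<in>A. D x)"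
  using assms
  by (induction A rule: infinite_finite_induct)
     (auto intro!: zeta_deriv_0 zeta_deriv_add)

text \<open>Adds a single eigenvalue to the series: that of the constant functions, when it is
  positive.\<close>

lemma zeta_deriv_insert:
  assumes "zeta_deriv I g D" "i0 \<notin> I" "\<And>w. (g i0 has_field_derivative g' w) (at w)"
  shows "zeta_deriv (insert i0 I) g (D + g' 0)"
proof -
  obtain Z \<sigma> where Z: "Z meromorphic_on UNIV" "Z analytic_on {w. Re w > \<sigma>}"
      "\<And>w. Re w > \<sigma> \<Longrightarrow> ((\<lambda>i. g i w) has_sum Z w) I" "Z analytic_on {0}" "deriv Z 0 = D"
    using assms(1) unfolding zeta_deriv_def by auto
  have an: "g i0 analytic_on A" for A
    using assms(3) by (metis analytic_on_subset analytic_on_open open_UNIV holomorphic_on_open subset_UNIV)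
  have "deriv (\<lambda>w. Z w + g i0 w) 0 = D + g' 0"
    using Z an DERIV_imp_deriv[OF assms(3)]
    by (subst deriv_add) (auto intro: analytic_on_imp_differentiable_at)
  moreover have "((\<lambda>i. g i w) has_sum Z w + g i0 w) (insert i0 I)" if "Re w > \<sigma>" for w
    using has_sum_insert[OF assms(2) Z(3)[OF that]] by (simp add: add.commute)
  ultimately show ?thesis
    unfolding zeta_deriv_def
    by (intro exI[of _ "\<lambda>w. Z w + g i0 w"] exI[of _ \<sigma>])
       (use Z an in \<open>auto intro!: meromorphic_on_add analytic_on_add intro: analytic_on_imp_meromorphic_on\<close>)
qed

subsection \<open>The Hurwitz zeta function\<close>

definition binom_rem :: "nat \<Rightarrow> complex \<Rightarrow> real \<Rightarrow> complex" where
  "binom_rem J v t = of_real (1 + t) powr v - (\<Sum>j<J. (v gchoose j) * of_real (t ^ j))"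

lemma pochhammer_ge_0: "r \<ge> 0 \<Longrightarrow> pochhammer r j \<ge> (0 :: real)"
  by (auto simp: pochhammer_prod intro!: prod_nonneg)

lemma norm_gbinomial_le:
  assumes "norm (v :: complex) \<le> r"
  shows "norm (v gchoose j) \<le> pochhammer r j / fact j"
proof -
  have r: "0 \<le> r" using assms norm_ge_zero order_trans by blast
  have "norm (pochhammer (- v) j) \<le> pochhammer r j"
  proof (induction j)
    case (Suc j)
    have "norm (- v + of_nat j) \<le> r + real j"
      using norm_triangle_ineq[of "- v" "of_nat j"] assms by simp
    then show ?case
      using Suc r by (simp add: pochhammer_Suc norm_mult mult_mono pochhammer_ge_0)
  qed auto
  then show ?thesis
    by (simp add: gbinomial_pochhammer norm_mult norm_power norm_divide divide_right_mono)
qed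

text \<open>\<open>v gchoose j\<close> is dominated by \<open>c j\<close>, and the
  \<open>c j * (1/2) ^ j\<close> are the terms of the binomial series of \<open>1 - 1/2\<close> to
  the power \<open>- r\<close>, hence summable. Uniformity in \<open>v\<close> is what locally
  uniform convergence in \<open>w\<close> requires.\<close>

lemma binom_rem_bound:
  assumes "r \<ge> 0"
  obtains C where "C \<ge> 0"
    "\<And>v t. \<lbrakk>norm v \<le> r; 0 \<le> t; t \<le> 1/2\<rbrakk> \<Longrightarrow> norm (binom_rem J v t) \<le> C * t ^ J"
proof -
  define c where "c j = pochhammer r j / fact j" for j
  have c0: "c j \<ge> 0" for j
    using assms unfolding c_def by (simp add: pochhammer_ge_0)
  have "summable (\<lambda>j. ((- r) gchoose j) * (- 1/2) ^ j)"
    using gen_binomial_real[of "- 1/2" "- r"] by (auto simp: sums_iff)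
  moreover have "((- r) gchoose j) * (- 1/2) ^ j = c j * (1/2) ^ j" for j
  proof -
    have "(- 1/2 :: real) ^ j = (- 1) ^ j * (1/2) ^ j"
      by (subst power_mult_distrib[symmetric]) simp
    moreover have "(- 1 :: real) ^ j * (- 1) ^ j = 1"
      by (subst power_mult_distrib[symmetric]) simp
    ultimately show ?thesis
      by (simp add: gbinomial_pochhammer c_def)
  qed
  ultimately have "summable (\<lambda>j. c j * (1/2) ^ j)"
    by simp
  then have "summable (\<lambda>j. 2 ^ J * (c (j + J) * (1/2) ^ (j + J)))"
    by (intro summable_mult summable_ignore_initial_segment)
  then have sm: "summable (\<lambda>j. c (j + J) * (1/2) ^ j)"
    by (simp add: power_add power_one_over mult_ac)
  define C where "C = (\<Sum>j. c (j + J) * (1/2) ^ j)"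
  have C0: "C \<ge> 0"
    unfolding C_def using c0 sm by (intro suminf_nonneg) auto
  show ?thesis
  proof (rule that[OF C0])
    fix v :: complex and t :: real assume v: "norm v \<le> r" and t: "0 \<le> t" "t \<le> 1/2"
    have "(\<lambda>j. (v gchoose j) * of_real t ^ j) sums (1 + of_real t) powr v"
      by (rule gen_binomial_complex) (use t in auto)
    then have "(\<lambda>j. (v gchoose (j + J)) * of_real t ^ (j + J)) sums binom_rem J v t"
      unfolding binom_rem_def by (drule_tac sums_split_initial_segment[where n = J]) simp
    then have eq: "binom_rem J v t = (\<Sum>j. (v gchoose (j + J)) * of_real t ^ (j + J))"
      by (simp add: sums_iff)
    have le: "norm ((v gchoose (j + J)) * of_real t ^ (j + J)) \<le> t ^ J * (c (j + J) * (1/2) ^ j)" for j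
    proof -
      have "norm ((v gchoose (j + J)) * of_real t ^ (j + J)) = norm (v gchoose (j + J)) * (t ^ j * t ^ J)"
        using t by (simp add: norm_mult norm_power power_add)
      also have "\<dots> \<le> c (j + J) * ((1/2) ^ j * t ^ J)"
        using norm_gbinomial_le[OF v] t c0 unfolding c_def
        by (intro mult_mono power_mono) auto
      finally show ?thesis by (simp add: mult_ac)
    qed
    have sm': "summable (\<lambda>j. t ^ J * (c (j + J) * (1/2) ^ j))"
      using sm by (rule summable_mult)
    have "norm (binom_rem J v t) \<le> (\<Sum>j. t ^ J * (c (j + J) * (1/2) ^ j))"
      unfolding eq using le sm' by (rule norm_suminf_le)
    also have "\<dots> = C * t ^ J"
      unfolding C_def using suminf_mult[OF sm] by (simp add: mult.commute)
    finally show "norm (binom_rem J v t) \<le> C * t ^ J" .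
  qed
qed

lemma holomorphic_on_gbinomial [holomorphic_intros]:
  "f holomorphic_on A \<Longrightarrow> (\<lambda>w. f w gchoose j) holomorphic_on A"
  unfolding gbinomial_prod_rev by (intro holomorphic_intros) auto

lemma holomorphic_on_powr_of_real [holomorphic_intros]:
  assumes "x > 0" "f holomorphic_on A"
  shows "(\<lambda>w. of_real x powr f w) holomorphic_on A"
  using assms by (auto simp: powr_def intro!: holomorphic_intros)

lemma holomorphic_on_binom_rem [holomorphic_intros]:
  assumes "t \<ge> 0" "f holomorphic_on A"
  shows "(\<lambda>w. binom_rem J (f w) t) holomorphic_on A"
  unfolding binom_rem_def using assms by (intro holomorphic_intros) auto

lemma norm_powr_of_real: "x > 0 \<Longrightarrow> norm (of_real x powr (z :: complex)) = x powr Re z"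
  by (subst norm_powr_real_powr) auto

text \<open>With \<open>u = k + a\<close> the summand is of the order of \<open>u\<close> to the
  power \<open>p - c * Re w - J\<close>, locally uniformly in \<open>w\<close>. Each further term
  split off from the binomial expansion thus moves the half-plane of convergence to the left by
  \<open>1 / c\<close>.\<close>

lemma remainder_series:
  fixes a b c p :: real and v0 :: complex and J :: nat
  assumes a: "a > 0" and b: "b \<ge> 0" and c: "c > 0"
  defines "g \<equiv> \<lambda>k w. of_real (real k + a) powr (of_real p - of_real c * w) *
                         binom_rem J (v0 - w) (b / (real k + a))"
  shows "\<exists>R R'. \<forall>w. c * Re w > p + 1 - real J \<longrightarrow>
    ((\<lambda>k. g k w) has_sum R w) UNIV \<and> (R has_field_derivative R' w) (at w) \<and>
    (\<lambda>k. deriv (g k) w) sums R' w"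
proof -
  define H where "H = {w. c * Re w > p + 1 - real J}"
  have H: "open H"
  proof -
    have "H = {w. Re w > (p + 1 - real J) / c}"
      unfolding H_def using c by (auto simp: field_simps)
    then show ?thesis by (simp add: open_halfplane)
  qed
  have hol: "g k holomorphic_on UNIV" for k
    unfolding g_def using a b by (intro holomorphic_intros) auto
  have der: "(g k has_field_derivative deriv (g k) w) (at w)" for k w
    using holomorphic_derivI[OF hol open_UNIV] by auto
  have bound: "\<exists>d h. 0 < d \<and> summable h \<and> (\<forall>k. h k \<ge> 0) \<and>
     (\<forall>\<^sub>F k in sequentially. \<forall>y\<in>ball x d. cmod (g k y) \<le> h k)" if x: "x \<in> H" for x
  proof -
    \<comment> \<open>Half the distance from \<open>x\<close> to the boundary line of
      \<open>H\<close>, which keeps the exponent \<open>s\<close> below \<open>- 1\<close> for the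
      whole ball.\<close>
    define d where "d = (c * Re x - (p + 1 - real J)) / (2 * c)"
    have d: "d > 0" using x c unfolding d_def H_def by simp
    define s where "s = p - real J - c * (Re x - d)"
    have "c * d = (c * Re x - (p + 1 - real J)) / 2"
      using c unfolding d_def by simp
    then have s: "s < - 1"
      using x unfolding s_def H_def by (simp add: right_diff_distrib field_simps)
    obtain C where C: "C \<ge> 0" "\<And>v t. \<lbrakk>norm v \<le> norm v0 + norm x + d; 0 \<le> t; t \<le> 1/2\<rbrakk>
         \<Longrightarrow> norm (binom_rem J v t) \<le> C * t ^ J"
      using binom_rem_bound[of "norm v0 + norm x + d" J] d by auto
    define h where "h k = C * b ^ J * real k powr s" for k
    have "summable h"
      unfolding h_def using s by (intro summable_mult) (simp add: summable_real_powr_iff)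
    moreover have "h k \<ge> 0" for k
      unfolding h_def using C b by simp
    moreover have "\<forall>\<^sub>F k in sequentially. \<forall>y\<in>ball x d. cmod (g k y) \<le> h k"
      \<comment> \<open>From \<open>k \<ge> 2 * b\<close> follows \<open>b / u \<le> 1/2\<close>,
        the range in which \<open>binom_rem_bound\<close> holds.\<close>
      using eventually_ge_at_top[of "nat \<lceil>2 * b\<rceil> + 1"]
    proof eventually_elim
      case (elim k)
      then have k: "real k \<ge> 2 * b" "real k \<ge> 1" by linarith+
      define u where "u = real k + a"
      have u: "u \<ge> real k" "u \<ge> 1" "u > 0" "u \<ge> 2 * b" using k a unfolding u_def by auto
      show ?case
      proof
        fix y assume y: "y \<in> ball x d"
        then have nd: "norm (x - y) < d" by (simp add: dist_norm)
        have "norm (v0 - y) \<le> norm v0 + norm y" by (rule norm_triangle_ineq4)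
        moreover have "norm y \<le> norm x + d"
          using nd norm_triangle_sub[of y x] by (simp add: norm_minus_commute)
        ultimately have n1: "norm (v0 - y) \<le> norm v0 + norm x + d" by simp
        have "Re x - Re y \<le> norm (x - y)"
          using complex_Re_le_cmod[of "x - y"] by simp
        then have re: "Re y \<ge> Re x - d" using nd by simp
        have cre: "c * (Re x - d) \<le> c * Re y"
          using re c by (intro mult_left_mono) auto
        have "cmod (g k y) = u powr (p - c * Re y) * norm (binom_rem J (v0 - y) (b / u))"
          unfolding g_def u_def[symmetric] using u by (simp add: norm_mult norm_powr_of_real)
        also have "\<dots> \<le> u powr (p - c * (Re x - d)) * (C * (b / u) ^ J)"
          using u cre b by (intro mult_mono powr_mono C n1) (auto simp: field_simps)
        also have "\<dots> = C * b ^ J * u powr s"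
        proof -
          have "s = (p - c * (Re x - d)) - real J" unfolding s_def by simp
          then have "u powr s = u powr (p - c * (Re x - d)) / u ^ J"
            using u by (simp only: powr_diff powr_realpow)
          then show ?thesis by (simp add: power_divide mult_ac)
        qed
        also have "\<dots> \<le> h k"
          unfolding h_def using u k s b C by (intro mult_left_mono powr_mono2') auto
        finally show "cmod (g k y) \<le> h k" .
      qed
    qed
    ultimately show ?thesis using d by blast
  qed
  have "\<exists>R R'. \<forall>x \<in> H. ((\<lambda>k. g k x) sums R x) \<and> ((\<lambda>k. deriv (g k) x) sums R' x) \<and> (R has_field_derivative R' x) (at x)"
  proof (rule series_and_derivative_comparison_complex[OF H der])
    fix x assume "x \<in> H"
    from bound[OF this] obtain d h where dh: "0 < d" "summable h" "\<And>k. h k \<ge> (0::real)"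
      "\<forall>\<^sub>F k in sequentially. \<forall>y\<in>ball x d. cmod (g k y) \<le> h k" by blast
    show "\<exists>d h. 0 < d \<and> summable h \<and> range h \<subseteq> \<real>\<^sub>\<ge>\<^sub>0 \<and> (\<forall>\<^sub>F n in sequentially. \<forall>y\<in>ball x d \<inter> H. cmod (g n y) \<le> cmod (h n))"
      by (intro exI[of _ d] exI[of _ "\<lambda>k. of_real (h k)"] conjI)
         (use dh in \<open>auto intro: summable_of_real elim!: eventually_mono\<close>)
  qed
  then obtain R R' where R: "\<And>x. x \<in> H \<Longrightarrow> ((\<lambda>k. g k x) sums R x)"
     "\<And>x. x \<in> H \<Longrightarrow> ((\<lambda>k. deriv (g k) x) sums R' x)" "\<And>x. x \<in> H \<Longrightarrow> (R has_field_derivative R' x) (at x)"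
    by blast
  have "((\<lambda>k. g k x) has_sum R x) UNIV" if x: "x \<in> H" for x
  proof -
    from bound[OF x] obtain d h where dh: "0 < d" "summable h"
      "\<forall>\<^sub>F k in sequentially. \<forall>y\<in>ball x d. cmod (g k y) \<le> h k" by blast
    have "summable (\<lambda>k. norm (g k x))"
      by (rule summable_comparison_test_ev[OF _ dh(2)]) (use dh in \<open>auto elim!: eventually_mono\<close>)
    then show ?thesis using R(1)[OF x] by (rule norm_summable_imp_has_sum)
  qed
  with R show ?thesis unfolding H_def by blast
qed

lemma powr_mult_inverse_power:
  "u > 0 \<Longrightarrow> of_real u powr (z :: complex) * of_real ((b / u) ^ j) = of_real (b ^ j) * of_real u powr (z - of_nat j)"
  by (simp add: powr_diff powr_nat' power_divide field_simps)

lemma powr_add_eq_mult: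
  assumes "u > 0" "b \<ge> 0"
  shows "of_real (u + b) powr (z :: complex) = of_real u powr z * of_real (1 + b / u) powr z"
proof -
  have "u + b = u * (1 + b / u)"
    using assms by (simp add: distrib_left)
  moreover have "1 + b / u \<ge> 0"
    using assms by simp
  ultimately show ?thesis
    using assms powr_times_real[of "of_real u" "of_real (1 + b / u)" z] by (simp only: of_real_mult) auto
qed

lemma binom_rem_expand:
  assumes "u > 0"
  shows "of_real u powr z * of_real (1 + b / u) powr v =
    (\<Sum>j<J. (v gchoose j) * of_real (b ^ j) * of_real u powr (z - of_nat j)) + of_real u powr z * binom_rem J v (b / u)"
  unfolding binom_rem_def ring_distribs sum_distrib_left
  using powr_mult_inverse_power[OF assms, of z b] by (simp add: mult_ac)

lemma gbinomial_Suc_eq: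
  "(z :: complex) gchoose Suc j = (z gchoose j) * (z - of_nat j) / of_nat (Suc j)"
  by (simp add: gbinomial_prod_rev fact_Suc del: of_nat_Suc)

lemma holomorphic_on_compose_shift:
  assumes "f holomorphic_on {w. Re w > r}" "\<And>w. w \<in> A \<Longrightarrow> r < Re (g w)" "g holomorphic_on A"
  shows "(\<lambda>w. f (g w)) holomorphic_on A"
  using holomorphic_on_compose_gen[OF assms(3,1)] assms(2) by (auto simp: o_def)

lemma binom_rem_0:
  assumes "J > 0" "t \<ge> 0"
  shows "binom_rem J 0 t = 0"
proof -
  have "1 + of_real t \<noteq> (0 :: complex)"
    using assms by (metis of_real_1 of_real_add of_real_eq_0_iff add_pos_nonneg less_irrefl zero_less_one)
  moreover obtain I where "J = Suc I" using assms by (cases J) auto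
  ultimately show ?thesis
    by (simp add: binom_rem_def sum.lessThan_Suc_shift del: sum.lessThan_Suc)
qed

text \<open>\<open>K w\<close> is \<open>w - 1\<close> times the Hurwitz zeta function, so
  \<open>K 1 = 1\<close> records the residue. The differences of \<open>u\<close> to the power
  \<open>1 - w\<close> at \<open>u + 1\<close> and \<open>u\<close> telescope over
  \<open>u = k + a\<close>, while their binomial expansion involves the zeta values at
  \<open>w + j\<close>. Solving for the term \<open>j = 0\<close> continues \<open>K\<close> by one
  unit to the left.\<close>

lemma hurwitz_zeta_halfplane:
  fixes a :: real
  assumes a: "a > 0"
  shows "\<exists>K. K holomorphic_on {w. Re w > 1 - real J} \<and>
     (\<forall>w. Re w > 1 \<longrightarrow> ((\<lambda>k. of_real (real k + a) powr (- w)) has_sum K w / (w - 1)) UNIV) \<and>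
     (J > 0 \<longrightarrow> K 1 = 1)"
proof (induction J)
  case 0
  from remainder_series[OF a order_refl zero_less_one, of 0 0 0]
  obtain R R' where "\<forall>w. 1 * Re w > 0 + 1 - real 0 \<longrightarrow>
       ((\<lambda>k. of_real (real k + a) powr (of_real 0 - of_real 1 * w) * binom_rem 0 (0 - w) (0 / (real k + a))) has_sum R w) UNIV
     \<and> (R has_field_derivative R' w) (at w)"
    by blast
  then have R: "\<And>w. Re w > 1 \<Longrightarrow>
       ((\<lambda>k. of_real (real k + a) powr (- w) * binom_rem 0 (- w) 0) has_sum R w) UNIV"
     "\<And>w. Re w > 1 \<Longrightarrow> (R has_field_derivative R' w) (at w)"
    by auto
  have sum: "((\<lambda>k. of_real (real k + a) powr (- w)) has_sum R w) UNIV" if "Re w > 1" for w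
    using R(1)[of w] that by (simp add: binom_rem_def)
  have "R holomorphic_on {w. Re w > 1}"
    using R(2) by (auto intro!: holomorphic_on_open[THEN iffD2] simp: open_halfplane)
  then have "(\<lambda>w. (w - 1) * R w) holomorphic_on {w. Re w > 1 - real 0}"
    by (auto intro!: holomorphic_intros)
  then show ?case
    using sum by (intro exI[of _ "\<lambda>w. (w - 1) * R w"]) auto
next
  case (Suc J)
  then obtain K where K: "K holomorphic_on {w. Re w > 1 - real J}"
    "\<And>w. Re w > 1 \<Longrightarrow> ((\<lambda>k. of_real (real k + a) powr (- w)) has_sum K w / (w - 1)) UNIV" by blast
  \<comment> \<open>Exponent \<open>p = 1\<close>, step \<open>b = 1\<close> and
    \<open>J + 2\<close> terms: the remainder converges for \<open>Re w > - J\<close>, one unit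
    beyond the domain of \<open>K\<close>.\<close>
  from remainder_series[OF a zero_le_one zero_less_one, of 1 "J + 2" 1]
  obtain R R' where "\<forall>w. 1 * Re w > 1 + 1 - real (J + 2) \<longrightarrow>
       ((\<lambda>k. of_real (real k + a) powr (of_real 1 - of_real 1 * w) * binom_rem (J + 2) (1 - w) (1 / (real k + a))) has_sum R w) UNIV
     \<and> (R has_field_derivative R' w) (at w)"
    by blast
  then have R: "\<And>w. Re w > - real J \<Longrightarrow>
       ((\<lambda>k. of_real (real k + a) powr (1 - w) * binom_rem (J + 2) (1 - w) (1 / (real k + a))) has_sum R w) UNIV"
     "\<And>w. Re w > - real J \<Longrightarrow> (R has_field_derivative R' w) (at w)"
    by auto
  \<comment> \<open>The telescoped identity solved for \<open>K w\<close>. The denominators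
    \<open>w + j - 1\<close> of the zeta values have been absorbed into the binomial coefficients,
    so no poles are left.\<close>
  define L where "L w = of_real a powr (1 - w) -
     (\<Sum>j=1..<J+1. ((1 - w) gchoose j) / of_nat (Suc j) * K (w + of_nat j)) + R w" for w
  have LK: "L w = K w" if w: "Re w > 1" for w
  proof -
    define u where "u k = real k + a" for k
    have u: "u k > 0" for k unfolding u_def using a by simp
    have "(\<lambda>k. of_real (u k) powr (1 - w)) \<longlonglongrightarrow> 0"
    proof (rule tendsto_norm_zero_cancel)
      have "(\<lambda>k. u k powr (1 - Re w)) \<longlonglongrightarrow> 0"
        unfolding u_def using w a
        by (intro tendsto_neg_powr filterlim_at_top_mono[OF filterlim_real_sequentially]) auto
      then show "(\<lambda>k. norm (of_real (u k) powr (1 - w))) \<longlonglongrightarrow> 0"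
        using u by (simp add: norm_powr_of_real)
    qed
    from telescope_sums[OF this]
    have tel: "(\<lambda>k. of_real (u (Suc k)) powr (1 - w) - of_real (u k) powr (1 - w)) sums (- (of_real a powr (1 - w)))"
      by (simp add: u_def)
    have z: "(\<lambda>k. of_real (u k) powr (- (w + of_nat j))) sums (K (w + of_nat j) / (w + of_nat j - 1))" for j
      using has_sum_imp_sums[OF K(2)[of "w + of_nat j"]] w unfolding u_def by simp
    have step: "of_real (u (Suc k)) powr (1 - w) - of_real (u k) powr (1 - w) =
       (\<Sum>j<J+1. ((1 - w) gchoose Suc j) * of_real (u k) powr (- (w + of_nat j))) +
       of_real (u k) powr (1 - w) * binom_rem (J + 2) (1 - w) (1 / u k)" for k
    proof -
      have "of_real (u (Suc k)) powr (1 - w) = of_real (u k + 1) powr (1 - w)"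
        by (simp add: u_def add_ac)
      also have "\<dots> = (\<Sum>j<Suc (J + 1). ((1 - w) gchoose j) * of_real (1 ^ j) * of_real (u k) powr (1 - w - of_nat j)) +
          of_real (u k) powr (1 - w) * binom_rem (J + 2) (1 - w) (1 / u k)"
        using powr_add_eq_mult[OF u, of 1 k "1 - w"] binom_rem_expand[OF u, of k "1 - w" 1 "1 - w" "J + 2"] by simp
      finally show ?thesis
        by (subst (asm) sum.lessThan_Suc_shift) (simp add: algebra_simps)
    qed
    have "(\<lambda>k. of_real (u (Suc k)) powr (1 - w) - of_real (u k) powr (1 - w)) sums
       ((\<Sum>j<J+1. ((1 - w) gchoose Suc j) * (K (w + of_nat j) / (w + of_nat j - 1))) + R w)"
      unfolding step
      by (intro sums_add sums_sum sums_mult z) (use has_sum_imp_sums[OF R(1)[of w]] w in \<open>simp add: u_def\<close>)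
    from sums_unique2[OF this tel]
    have "(\<Sum>j<J+1. ((1 - w) gchoose Suc j) * (K (w + of_nat j) / (w + of_nat j - 1))) + R w = - (of_real a powr (1 - w))" .
    also have "(\<Sum>j<J+1. ((1 - w) gchoose Suc j) * (K (w + of_nat j) / (w + of_nat j - 1)))
        = (\<Sum>j<J+1. - (((1 - w) gchoose j) / of_nat (Suc j) * K (w + of_nat j)))"
    proof (rule sum.cong)
      fix j
      have "Re (w + of_nat j - 1) > 0" using w by simp
      then have nz: "w + of_nat j - 1 \<noteq> 0" by force
      have "((1 - w) gchoose Suc j) = - (((1 - w) gchoose j) * (w + of_nat j - 1) / of_nat (Suc j))"
        unfolding gbinomial_Suc_eq by (simp add: algebra_simps diff_divide_distrib del: of_nat_Suc)
      then show "((1 - w) gchoose Suc j) * (K (w + of_nat j) / (w + of_nat j - 1)) =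
         - (((1 - w) gchoose j) / of_nat (Suc j) * K (w + of_nat j))"
        using nz by (simp del: of_nat_Suc)
    qed auto
    also have "\<dots> = - K w - (\<Sum>j=1..<J+1. ((1 - w) gchoose j) / of_nat (Suc j) * K (w + of_nat j))"
      by (simp add: lessThan_atLeast0 sum.atLeast_Suc_lessThan[of 0] sum_negf del: sum.op_ivl_Suc)
    finally show ?thesis
      unfolding L_def by (simp add: algebra_simps)
  qed
  have L: "L holomorphic_on {w. Re w > 1 - real (Suc J)}"
    unfolding L_def using a R(2)
    by (intro holomorphic_intros holomorphic_on_compose_shift[OF K(1)])
       (auto intro!: holomorphic_on_open[THEN iffD2] simp: open_halfplane)
  \<comment> \<open>At \<open>w = 1\<close> the exponent \<open>1 - w\<close> is \<open>0\<close>: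
    the remainder and all binomial coefficients with \<open>j \<ge> 1\<close> vanish, and only
    \<open>a\<close> to the power \<open>0\<close> remains in \<open>L 1\<close>.\<close>
  have "R 1 = 0"
  proof -
    have "((\<lambda>k::nat. 0) has_sum R 1) UNIV"
      using R(1)[of 1] a by (simp add: binom_rem_0)
    then show ?thesis
      by (rule has_sum_unique) (simp add: has_sum_0)
  qed
  then have "L 1 = 1"
    unfolding L_def using a by (simp add: gbinomial_0_left sum.neutral)
  with L LK K(2) show ?case by (intro exI[of _ L]) auto
qed

lemma hurwitz_zeta:
  fixes a :: real
  assumes a: "a > 0"
  obtains K where "K holomorphic_on UNIV" "K 1 = 1"
    "\<And>w. Re w > 1 \<Longrightarrow> ((\<lambda>k. of_real (real k + a) powr (- w)) has_sum K w / (w - 1)) UNIV"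
proof -
  have "\<exists>K. \<forall>J. K J holomorphic_on {w. Re w > 1 - real (J + 1)} \<and>
     (\<forall>w. Re w > 1 \<longrightarrow> ((\<lambda>k. of_real (real k + a) powr (- w)) has_sum K J w / (w - 1)) UNIV) \<and>
     K J 1 = 1"
    using hurwitz_zeta_halfplane[OF a] by (intro choice allI) (metis add_gr_0 zero_less_one)
  then obtain K where K: "\<And>J. K J holomorphic_on {w. Re w > - real J}"
    "\<And>J w. Re w > 1 \<Longrightarrow> ((\<lambda>k. of_real (real k + a) powr (- w)) has_sum K J w / (w - 1)) UNIV"
    "\<And>J. K J 1 = 1"
    by auto
  have eq: "K J w = K 0 w" if "Re w > 1" for J w
  proof -
    have "K J w / (w - 1) = K 0 w / (w - 1)"
      using K(2)[OF that] has_sum_unique by blast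
    then show ?thesis using that by (auto split: if_splits)
  qed
  have nic: "K J nicely_meromorphic_on {w. Re w > - real J}" for J
    using K(1)[of J] by (intro analytic_on_imp_nicely_meromorphic_on) (simp add: analytic_on_open open_halfplane)
  obtain Y where Y: "Y nicely_meromorphic_on UNIV" "\<And>J w. Re w > - real J \<Longrightarrow> Y w = K J w"
    using nicely_meromorphic_glue[of K "\<lambda>_. 1" "K 0", OF nic eq] by blast
  have "Y field_differentiable at w" for w
  proof -
    obtain J where J: "- Re w < real J" using reals_Archimedean2 by blast
    have "Y holomorphic_on {w. Re w > - real J}"
      by (rule holomorphic_transform[OF K(1)[of J]]) (use Y in auto)
    then show ?thesis
      using J by (auto intro!: holomorphic_on_imp_differentiable_at simp: open_halfplane)
  qed
  then have "Y holomorphic_on UNIV"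
    by (simp add: holomorphic_on_def)
  moreover have "Y 1 = 1" using Y(2)[of 0 1] K(3) by simp
  moreover have "((\<lambda>k. of_real (real k + a) powr (- w)) has_sum Y w / (w - 1)) UNIV" if "Re w > 1" for w
    using Y(2)[of 0 w] K(2)[OF that, of 0] that by simp
  ultimately show ?thesis using that by blast
qed

lemma minus_one_gbinomial: "((- 1 :: complex) gchoose d) = (- 1) ^ d"
  using gbinomial_minus[of "1 :: complex" d] by (simp flip: binomial_gbinomial)

text \<open>Source of the harmonic numbers in \<open>f_exponent\<close>: up to the sign
  \<open>(- 1) ^ d\<close> the coefficient is the product of the \<open>(w + i) / i\<close> for
  \<open>i = 1, ..., d\<close>, whose logarithmic derivative at \<open>0\<close> is the sum of the
  \<open>1 / i\<close>.\<close>

lemma gbinomial_minus_deriv: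
  "((\<lambda>w. (- w - 1) gchoose d) has_field_derivative (- 1) ^ d * (\<Sum>j=1..d. 1 / of_nat j)) (at (0::complex))"
proof (induction d)
  case (Suc d)
  have v: "((- 0 - 1 :: complex) gchoose d) = (- 1) ^ d"
    by (simp add: minus_one_gbinomial)
  have "((\<lambda>w. - w - 1 - of_nat d) has_field_derivative - 1) (at (0 :: complex))"
    by (rule derivative_eq_intros refl | simp)+
  from DERIV_cdivide[OF DERIV_mult[OF Suc this], of "of_nat (Suc d)"]
  have "((\<lambda>w. ((- w - 1) gchoose d) * (- w - 1 - of_nat d) / of_nat (Suc d)) has_field_derivative
     ((- 1) ^ d * (\<Sum>j=1..d. 1 / of_nat j) * (- 0 - 1 - of_nat d) + - 1 * (- 1) ^ d) / of_nat (Suc d)) (at (0::complex))"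
    unfolding v .
  also have "((- 1) ^ d * (\<Sum>j=1..d. 1 / of_nat j) * (- 0 - 1 - of_nat d) + - 1 * (- 1) ^ d) / of_nat (Suc d)
     = (- 1) ^ Suc d * (\<Sum>j=1..Suc d. 1 / (of_nat j :: complex))"
  proof -
    have "(e * S * (- m) + - 1 * e) / m = - e * (S + 1 / m)" if "m \<noteq> 0" for e S m :: complex
      using that by (simp add: field_simps)
    from this[of "of_nat (Suc d)" "(- 1) ^ d" "\<Sum>j=1..d. 1 / of_nat j", OF of_nat_neq_0] show ?thesis
      by (simp add: algebra_simps)
  qed
  finally show ?case unfolding gbinomial_Suc_eq .
qed auto

subsection \<open>Regularized products and Barnes gamma functions\<close>

text \<open>
  The \<open>j\<close>-th term of the binomial expansion, with \<open>K(w)/(w - 1)\<close> the Hurwitz zeta function. For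
  \<open>j = d + 1\<close> the zero of the binomial coefficient at \<open>w = 0\<close> cancels the pole of the zeta function.
\<close>

definition zeta_term :: "(complex \<Rightarrow> complex) \<Rightarrow> real \<Rightarrow> nat \<Rightarrow> nat \<Rightarrow> nat \<Rightarrow> complex \<Rightarrow> complex" where
  "zeta_term K b d c j w = of_real (b ^ j) *
     (if j = d + 1 then - (((- w - 1) gchoose d) / of_nat (d + 1)) * (K (1 + of_nat c * w) / of_nat c)
      else ((- w) gchoose j) *
           (K (of_nat c * w + of_nat j - of_nat d) / (of_nat c * w + of_nat j - of_nat d - 1)))"

text \<open>The part of the derivative of \<open>zeta_term\<close> at \<open>0\<close> that does not
  depend on \<open>c\<close>. Parts proportional to \<open>c\<close> and to \<open>1 / c\<close>
  arise only for \<open>j = 0\<close> and \<open>j = d + 1\<close>, respectively.\<close>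

definition zeta_term_deriv :: "(complex \<Rightarrow> complex) \<Rightarrow> real \<Rightarrow> nat \<Rightarrow> nat \<Rightarrow> complex" where
  "zeta_term_deriv K b d j = of_real (b ^ j) *
     (if j = 0 then 0
      else if j = d + 1 then - ((- 1) ^ d / of_nat (d + 1)) * deriv K 1
      else - ((((- 1) gchoose (j - 1)) / of_nat j) * (K (of_nat j - of_nat d) / (of_nat j - of_nat d - 1))))"

lemma holomorphic_compose_UNIV:
  assumes "K holomorphic_on UNIV" "g holomorphic_on A"
  shows "(\<lambda>w. K (g w)) holomorphic_on A"
  using holomorphic_on_compose_gen[OF assms(2,1)] by (simp add: o_def)

lemma gbinomial_absorb_minus:
  assumes "j > 0"
  shows "(- w :: complex) gchoose j = - w * (((- w - 1) gchoose (j - 1)) / of_nat j)"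
  using gbinomial_absorption'[OF assms, of "- w"] by simp

lemma of_nat_diff_eq_1_D:
  assumes "of_nat j - of_nat d - 1 = (0 :: complex)"
  shows "j = d + 1"
proof -
  have "(of_nat j :: complex) = of_nat (d + 1)" using assms by (simp add: algebra_simps)
  then show ?thesis by (simp only: of_nat_eq_iff)
qed

context
  fixes K :: "complex \<Rightarrow> complex"
  assumes K: "K holomorphic_on UNIV"
begin

lemma K_deriv: "(K has_field_derivative deriv K z) (at z)"
  using holomorphic_derivI[OF K open_UNIV] by auto

lemma zeta_term_holomorphic:
  assumes "\<And>w. w \<in> A \<Longrightarrow> j = d + 1 \<or> of_nat c * w + of_nat j - of_nat d - 1 \<noteq> 0"
  shows "zeta_term K b d c j holomorphic_on A"
proof (cases "j = d + 1")
  case True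
  then show ?thesis unfolding zeta_term_def
    by (cases "c = 0") (auto intro!: holomorphic_intros holomorphic_compose_UNIV[OF K])
next
  case False
  with assms show ?thesis unfolding zeta_term_def
    by (auto intro!: holomorphic_intros holomorphic_compose_UNIV[OF K])
qed

lemma zeta_term_meromorphic: "zeta_term K b d c j meromorphic_on UNIV"
proof -
  have *: "f meromorphic_on UNIV" if "f holomorphic_on UNIV" for f
    using that by (intro analytic_on_imp_meromorphic_on) (simp add: analytic_on_open)
  show ?thesis
  proof (cases "j = d + 1")
    case True
    then show ?thesis by (intro * zeta_term_holomorphic) auto
  next
    case False
    have "(\<lambda>w. of_real (b ^ j) * (((- w) gchoose j) * K (of_nat c * w + of_nat j - of_nat d)) /
             (of_nat c * w + of_nat j - of_nat d - 1)) meromorphic_on UNIV"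
      by (intro meromorphic_on_divide *) (auto intro!: holomorphic_intros holomorphic_compose_UNIV[OF K])
    then show ?thesis
      using False unfolding zeta_term_def by simp
  qed
qed

lemma zeta_term_analytic:
  assumes "j = d + 1 \<or> of_nat c * w + of_nat j - of_nat d - 1 \<noteq> 0"
  shows "zeta_term K b d c j analytic_on {w}"
proof -
  define A where "A = {w. j = d + 1 \<or> of_nat c * w + of_nat j - of_nat d - 1 \<noteq> (0 :: complex)}"
  have "open A"
    unfolding A_def by (cases "j = d + 1") (auto intro!: open_Collect_neq continuous_intros)
  moreover have "zeta_term K b d c j holomorphic_on A"
    by (rule zeta_term_holomorphic) (auto simp: A_def)
  moreover have "w \<in> A" using assms by (auto simp: A_def)
  ultimately show ?thesis
    using analytic_at by blast
qed

lemma zeta_term_analytic_0: "zeta_term K b d c j analytic_on {0}"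
proof (rule zeta_term_analytic)
  show "j = d + 1 \<or> of_nat c * 0 + of_nat j - of_nat d - 1 \<noteq> (0 :: complex)"
    using of_nat_diff_eq_1_D[of j d] by auto
qed

text \<open>For \<open>j = 0\<close> the term is a function of \<open>c * w\<close>, and the chain
  rule gives the factor \<open>c\<close>. For \<open>j = d + 1\<close> the product rule gives one
  part with \<open>K 1 / c\<close> and one in which \<open>c\<close> cancels. All other terms carry
  a factor \<open>- w\<close>, so only the value at \<open>0\<close> of the cofactor survives, and
  it is free of \<open>c\<close>.\<close>

lemma zeta_term_has_derivative:
  assumes K1: "K 1 = 1" and c: "c > 0"
  shows "(zeta_term K b d c j has_field_derivative
     zeta_term_deriv K b d j +
     (if j = 0 then of_nat c * deriv (\<lambda>v. K (v - of_nat d) / (v - of_nat d - 1)) 0 else 0) +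
     (if j = d + 1 then of_real (b ^ (d + 1)) * (- ((- 1) ^ d * (\<Sum>j=1..d. 1 / of_nat j) / of_nat (d + 1))) / of_nat c else 0))
     (at 0)"
proof -
  consider "j = 0" | "j = d + 1" | "j \<noteq> 0" "j \<noteq> d + 1" by blast
  then show ?thesis
  proof cases
    case 1
    define f where "f v = K (v - of_nat d) / (v - of_nat d - 1)" for v
    have "of_nat d + 1 \<noteq> (0 :: complex)"
      by (metis of_nat_Suc of_nat_neq_0 add.commute)
    then have "- of_nat d - 1 \<noteq> (0 :: complex)"
      by (metis add.inverse_inverse minus_add_distrib neg_equal_0_iff_equal uminus_add_conv_diff add.commute diff_conv_add_uminus)
    then have "\<exists>D. (f has_field_derivative D) (at 0)"
      unfolding f_def
      by (intro exI) (rule derivative_eq_intros DERIV_chain2[OF K_deriv] refl | simp)+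
    then have "(f has_field_derivative deriv f 0) (at 0)"
      using DERIV_imp_deriv by blast
    then have "((\<lambda>w. f (of_nat c * w)) has_field_derivative deriv f 0 * of_nat c) (at 0)"
      by (intro DERIV_chain2[where f = f]) (auto intro!: derivative_eq_intros)
    moreover have "zeta_term K b d c j = (\<lambda>w. f (of_nat c * w))"
      using 1 by (auto simp: zeta_term_def f_def fun_eq_iff)
    ultimately show ?thesis
      using 1 by (simp add: zeta_term_deriv_def f_def[abs_def] mult.commute)
  next
    case 2
    define E where "E = (- 1) ^ d * (\<Sum>j=1..d. 1 / of_nat j :: complex)"
    have d1: "((\<lambda>w. K (1 + of_nat c * w)) has_field_derivative deriv K 1 * of_nat c) (at 0)"
      by (intro DERIV_chain2[where f = K]) (use K_deriv[of 1] in \<open>auto intro!: derivative_eq_intros\<close>)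
    have d2: "((\<lambda>w. (- w - 1) gchoose d) has_field_derivative E) (at (0 :: complex))"
      unfolding E_def by (rule gbinomial_minus_deriv)
    have "((\<lambda>w. of_real (b ^ j) * (- (((- w - 1) gchoose d) / of_nat (d + 1)) * (K (1 + of_nat c * w) / of_nat c)))
        has_field_derivative of_real (b ^ j) * (- (E / of_nat (d + 1)) * (K (1 + of_nat c * 0) / of_nat c) +
            deriv K 1 * of_nat c / of_nat c * (- (((- 0 - 1) gchoose d) / of_nat (d + 1))))) (at 0)"
      by (intro DERIV_cmult DERIV_mult DERIV_minus DERIV_cdivide d1 d2)
    moreover have "zeta_term K b d c j = (\<lambda>w. of_real (b ^ j) * (- (((- w - 1) gchoose d) / of_nat (d + 1)) * (K (1 + of_nat c * w) / of_nat c)))"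
      using 2 by (auto simp: zeta_term_def fun_eq_iff)
    ultimately show ?thesis
      using 2 c by (simp add: zeta_term_deriv_def K1 E_def minus_one_gbinomial algebra_simps del: of_nat_Suc power_Suc)
  next
    case 3
    define h where "h w = of_real (b ^ j) * ((((- w - 1) gchoose (j - 1)) / of_nat j) *
       (K (of_nat c * w + of_nat j - of_nat d) / (of_nat c * w + of_nat j - of_nat d - 1)))" for w
    define A where "A = {w. of_nat c * w + of_nat j - of_nat d - 1 \<noteq> (0 :: complex)}"
    have A: "open A" unfolding A_def by (intro open_Collect_neq continuous_intros)
    have A0: "0 \<in> A" using 3 of_nat_diff_eq_1_D[of j d] unfolding A_def by auto
    have "h holomorphic_on A"
      unfolding h_def A_def by (auto intro!: holomorphic_intros holomorphic_compose_UNIV[OF K] simp: 3)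
    then have hd: "(h has_field_derivative deriv h 0) (at 0)"
      using A A0 by (rule holomorphic_derivI)
    have "((\<lambda>w. - w * h w) has_field_derivative (- 1 * h 0 + deriv h 0 * (- 0))) (at 0)"
      by (intro DERIV_mult hd) (auto intro!: derivative_eq_intros)
    moreover have "zeta_term K b d c j = (\<lambda>w. - w * h w)"
      using 3 by (auto simp: zeta_term_def h_def fun_eq_iff gbinomial_absorb_minus[of j])
    ultimately show ?thesis
      using 3 by (simp add: zeta_term_deriv_def h_def)
  qed
qed

lemma zeta_term_has_sum:
  assumes sum: "\<forall>w. Re w > 1 \<longrightarrow> ((\<lambda>k. of_real (real k + a) powr (- w)) has_sum K w / (w - 1)) UNIV"
    and c: "c > 0" and w: "real c * Re w > real d + 1"
  shows "((\<lambda>k. ((- w) gchoose j) * of_real (b ^ j) * of_real (real k + a) powr (of_nat d - of_nat c * w - of_nat j))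
     has_sum zeta_term K b d c j w) UNIV"
proof -
  define w' where "w' = of_nat c * w + of_nat j - of_nat d"
  have w': "Re w' > 1" using w by (simp add: w'_def)
  have "real c * Re w > 0" using w by (auto intro: le_less_trans[rotated])
  then have w0: "w \<noteq> 0" by auto
  have "((\<lambda>k. (((- w) gchoose j) * of_real (b ^ j)) * of_real (real k + a) powr (- w'))
     has_sum (((- w) gchoose j) * of_real (b ^ j)) * (K w' / (w' - 1))) UNIV"
    using sum w' by (intro has_sum_cmult_right) blast
  moreover have "(((- w) gchoose j) * of_real (b ^ j)) * (K w' / (w' - 1)) = zeta_term K b d c j w"
  proof (cases "j = d + 1")
    case True
    then have eqs: "w' = 1 + of_nat c * w" "w' - 1 = of_nat c * w" by (simp_all add: w'_def)
    have "((- w) gchoose j) = - w * (((- w - 1) gchoose d) / of_nat (d + 1))"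
      using gbinomial_absorb_minus[of j w] True by simp
    then show ?thesis
      using True c w0 unfolding zeta_term_def eqs by (simp add: mult_ac del: of_nat_Suc power_Suc)
  qed (simp add: zeta_term_def w'_def mult_ac)
  moreover have "- w' = of_nat d - of_nat c * w - of_nat j" by (simp add: w'_def)
  ultimately show ?thesis by simp
qed

end

lemma has_sum_finite_sum:
  fixes f :: "'i \<Rightarrow> 'a \<Rightarrow> 'b :: topological_comm_monoid_add"
  assumes "\<And>i. i \<in> I \<Longrightarrow> (f i has_sum S i) A"
  shows "((\<lambda>x. \<Sum>i\<in>I. f i x) has_sum (\<Sum>i\<in>I. S i)) A"
  using assms by (induction I rule: infinite_finite_induct) (auto intro!: has_sum_add)

text \<open>The expansion is cut at lengths \<open>N J\<close> that grow with the half-plane, and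
  the pieces are glued. The derivative at \<open>0\<close> is read off from the cut
  \<open>J = 1\<close>, whose half-plane \<open>Re w > - 1\<close> contains
  \<open>0\<close>.\<close>

lemma monomial_continuation_aux:
  fixes a b :: real and c d :: nat
  defines "u \<equiv> \<lambda>k. real k + a"
  assumes K: "K holomorphic_on UNIV" "K 1 = 1"
    and sumK: "\<forall>w. Re w > 1 \<longrightarrow> ((\<lambda>k. of_real (real k + a) powr (- w)) has_sum K w / (w - 1)) UNIV"
    and a: "a > 0" and b: "b \<ge> 0" and c: "c > 0" "c \<le> 2"
  shows "zeta_deriv UNIV
    (\<lambda>k w. of_real (u k) ^ d * of_real (u k) powr (- (of_nat c * w)) * of_real (1 + b / u k) powr (- w))
    (of_nat c * deriv (\<lambda>v. K (v - of_nat d) / (v - of_nat d - 1)) 0 +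
     ((\<Sum>j<d+4. zeta_term_deriv K b d j) +
      (\<Sum>k. of_real (u k) ^ d * deriv (\<lambda>w. binom_rem (d + 4) (- w) (b / u k)) 0)) +
     of_real (b ^ (d + 1)) * (- ((- 1) ^ d * (\<Sum>j=1..d. 1 / of_nat j) / of_nat (d + 1))) / of_nat c)"
proof -
  define S where "S = (\<Sum>k. of_real (u k) ^ d * deriv (\<lambda>w. binom_rem (d + 4) (- w) (b / u k)) 0)"
  define f where "f k w = of_real (u k) ^ d * of_real (u k) powr (- (of_nat c * w)) * of_real (1 + b / u k) powr (- w)" for k and w :: complex
  have u: "u k > 0" for k unfolding u_def using a by simp
  \<comment> \<open>Chosen so that \<open>d + 1 - N J = - 2 * J - 1\<close>. As
    \<open>c \<le> 2\<close>, the remainder then converges on all of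
    \<open>Re w > - J\<close>.\<close>
  define N where "N J = 2 * J + d + 2" for J
  define g where "g = (\<lambda>J k w. of_real (u k) powr (of_nat d - of_nat c * w) * binom_rem (N J) (- w) (b / u k))"
  define Q where "Q J R R' \<longleftrightarrow> (\<forall>w. real c * Re w > real d + 1 - real (N J) \<longrightarrow>
      ((\<lambda>k. g J k w) has_sum R w) UNIV \<and> (R has_field_derivative R' w) (at w) \<and>
      (\<lambda>k. deriv (g J k) w) sums R' w)" for J R R'
  have "\<forall>J. \<exists>R R'. Q J R R'"
  proof
    fix J
    show "\<exists>R R'. Q J R R'"
      using remainder_series[OF a b, of "real c" "real d" "N J" 0] c
      by (simp only: Q_def g_def u_def of_real_of_nat_eq diff_0 of_nat_0_less_iff simp_thms)
  qed
  then obtain R R' where "\<And>J. Q J (R J) (R' J)"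
    by metis
  note RR = this[unfolded Q_def, rule_format]
  have dom: "real c * Re w > real d + 1 - real (N J)" if "Re w > - real J" for J w
  proof (cases "Re w \<ge> 0")
    case True
    then have "real c * Re w \<ge> 0" by simp
    then show ?thesis unfolding N_def by simp
  next
    case False
    then have "real c * Re w \<ge> 2 * Re w"
      using c by (intro mult_right_mono_neg) auto
    then show ?thesis using that unfolding N_def by simp
  qed
  have dom0: "real c * Re 0 > real d + 1 - real (N J)" for J unfolding N_def by simp
  define M where "M J w = (\<Sum>j<N J. zeta_term K b d c j w) + R J w" for J w
  have Rhol: "R J holomorphic_on A" if "open A" "\<And>w. w \<in> A \<Longrightarrow> real c * Re w > real d + 1 - real (N J)" for J A
    unfolding holomorphic_on_open[OF that(1)] using RR that(2) by blast
  have Ran: "R J analytic_on {w. Re w > - real J}" for J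
    unfolding analytic_on_open[OF open_halfplane] using dom by (intro Rhol open_halfplane) auto
  have "R J analytic_on {0}" for J
  proof -
    define A where "A = {w. real c * Re w > real d + 1 - real (N J)}"
    have "open A" unfolding A_def
      by (intro open_Collect_less continuous_intros)
    moreover have "R J holomorphic_on A"
      using \<open>open A\<close> by (rule Rhol) (simp add: A_def)
    moreover have "0 \<in> A" using dom0 unfolding A_def by simp
    ultimately show ?thesis using analytic_at by blast
  qed
  then have Man0: "M J analytic_on {0}" for J
    unfolding M_def by (intro analytic_on_add analytic_on_sum zeta_term_analytic_0[OF K(1)])
  have Mmero: "M J meromorphic_on {w. Re w > - real J}" for J
    unfolding M_def
    by (intro meromorphic_on_add meromorphic_on_sum analytic_on_imp_meromorphic_on[OF Ran]
          meromorphic_on_subset[OF zeta_term_meromorphic[OF K(1)]]) auto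
  have big: "real c * Re w > real d + 1" if "Re w > real d + 1" for w
  proof -
    have "real c * Re w \<ge> 1 * Re w" using c that by (intro mult_right_mono) auto
    then show ?thesis using that by linarith
  qed
  have Man: "M J analytic_on {w. Re w > real d + 1}" for J
  proof -
    have "zeta_term K b d c j analytic_on {w. Re w > real d + 1}" for j
    proof (subst analytic_on_analytic_at, intro ballI zeta_term_analytic[OF K(1)])
      fix w assume "w \<in> {w. Re w > real d + 1}"
      then have "Re (of_nat c * w + of_nat j - of_nat d - 1) > 0" using big[of w] by simp
      then show "j = d + 1 \<or> of_nat c * w + of_nat j - of_nat d - 1 \<noteq> 0" by force
    qed
    then show ?thesis
      unfolding M_def by (intro analytic_on_add analytic_on_sum analytic_on_subset[OF Ran]) auto
  qed
  have Msum: "((\<lambda>k. f k w) has_sum M J w) UNIV" if "Re w > real d + 1" for J w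
  proof -
    have "Re w > - real J" using that by simp
    then have r: "((\<lambda>k. g J k w) has_sum R J w) UNIV" using RR dom by blast
    have "((\<lambda>k. (\<Sum>j<N J. ((- w) gchoose j) * of_real (b ^ j) * of_real (u k) powr (of_nat d - of_nat c * w - of_nat j)) + g J k w)
       has_sum M J w) UNIV"
      unfolding M_def u_def
      by (intro has_sum_add has_sum_finite_sum zeta_term_has_sum[OF K(1) sumK c(1) big[OF that]] r[unfolded u_def])
    moreover have "(\<Sum>j<N J. ((- w) gchoose j) * of_real (b ^ j) * of_real (u k) powr (of_nat d - of_nat c * w - of_nat j)) + g J k w = f k w" for k
    proof -
      have "of_real (u k) powr (of_nat d - of_nat c * w) = of_real (u k) ^ d * of_real (u k) powr (- (of_nat c * w))"
        using u[of k] by (simp add: powr_diff powr_nat' powr_minus divide_inverse)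
      then show ?thesis
        unfolding f_def g_def
        using binom_rem_expand[OF u, of k "of_nat d - of_nat c * w" b "- w" "N J"] by simp
    qed
    ultimately show ?thesis by simp
  qed
  define Z where "Z J = remove_sings (M J)" for J
  have ZM: "Z J w = M J w" if "Re w > real d + 1" for J w
    unfolding Z_def using Man[of J] that by (intro remove_sings_at_analytic) (auto intro: analytic_on_subset)
  have Zn: "Z J nicely_meromorphic_on {w. Re w > - real J}" for J
    unfolding Z_def by (rule remove_sings_nicely_meromorphic[OF Mmero])
  have ZM0: "Z J w = M 0 w" if "Re w > real d + 1" for J w
    unfolding ZM[OF that] using Msum[OF that] by (rule has_sum_unique) (rule Msum[OF that])
  obtain Y where Y: "Y nicely_meromorphic_on UNIV" "\<And>J w. Re w > - real J \<Longrightarrow> Y w = Z J w"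
    using nicely_meromorphic_glue[of Z "\<lambda>_. real d + 1" "M 0", OF Zn ZM0] by blast
  have YM: "Y w = M 1 w" if "Re w > real d + 1" for w
    using Y(2)[of 1 w] ZM[OF that, of 1] that by simp
  have evY: "eventually (\<lambda>w. Y w = Z 1 w) (nhds 0)"
  proof -
    have "eventually (\<lambda>w. w \<in> {w. Re w > - real 1}) (nhds 0)"
      by (rule eventually_nhds_in_open[OF open_halfplane]) simp
    then show ?thesis by eventually_elim (use Y(2)[of 1] in auto)
  qed
  have Zan: "Z 1 analytic_on {0}"
    unfolding Z_def using Man0[of 1] by (rule remove_sings_analytic_on)
  have "Y analytic_on {0}"
    using analytic_at_cong[OF evY] Zan by simp
  moreover have "Y analytic_on {w. Re w > real d + 1}"
    using Man[of 1] YM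
    by (simp add: analytic_on_open open_halfplane) (metis (no_types, lifting) holomorphic_transform mem_Collect_eq)
  moreover have "((\<lambda>k. f k w) has_sum Y w) UNIV" if "Re w > real d + 1" for w
    unfolding YM[OF that] by (rule Msum[OF that])
  moreover have "deriv Y 0 =
     of_nat c * deriv (\<lambda>v. K (v - of_nat d) / (v - of_nat d - 1)) 0 +
     ((\<Sum>j<d+4. zeta_term_deriv K b d j) + S) +
     of_real (b ^ (d + 1)) * (- ((- 1) ^ d * (\<Sum>j=1..d. 1 / of_nat j) / of_nat (d + 1))) / of_nat c"
    (is "_ = of_nat c * ?A + (?B + S) + ?E")
  proof -
    have N1: "N 1 = d + 4" unfolding N_def by simp
    have R1: "(R 1 has_field_derivative R' 1 0) (at 0)" "(\<lambda>k. deriv (g 1 k) 0) sums R' 1 0"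
      using RR[OF dom0] by blast+
    \<comment> \<open>The remainder vanishes at \<open>w = 0\<close>, so the derivative of the power
      containing \<open>c\<close> drops out; this makes \<open>S\<close> independent of
      \<open>c\<close>.\<close>
    have "deriv (g 1 k) 0 = of_real (u k) ^ d * deriv (\<lambda>w. binom_rem (d + 4) (- w) (b / u k)) 0" for k
    proof -
      have "(\<lambda>w. binom_rem (d + 4) (- w) (b / u k)) holomorphic_on UNIV"
        using u[of k] b by (intro holomorphic_intros) auto
      from holomorphic_derivI[OF this open_UNIV, of 0]
      have d1: "((\<lambda>w. binom_rem (d + 4) (- w) (b / u k)) has_field_derivative deriv (\<lambda>w. binom_rem (d + 4) (- w) (b / u k)) 0) (at 0)"
        by simp
      have "(\<lambda>w :: complex. of_real (u k) powr (of_nat d - of_nat c * w)) holomorphic_on UNIV"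
        using u[of k] by (intro holomorphic_intros) auto
      from holomorphic_derivI[OF this open_UNIV, of 0]
      have d2: "((\<lambda>w :: complex. of_real (u k) powr (of_nat d - of_nat c * w)) has_field_derivative deriv (\<lambda>w :: complex. of_real (u k) powr (of_nat d - of_nat c * w)) 0) (at 0)"
        by simp
      have "binom_rem (d + 4) (- 0) (b / u k) = 0"
        using binom_rem_0[of "d + 4" "b / u k"] u[of k] b by simp
      then show ?thesis
        unfolding g_def N1 using DERIV_imp_deriv[OF DERIV_mult[OF d2 d1]] u[of k]
        by (simp add: powr_nat' mult.commute[of "of_real (u k) ^ d"])
    qed
    then have "R' 1 0 = S"
      using R1(2) unfolding S_def by (simp add: sums_iff)
    then have "(M 1 has_field_derivative
        (\<Sum>j<d+4. zeta_term_deriv K b d j + (if j = 0 then of_nat c * ?A else 0) + (if j = d + 1 then ?E else 0)) + S) (at 0)"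
      unfolding M_def N1 using R1(1)
      by (intro DERIV_add DERIV_sum zeta_term_has_derivative[OF K c(1)]) simp
    also have "(\<Sum>j<d+4. zeta_term_deriv K b d j + (if j = 0 then of_nat c * ?A else 0) + (if j = d + 1 then ?E else 0))
        = ?B + of_nat c * ?A + ?E"
      by (simp only: sum.distrib sum.delta' sum.delta finite_lessThan lessThan_iff) simp
    finally have "deriv (M 1) 0 = of_nat c * ?A + (?B + S) + ?E"
      by (intro DERIV_imp_deriv) (simp add: algebra_simps)
    moreover have "deriv Y 0 = deriv (Z 1) 0"
      by (rule deriv_cong_ev[OF evY refl])
    moreover have "deriv (Z 1) 0 = deriv (M 1) 0"
      unfolding Z_def by (rule deriv_remove_sings_at_analytic[OF Man0])
    ultimately show ?thesis by simp
  qed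
  ultimately have "zeta_deriv UNIV f
     (of_nat c * ?A + ((\<Sum>j<d+4. zeta_term_deriv K b d j) + S) +
     of_real (b ^ (d + 1)) * (- ((- 1) ^ d * (\<Sum>j=1..d. 1 / of_nat j) / of_nat (d + 1))) / of_nat c)"
    using Y(1) unfolding zeta_deriv_def nicely_meromorphic_on_def by blast
  then show ?thesis unfolding f_def S_def .
qed

lemma monomial_continuation:
  fixes a b :: real and d :: nat
  defines "u \<equiv> \<lambda>k. real k + a"
  assumes a: "a > 0" and b: "b \<ge> 0"
  obtains A B where
    "zeta_deriv UNIV (\<lambda>k w. of_real (u k) ^ d * of_real (u k) powr (- w)) A"
    "\<And>c. \<lbrakk>c > 0; c \<le> 2\<rbrakk> \<Longrightarrow> zeta_deriv UNIV
       (\<lambda>k w. of_real (u k) ^ d * of_real (u k) powr (- (of_nat c * w)) * of_real (1 + b / u k) powr (- w))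
       (of_nat c * A + B +
        (- 1) ^ (d + 1) / of_nat (d + 1) * (\<Sum>j=1..d. 1 / of_nat j) * of_real b ^ (d + 1) / of_nat c)"
proof -
  obtain K where K: "K holomorphic_on UNIV" "K 1 = 1"
    "\<forall>w. Re w > 1 \<longrightarrow> ((\<lambda>k. of_real (real k + a) powr (- w)) has_sum K w / (w - 1)) UNIV"
    using hurwitz_zeta[OF a] by blast
  note aux = monomial_continuation_aux[OF K a]
  \<comment> \<open>At \<open>b = 0\<close> only the part proportional to \<open>c\<close> is left,
    so \<open>c = 1\<close> there yields the constant \<open>A\<close> itself.\<close>
  have "binom_rem (d + 4) v 0 = 0" for v
  proof -
    have "(\<Sum>j<Suc (d + 3). (v gchoose j) * of_real (0 ^ j)) = 1"
      by (subst sum.lessThan_Suc_shift) simp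
    then show ?thesis unfolding binom_rem_def by (simp add: eval_nat_numeral)
  qed
  moreover have "zeta_term_deriv K 0 d j = 0" for j
    unfolding zeta_term_deriv_def by (simp add: power_0_left)
  ultimately have "zeta_deriv UNIV (\<lambda>k w. of_real (u k) ^ d * of_real (u k) powr (- w))
       (deriv (\<lambda>v. K (v - of_nat d) / (v - of_nat d - 1)) 0)"
    using aux[of 0 1 d] by (simp add: u_def)
  moreover note aux[OF b, of _ d]
  ultimately show ?thesis
    by (intro that) (auto simp: u_def mult_ac)
qed

section \<open>Polynomial multiplicities, Barnes zeta functions and the anomaly\<close>

lemma gbinomial_shift_poly:
  obtains q :: "complex poly" where "degree q \<le> m" "\<And>x. (x + e) gchoose m = poly q x"
proof (induction m arbitrary: thesis)
  case 0
  then show ?case using 0[of 1] by simp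
next
  case (Suc m)
  obtain q :: "complex poly" where q: "degree q \<le> m" "\<And>x. (x + e) gchoose m = poly q x"
    using Suc.IH by blast
  define r where "r = smult (1 / of_nat (Suc m)) (q * [:e - of_nat m, 1:])"
  show ?case
  proof (rule Suc.prems)
    have "degree (q * [:e - of_nat m, 1:]) \<le> degree q + 1"
      using degree_mult_le[of q "[:e - of_nat m, 1:]"] by simp
    then show "degree r \<le> Suc m"
      using q(1) degree_smult_le[of "1 / of_nat (Suc m)" "q * [:e - of_nat m, 1:]"]
      unfolding r_def by linarith
    show "(x + e) gchoose Suc m = poly r x" for x
      unfolding r_def gbinomial_Suc_eq q(2) using of_nat_neq_0[of m, where 'a = complex]
      by (simp add: divide_simps del: of_nat_Suc) (simp add: algebra_simps)
  qed
qed

text \<open>Tuples are grouped by their sum. The groups are finite and summability in the complex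
  numbers is absolute, so summability passes from the grouped series to the series over all
  tuples.\<close>

lemma has_sum_tuples:
  fixes F :: "nat \<Rightarrow> complex"
  assumes "((\<lambda>k. of_nat (card {xs :: nat list. length xs = l \<and> sum_list xs = k}) * F k) has_sum S) UNIV"
  shows "((\<lambda>xs. F (sum_list xs)) has_sum S) {xs. length xs = l}"
proof -
  define L where "L k = {xs :: nat list. length xs = l \<and> sum_list xs = k}" for k
  have fin: "finite (L k)" for k
  proof (rule finite_subset)
    show "L k \<subseteq> {xs. set xs \<subseteq> {..k} \<and> length xs = l}"
      unfolding L_def using member_le_sum_list by fastforce
  qed (rule finite_lists_length_eq, simp)
  have "(\<lambda>k. norm (of_nat (card (L k)) * F k)) summable_on UNIV"
    using assms unfolding L_def summable_on_iff_abs_summable_on_complex[symmetric] by (rule has_sum_imp_summable)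
  then have abs: "(\<lambda>p. norm (case p of (k, xs) \<Rightarrow> F k)) summable_on (SIGMA k:UNIV. L k)"
    using fin by (subst Infinite_Sum.abs_summable_on_Sigma_iff) (auto simp: norm_mult)
  have "((\<lambda>(k, xs). F k) has_sum S) (SIGMA k:UNIV. L k)"
  proof (rule has_sum_SigmaI)
    show "((\<lambda>xs. case (k, xs) of (k, xs) \<Rightarrow> F k) has_sum of_nat (card (L k)) * F k) (L k)" for k
      using fin by (auto intro!: has_sum_finiteI)
  qed (use assms abs in \<open>auto simp: L_def intro: abs_summable_summable\<close>)
  moreover have "((\<lambda>(k, xs). F k) has_sum S) (SIGMA k:UNIV. L k) \<longleftrightarrow>
      ((\<lambda>p. F (sum_list (snd p))) has_sum S) (SIGMA k:UNIV. L k)"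
    by (rule has_sum_cong) (auto simp: L_def)
  ultimately have "((\<lambda>p. F (sum_list (snd p))) has_sum S) (SIGMA k:UNIV. L k)"
    by simp
  moreover have "bij_betw snd (SIGMA k:UNIV. L k) {xs. length xs = l}"
    by (rule bij_betwI[where g = "\<lambda>xs. (sum_list xs, xs)"]) (auto simp: L_def)
  ultimately show ?thesis
    using has_sum_reindex_bij_betw[of snd "SIGMA k:UNIV. L k" "{xs. length xs = l}" "\<lambda>xs. F (sum_list xs)" S]
    by simp
qed

text \<open>The number of tuples of length \<open>l\<close> with sum \<open>k\<close> is a
  polynomial in \<open>k + a\<close>, so the Barnes zeta function is a linear combination of shifted
  Hurwitz zeta functions.\<close>

lemma barnes_continuation:
  fixes a :: real
  assumes a: "a > 0" and l: "l \<ge> 1"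
  obtains B where
    "zeta_deriv UNIV (\<lambda>k w. of_nat ((k + l - 1) choose (l - 1)) * of_real (real k + a) powr (- w)) B"
    "barnes_Gamma l (of_real a) = exp B"
proof -
  \<comment> \<open>The shift for which \<open>(k + a) + e = k + l - 1\<close>.\<close>
  define e where "e = (of_nat (l - 1) - of_real a :: complex)"
  obtain q where q: "\<And>x. (x + e) gchoose (l - 1) = poly q x"
    using gbinomial_shift_poly[of "l - 1" e] by blast
  have "\<forall>d. \<exists>A. zeta_deriv UNIV (\<lambda>k w. of_real (real k + a) ^ d * of_real (real k + a) powr (- w)) A"
    by (rule allI, rule monomial_continuation[OF a order_refl]) blast
  then obtain A where A: "\<And>d. zeta_deriv UNIV
      (\<lambda>k w. of_real (real k + a) ^ d * of_real (real k + a) powr (- w)) (A d)"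
    by (rule choice[THEN exE]) blast
  define B where "B = (\<Sum>d\<le>degree q. coeff q d * A d)"
  have "zeta_deriv UNIV
      (\<lambda>k w. \<Sum>d\<le>degree q. coeff q d * (of_real (real k + a) ^ d * of_real (real k + a) powr (- w))) B"
    unfolding B_def by (intro zeta_deriv_sum zeta_deriv_cmult A)
  moreover have "(\<Sum>d\<le>degree q. coeff q d * (of_real (real k + a) ^ d * of_real (real k + a) powr (- w)))
      = of_nat ((k + l - 1) choose (l - 1)) * of_real (real k + a) powr (- w)" for k w
  proof -
    have "of_real (real k + a) + e = of_nat (k + l - 1)"
      using l by (simp add: e_def of_nat_diff)
    then have "of_nat ((k + l - 1) choose (l - 1)) = poly q (of_real (real k + a))"
      by (simp add: binomial_gbinomial flip: q)
    then show ?thesis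
      by (simp add: poly_altdef sum_distrib_right mult.assoc)
  qed
  ultimately have cd: "zeta_deriv UNIV (\<lambda>k w. of_nat ((k + l - 1) choose (l - 1)) * of_real (real k + a) powr (- w)) B"
    by simp
  have "zeta_deriv {xs. length xs = l} (\<lambda>m w. (of_nat (sum_list m) + of_real a) powr (- w)) B"
    using cd
  proof (rule zeta_deriv_transfer)
    fix w S :: complex
    assume "((\<lambda>k. of_nat ((k + l - 1) choose (l - 1)) * of_real (real k + a) powr (- w)) has_sum S) UNIV"
    moreover have "(k + l - 1) choose (l - 1) = card {xs :: nat list. length xs = l \<and> sum_list xs = k}" for k
      unfolding card_length_sum_list using l binomial_symmetric[of "l - 1" "k + l - 1"] by simp
    ultimately have "((\<lambda>k. of_nat (card {xs :: nat list. length xs = l \<and> sum_list xs = k}) * of_real (real k + a) powr (- w)) has_sum S) UNIV"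
      by simp
    from has_sum_tuples[OF this]
    show "((\<lambda>m. (of_nat (sum_list m) + of_real a) powr (- w)) has_sum S) {xs. length xs = l}"
      by simp
  qed
  from zeta_deriv_series_continuation[OF this]
  have "barnes_Gamma l (of_real a) = exp B"
    unfolding barnes_Gamma_def barnes_zeta_def by simp
  with cd show ?thesis using that by blast
qed

abbreviation (input) barnes_value :: "complex \<Rightarrow> nat \<Rightarrow> complex \<Rightarrow> complex \<Rightarrow> complex" where
  "barnes_value f n x y \<equiv> exp f *
     (\<Prod>l=1..<n. inverse (barnes_Gamma l x * barnes_Gamma l y)) *
     inverse ((barnes_Gamma n x * barnes_Gamma n y) ^ 2)"

text \<open>The multiplicity is needed in two forms: as a polynomial in \<open>k + a\<close>, to
  which the continuation of monomials applies, and as a combination of tuple counts, in which Barnes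
  gamma functions can be recognised.\<close>

lemma det_continuation:
  fixes a b :: real and T :: "nat \<Rightarrow> complex" and m :: "nat \<Rightarrow> nat"
  assumes n: "n \<ge> 1" and a: "a > 0" and b: "b \<ge> 0"
    and T: "\<And>k. of_nat (m k) = (\<Sum>d<n. T d * of_real (real k + a) ^ d)"
    and m: "\<And>k. m k = 2 * ((k + n - 1) choose (n - 1)) + (\<Sum>l=1..<n. (k + l - 1) choose (l - 1))"
  obtains D where
    "zeta_deriv UNIV (\<lambda>k w. of_nat (m k) * of_real ((real k + a) * (real k + a + b)) powr (- w)) D"
    "exp (- D) =
       barnes_value (\<Sum>d<n. T d * ((- 1) ^ (d + 1) / of_nat (d + 1) * (\<Sum>j=1..d. 1 / of_nat j) * of_real b ^ (d + 1)) / 2) n (of_real (a + b)) (of_real a)"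
proof -
  define u where "u k = real k + a" for k
  have u: "u k > 0" for k unfolding u_def using a by simp
  define E where "E d = (- 1) ^ (d + 1) / of_nat (d + 1) * (\<Sum>j=1..d. 1 / of_nat j) * complex_of_real b ^ (d + 1)" for d
  define Q where "Q d A B \<longleftrightarrow>
    zeta_deriv UNIV (\<lambda>k w. of_real (u k) ^ d * of_real (u k) powr (- w)) A \<and>
    (\<forall>c. c > 0 \<and> c \<le> 2 \<longrightarrow> zeta_deriv UNIV
       (\<lambda>k w. of_real (u k) ^ d * of_real (u k) powr (- (of_nat c * w)) * of_real (1 + b / u k) powr (- w))
       (of_nat c * A + B + E d / of_nat c))" for d A B
  have "\<forall>d. \<exists>A B. Q d A B"
    unfolding Q_def u_def E_def by (rule allI, rule monomial_continuation[OF a b]) blast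
  then obtain A B where AB: "\<And>d. Q d (A d) (B d)"
    by metis
  note AB = AB[unfolded Q_def]
  have c0: "zeta_deriv UNIV (\<lambda>k w. of_nat (m k) * of_real (u k) powr (- w)) (\<Sum>d<n. T d * A d)"
  proof (rule zeta_deriv_cong)
    show "zeta_deriv UNIV (\<lambda>k w. \<Sum>d<n. T d * (of_real (u k) ^ d * of_real (u k) powr (- w))) (\<Sum>d<n. T d * A d)"
      using AB by (intro zeta_deriv_sum zeta_deriv_cmult) blast
  qed (simp add: T sum_distrib_right mult.assoc u_def)
  have c12: "zeta_deriv UNIV (\<lambda>k w. of_nat (m k) * (of_real (u k) powr (- (of_nat c * w)) * of_real (1 + b / u k) powr (- w)))
     (\<Sum>d<n. T d * (of_nat c * A d + B d + E d / of_nat c))" if "c > 0" "c \<le> 2" for c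
  proof (rule zeta_deriv_cong)
    show "zeta_deriv UNIV (\<lambda>k w. \<Sum>d<n. T d *
        (of_real (u k) ^ d * of_real (u k) powr (- (of_nat c * w)) * of_real (1 + b / u k) powr (- w)))
        (\<Sum>d<n. T d * (of_nat c * A d + B d + E d / of_nat c))"
      using AB that by (intro zeta_deriv_sum zeta_deriv_cmult) blast
  qed (simp add: T sum_distrib_right mult.assoc u_def)
  have c1: "zeta_deriv UNIV (\<lambda>k w. of_nat (m k) * of_real (real k + (a + b)) powr (- w))
     (\<Sum>d<n. T d * (A d + B d + E d))"
  proof -
    have "zeta_deriv UNIV (\<lambda>k w. of_nat (m k) * (of_real (u k) powr (- w) * of_real (1 + b / u k) powr (- w)))
      (\<Sum>d<n. T d * (A d + B d + E d))"
      using c12[of 1] by simp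
    then show ?thesis
      by (rule zeta_deriv_cong) (use powr_add_eq_mult[OF u b] in \<open>simp add: u_def add.assoc\<close>)
  qed
  have c2: "zeta_deriv UNIV (\<lambda>k w. of_nat (m k) * of_real ((real k + a) * (real k + a + b)) powr (- w))
     (\<Sum>d<n. T d * (2 * A d + B d + E d / 2))"
  proof -
    have "zeta_deriv UNIV (\<lambda>k w. of_nat (m k) * (of_real (u k) powr (- (2 * w)) * of_real (1 + b / u k) powr (- w)))
      (\<Sum>d<n. T d * (2 * A d + B d + E d / 2))"
      using c12[of 2] by simp
    moreover have "of_real (u k) powr (- (2 * w)) * of_real (1 + b / u k) powr (- w) =
        of_real ((real k + a) * (real k + a + b)) powr (- w)" for k and w :: complex
    proof -
      have "of_real (u k * (u k + b)) powr (- w) = of_real (u k) powr (- w) * of_real (u k + b) powr (- w)"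
        using u[of k] b powr_times_real[of "of_real (u k)" "of_real (u k + b)" "- w"]
        by (simp only: of_real_mult) auto
      also have "\<dots> = of_real (u k) powr (- w) * of_real (u k) powr (- w) * of_real (1 + b / u k) powr (- w)"
        unfolding powr_add_eq_mult[OF u b] by simp
      also have "of_real (u k) powr (- w) * of_real (u k) powr (- w) = of_real (u k) powr (- (2 * w))"
        by (simp flip: powr_add)
      finally show ?thesis unfolding u_def by (rule sym)
    qed
    ultimately show ?thesis by simp
  qed
  have barnes: "\<exists>G. (\<forall>l\<ge>1. barnes_Gamma l (of_real x) = exp (G l)) \<and>
      zeta_deriv UNIV (\<lambda>k w. of_nat (m k) * of_real (real k + x) powr (- w)) (2 * G n + (\<Sum>l=1..<n. G l))"
    if x: "x > 0" for x :: real
  proof -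
    have "\<forall>l. \<exists>G. l \<ge> 1 \<longrightarrow> zeta_deriv UNIV (\<lambda>k w. of_nat ((k + l - 1) choose (l - 1)) * of_real (real k + x) powr (- w)) G \<and>
      barnes_Gamma l (of_real x) = exp G"
    proof
      fix l
      show "\<exists>G. l \<ge> 1 \<longrightarrow> zeta_deriv UNIV (\<lambda>k w. of_nat ((k + l - 1) choose (l - 1)) * of_real (real k + x) powr (- w)) G \<and>
        barnes_Gamma l (of_real x) = exp G"
        by (cases "l \<ge> 1") (use barnes_continuation[OF x, of l] in blast)+
    qed
    then obtain G where G: "\<And>l. l \<ge> 1 \<Longrightarrow> zeta_deriv UNIV (\<lambda>k w. of_nat ((k + l - 1) choose (l - 1)) * of_real (real k + x) powr (- w)) (G l)"
      "\<And>l. l \<ge> 1 \<Longrightarrow> barnes_Gamma l (of_real x) = exp (G l)" by (rule choice[THEN exE]) blast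
    have "zeta_deriv UNIV (\<lambda>k w. 2 * (of_nat ((k + n - 1) choose (n - 1)) * of_real (real k + x) powr (- w)) +
        (\<Sum>l=1..<n. of_nat ((k + l - 1) choose (l - 1)) * of_real (real k + x) powr (- w))) (2 * G n + (\<Sum>l=1..<n. G l))"
      using G(1) n by (intro zeta_deriv_add zeta_deriv_cmult zeta_deriv_sum) auto
    then have "zeta_deriv UNIV (\<lambda>k w. of_nat (m k) * of_real (real k + x) powr (- w)) (2 * G n + (\<Sum>l=1..<n. G l))"
      by (rule zeta_deriv_cong) (simp add: m sum_distrib_right distrib_right del: of_real_add)
    with G(2) show ?thesis by blast
  qed
  obtain G where G: "\<And>l. l \<ge> 1 \<Longrightarrow> barnes_Gamma l (of_real a) = exp (G l)"
      "zeta_deriv UNIV (\<lambda>k w. of_nat (m k) * of_real (real k + a) powr (- w)) (2 * G n + (\<Sum>l=1..<n. G l))"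
    using barnes[OF a] by blast
  have ab: "a + b > 0" using a b by simp
  obtain H where H: "\<And>l. l \<ge> 1 \<Longrightarrow> barnes_Gamma l (of_real (a + b)) = exp (H l)"
      "zeta_deriv UNIV (\<lambda>k w. of_nat (m k) * of_real (real k + (a + b)) powr (- w)) (2 * H n + (\<Sum>l=1..<n. H l))"
    using barnes[OF ab] by blast
  \<comment> \<open>In \<open>D0\<close> and \<open>D1\<close> both sides are derivatives of
    continuations of one and the same series, with \<open>u_k = k + a\<close> and
    \<open>k + a + b\<close>.\<close>
  have D0: "(\<Sum>d<n. T d * A d) = 2 * G n + (\<Sum>l=1..<n. G l)"
    using zeta_deriv_unique[OF c0[unfolded u_def] G(2)] .
  have D1: "(\<Sum>d<n. T d * (A d + B d + E d)) = 2 * H n + (\<Sum>l=1..<n. H l)"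
    using zeta_deriv_unique[OF c1 H(2)] .
  \<comment> \<open>The anomaly: \<open>2 A + B + E/2\<close> is \<open>A\<close> plus
    \<open>A + B + E\<close> minus \<open>E/2\<close>.\<close>
  have "(\<Sum>d<n. T d * (2 * A d + B d + E d / 2)) =
      (\<Sum>d<n. T d * A d) + (\<Sum>d<n. T d * (A d + B d + E d)) - (\<Sum>d<n. T d * E d / 2)"
    by (simp add: sum.distrib[symmetric] sum_subtractf[symmetric] algebra_simps)
  then have D2: "- (\<Sum>d<n. T d * (2 * A d + B d + E d / 2)) =
      (\<Sum>d<n. T d * E d / 2) + (\<Sum>l=1..<n. - (H l + G l)) + - (2 * (H n + G n))"
    unfolding D0 D1 by (simp add: sum_negf sum.distrib sum_subtractf)
  have "exp (- (\<Sum>d<n. T d * (2 * A d + B d + E d / 2))) =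
     barnes_value (\<Sum>d<n. T d * E d / 2) n (of_real (a + b)) (of_real a)"
  proof -
    have "(\<Prod>l=1..<n. inverse (barnes_Gamma l (of_real (a + b)) * barnes_Gamma l (of_real a))) =
      exp (\<Sum>l=1..<n. - (H l + G l))"
      by (subst exp_sum) (auto intro!: prod.cong simp: G(1) H(1) exp_minus exp_diff divide_inverse simp del: of_real_add)
    moreover have "inverse ((barnes_Gamma n (of_real (a + b)) * barnes_Gamma n (of_real a)) ^ 2) = exp (- (2 * (H n + G n)))"
      unfolding G(1)[OF n] H(1)[OF n] by (simp only: exp_minus exp_double exp_add)
    ultimately show ?thesis unfolding D2 by (simp only: exp_add)
  qed
  with c2 show ?thesis using that unfolding E_def by blast
qed

section \<open>The multiplicity polynomial and the regularized product of the eigenvalues\<close>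

lemma P_poly_eq_sum:
  assumes "n \<ge> 1"
  shows "P_poly n z = ((z + check n) gchoose (n - 1)) + ((z + check n - 1) gchoose (n - 1))"
proof -
  obtain m where m: "n = Suc m" using assms by (cases n) auto
  \<comment> \<open>Pascal's rule twice. As a sum, \<open>P_poly\<close> visibly has degree at most
    \<open>n - 1\<close>; in its definition the leading terms cancel.\<close>
  show ?thesis
    unfolding P_poly_def m
    using gbinomial_Suc_Suc[of "z + check (Suc m)" m] gbinomial_Suc_Suc[of "z + check (Suc m) - 1" m] by simp
qed

text \<open>The definite description needs existence, from the polynomial \<open>q + r\<close> in
  \<open>z - s\<close> of degree below \<open>n\<close>, and uniqueness, since a complex polynomial
  that vanishes everywhere is zero.\<close>

lemma T_coeff:
  assumes n: "n \<ge> 1"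
  shows "P_poly n z = (\<Sum>d<n. T_coeff n d s * (z - s) ^ d)"
proof -
  obtain q where q: "degree q \<le> n - 1" "\<And>x. (x + (s + check n)) gchoose (n - 1) = poly q x"
    using gbinomial_shift_poly by blast
  obtain r where r: "degree r \<le> n - 1" "\<And>x. (x + (s + check n - 1)) gchoose (n - 1) = poly r x"
    using gbinomial_shift_poly by blast
  let ?Q = "\<lambda>T. (\<forall>k\<ge>n. T k = 0) \<and> (\<forall>z. P_poly n z = (\<Sum>k=0..<n. T k * (z - s) ^ k))"
  have ex: "?Q (coeff (q + r))"
  proof (intro conjI allI impI)
    have deg: "degree (q + r) < n" using degree_add_le[OF q(1) r(1)] n by simp
    then show "coeff (q + r) k = 0" if "k \<ge> n" for k
      using that by (intro coeff_eq_0) simp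
    fix z
    have "P_poly n z = poly (q + r) (z - s)"
      unfolding P_poly_eq_sum[OF n] poly_add q(2)[symmetric] r(2)[symmetric] by (simp add: algebra_simps)
    also have "\<dots> = (\<Sum>k<n. coeff (q + r) k * (z - s) ^ k)"
      unfolding poly_altdef using deg by (intro sum.mono_neutral_left) (auto intro: le_degree simp del: coeff_add)
    finally show "P_poly n z = (\<Sum>k=0..<n. coeff (q + r) k * (z - s) ^ k)"
      by (simp add: lessThan_atLeast0)
  qed
  have uniq: "T = T'" if T: "?Q T" and T': "?Q T'" for T T'
  proof
    fix k
    define p where "p = (\<Sum>k=0..<n. monom (T k - T' k) k)"
    have "poly p x = 0" for x
    proof -
      have "poly p x = P_poly n (x + s) - P_poly n (x + s)"
        using T[THEN conjunct2, rule_format, of "x + s"] T'[THEN conjunct2, rule_format, of "x + s"]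
        unfolding p_def by (simp add: poly_sum poly_monom left_diff_distrib sum_subtractf)
      then show ?thesis by simp
    qed
    then have "p = 0" using poly_all_0_iff_0 by blast
    then have "coeff p k = 0" by simp
    moreover have "coeff p k = (if k < n then T k - T' k else 0)"
      unfolding p_def by (simp add: coeff_sum sum.delta)
    ultimately show "T k = T' k"
      using T T' by (auto split: if_splits)
  qed
  have "?Q (THE T. ?Q T)"
    by (rule theI[of ?Q, OF ex]) (rule uniq[OF _ ex])
  from this[THEN conjunct2, THEN spec, of z] show ?thesis
    unfolding T_coeff_def lessThan_atLeast0 .
qed

text \<open>The difference of squares factors as \<open>(k + a) * (k + a + 2 * s)\<close> with
  \<open>a = h + 1 - s\<close>. The index is shifted by one because the constant functions are
  treated apart.\<close>

lemma zeta_regularized_product: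
  fixes n :: nat and s :: real
  defines "h \<equiv> (real n - 1) / 2"
  assumes n: "n \<ge> 1" and s: "0 \<le> s" "s < h + 1"
  obtains D where
    "zeta_deriv UNIV (\<lambda>k w. of_nat (((k + n) choose (n - 1)) + ((k + n - 1) choose (n - 1))) *
        of_real ((real k + 1 + h) ^ 2 - s ^ 2) powr (- w)) D"
    "exp (- D) = barnes_value (f_exponent n (of_real s)) n (of_real (h + 1 + s)) (of_real (h + 1 - s))"
proof -
  define a where "a = h + 1 - s"
  define m where "m k = ((k + n) choose (n - 1)) + ((k + n - 1) choose (n - 1))" for k
  have h: "check n = of_real h" unfolding h_def check_def by simp
  \<comment> \<open>The multiplicity is \<open>P_poly n z\<close> at
    \<open>z = k + 1 + check n\<close>, and \<open>z - s = k + a\<close>: the \<open>T_coeff\<close>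
    are exactly the coefficients in powers of \<open>k + a\<close>.\<close>
  have mT: "of_nat (m k) = (\<Sum>d<n. T_coeff n d (of_real s) * of_real (real k + a) ^ d)" for k
  proof -
    have e: "of_nat k + 1 + check n + check n = of_nat (k + n)"
      unfolding check_def by (simp add: field_simps)
    have e': "of_nat k + 1 + check n + check n - 1 = of_nat (k + n - 1)"
      unfolding e using n by (simp add: of_nat_diff)
    have "of_nat (m k) = P_poly n (of_nat k + 1 + check n)"
      unfolding P_poly_eq_sum[OF n] e' unfolding e m_def by (simp add: binomial_gbinomial)
    also have "\<dots> = (\<Sum>d<n. T_coeff n d (of_real s) * (of_nat k + 1 + check n - of_real s) ^ d)"
      by (rule T_coeff[OF n])
    finally show ?thesis unfolding h a_def by (simp add: algebra_simps)
  qed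
  \<comment> \<open>Hockey-stick identity: \<open>(k + n) choose (n - 1)\<close> is the sum of the
    \<open>(k + l - 1) choose (l - 1)\<close> over \<open>l = 1, ..., n\<close>. The second summand
    of \<open>m k\<close> repeats the term \<open>l = n\<close>.\<close>
  have m2: "m k = 2 * ((k + n - 1) choose (n - 1)) + (\<Sum>l=1..<n. (k + l - 1) choose (l - 1))" for k
  proof -
    obtain j where j: "n = Suc j" using n by (cases n) auto
    have "(\<Sum>i\<le>j. (k + i) choose i) = Suc (k + j) choose j" by (rule sum_choose_lower)
    moreover have "(\<Sum>i\<le>j. (k + i) choose i) = ((k + j) choose j) + (\<Sum>i<j. (k + i) choose i)"
      by (simp flip: lessThan_Suc_atMost)
    moreover have "(\<Sum>l=1..<n. (k + l - 1) choose (l - 1)) = (\<Sum>i<j. (k + i) choose i)"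
      unfolding j lessThan_atLeast0 using sum.shift_bounds_Suc_ivl[of "\<lambda>l. (k + l - 1) choose (l - 1)" 0 j] by simp
    ultimately show ?thesis unfolding m_def j by simp
  qed
  have a0: "a > 0" and s0: "2 * s \<ge> 0" using s unfolding a_def by auto
  obtain D where D: "zeta_deriv UNIV (\<lambda>k w. of_nat (m k) * of_real ((real k + a) * (real k + a + 2 * s)) powr (- w)) D"
    "exp (- D) =
       barnes_value (\<Sum>d<n. T_coeff n d (of_real s) * ((- 1) ^ (d + 1) / of_nat (d + 1) * (\<Sum>j=1..d. 1 / of_nat j) * of_real (2 * s) ^ (d + 1)) / 2) n (of_real (a + 2 * s)) (of_real a)"
    by (rule det_continuation[OF n a0 s0 mT m2]) (rule that)
  have "(\<Sum>d<n. T_coeff n d (of_real s) * ((- 1) ^ (d + 1) / of_nat (d + 1) * (\<Sum>j=1..d. 1 / of_nat j) * of_real (2 * s) ^ (d + 1)) / 2)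
      = f_exponent n (of_real s)"
  proof -
    \<comment> \<open>The term \<open>d = 0\<close> carries an empty harmonic sum, so starting at
      \<open>d = 1\<close> as in \<open>f_exponent\<close> loses nothing.\<close>
    have "{..<n} = insert 0 {1..<n}" using n by auto
    then show ?thesis
      unfolding f_exponent_def by (simp add: mult_ac add.commute)
  qed
  moreover have "(real k + a) * (real k + a + 2 * s) = (real k + 1 + h) ^ 2 - s ^ 2" for k
    unfolding a_def by (simp add: power2_eq_square algebra_simps)
  moreover have "a + 2 * s = h + 1 + s" unfolding a_def by simp
  ultimately show ?thesis
    using that D unfolding m_def by (simp only: a_def)
qed

subsection \<open>Smooth functions\<close>

abbreviation (input) fd :: "('a::real_normed_vector \<Rightarrow> 'b::real_normed_vector) \<Rightarrow> 'a \<Rightarrow> 'a \<Rightarrow> 'b" where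
  "fd f x v \<equiv> frechet_derivative f (at x) v"

lemma frechet_derivative_cong_open:
  assumes "open U" "x \<in> U" "\<And>y. y \<in> U \<Longrightarrow> f y = g y"
  shows "frechet_derivative f (at x) = frechet_derivative g (at x)"
proof -
  have "(f has_derivative f') (at x) \<longleftrightarrow> (g has_derivative f') (at x)" for f'
    using has_derivative_transform_within_open[of f f' x UNIV U g]
      has_derivative_transform_within_open[of g f' x UNIV U f] assms by auto
  then show ?thesis
    unfolding frechet_derivative_def by simp
qed

lemma differentiable_cong_open:
  assumes "open U" "x \<in> U" "\<And>y. y \<in> U \<Longrightarrow> f y = g y" "f differentiable at x"
  shows "g differentiable at x"
proof -
  obtain D where "(f has_derivative D) (at x)"
    using assms(4) unfolding differentiable_def by blast
  from has_derivative_transform_within_open[OF this assms(1,2)] assms(3)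
  have "(g has_derivative D) (at x)" by simp
  then show ?thesis unfolding differentiable_def by blast
qed

lemma differentiable_on_open_iff:
  "open U \<Longrightarrow> f differentiable_on U \<longleftrightarrow> (\<forall>x\<in>U. f differentiable at x)"
  by (auto simp: differentiable_on_def at_within_open_NO_MATCH)

lemma Ck_on_cong:
  assumes "open U" "\<And>x. x \<in> U \<Longrightarrow> f x = g x" "Ck_on k f U"
  shows "Ck_on k g U"
  using assms
proof (induction k arbitrary: f g)
  case 0
  then show ?case using continuous_on_cong[of U U f g] by simp
next
  case (Suc k)
  have "Ck_on k (\<lambda>x. fd g x v) U" for v
  proof (rule Suc.IH[OF \<open>open U\<close>])
    show "Ck_on k (\<lambda>x. fd f x v) U" using Suc.prems by simp
    show "fd f x v = fd g x v" if "x \<in> U" for x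
      using frechet_derivative_cong_open[of U x f g] Suc.prems that by simp
  qed
  moreover have "g differentiable at x" if "x \<in> U" for x
    using differentiable_cong_open[of U x f g] Suc.prems that
    by (simp add: differentiable_on_open_iff)
  ultimately show ?case using Suc.prems by (simp add: differentiable_on_open_iff)
qed

lemma smooth_on_cong:
  "\<lbrakk>open U; \<And>x. x \<in> U \<Longrightarrow> f x = g x; smooth_on U f\<rbrakk> \<Longrightarrow> smooth_on U g"
  unfolding smooth_on_def using Ck_on_cong by blast

lemma smooth_on_differentiable:
  assumes "open U" "smooth_on U f" "x \<in> U"
  shows "f differentiable at x"
  using assms(2)[unfolded smooth_on_def, rule_format, of 1] assms
  by (simp add: differentiable_on_open_iff)

lemma smooth_on_continuous: "smooth_on U f \<Longrightarrow> continuous_on U f"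
  unfolding smooth_on_def by (metis Ck_on.simps(1))

lemma smooth_on_deriv: "smooth_on U f \<Longrightarrow> smooth_on U (\<lambda>x. fd f x v)"
  unfolding smooth_on_def by (metis Ck_on.simps(2))

lemma Ck_on_subset: "Ck_on k f U \<Longrightarrow> V \<subseteq> U \<Longrightarrow> Ck_on k f V"
  by (induction k arbitrary: f) (auto intro: continuous_on_subset differentiable_on_subset)

lemma smooth_on_subset: "smooth_on U f \<Longrightarrow> V \<subseteq> U \<Longrightarrow> smooth_on V f"
  unfolding smooth_on_def using Ck_on_subset by blast

lemma frechet_derivative_eqI: "(f has_derivative f') (at x) \<Longrightarrow> fd f x v = f' v"
  using frechet_derivative_at by metis

lemma Ck_on_add:
  assumes "open U" "Ck_on k f U" "Ck_on k g U"
  shows "Ck_on k (\<lambda>x. f x + g x) U"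
  using assms
proof (induction k arbitrary: f g)
  case 0
  then show ?case by (auto intro: continuous_on_add)
next
  case (Suc k)
  have d: "(f has_derivative frechet_derivative f (at x)) (at x)" "(g has_derivative frechet_derivative g (at x)) (at x)"
    if "x \<in> U" for x
    using Suc.prems that by (auto simp: differentiable_on_open_iff simp flip: frechet_derivative_works)
  have "Ck_on k (\<lambda>x. fd (\<lambda>x. f x + g x) x v) U" for v
  proof (rule Ck_on_cong[OF \<open>open U\<close>])
    show "Ck_on k (\<lambda>x. fd f x v + fd g x v) U"
      using Suc by simp
    show "fd f x v + fd g x v = fd (\<lambda>x. f x + g x) x v"
      if "x \<in> U" for x
      using frechet_derivative_eqI[OF has_derivative_add[OF d[OF that]]] by simp
  qed
  moreover have "(\<lambda>x. f x + g x) differentiable at x" if "x \<in> U" for x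
    using has_derivative_add[OF d[OF that]] unfolding differentiable_def by blast
  ultimately show ?case using Suc.prems by (simp add: differentiable_on_open_iff)
qed

lemma smooth_on_add:
  "open U \<Longrightarrow> smooth_on U f \<Longrightarrow> smooth_on U g \<Longrightarrow> smooth_on U (\<lambda>x. f x + g x)"
  unfolding smooth_on_def using Ck_on_add by blast

lemma frechet_derivative_add:
  "f differentiable at x \<Longrightarrow> g differentiable at x \<Longrightarrow>
   fd (\<lambda>x. f x + g x) x v = fd f x v + fd g x v"
  by (rule frechet_derivative_eqI) (intro has_derivative_add; simp add: frechet_derivative_works)

lemma frechet_derivative_mult_real:
  fixes f g :: "'a::real_normed_vector \<Rightarrow> real"
  assumes "f differentiable at x" "g differentiable at x"
  shows "fd (\<lambda>x. f x * g x) x v =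
    f x * fd g x v + fd f x v * g x"
  by (rule frechet_derivative_eqI[OF has_derivative_mult])
     (use assms in \<open>simp_all add: frechet_derivative_works\<close>)

text \<open>The Leibniz rule reproduces products of smooth functions, so the induction on the order
  keeps both factors fully smooth and has no orders to match.\<close>

lemma smooth_on_mult:
  fixes f g :: "'a::euclidean_space \<Rightarrow> real"
  assumes U: "open U" and fg: "smooth_on U f" "smooth_on U g"
  shows "smooth_on U (\<lambda>x. f x * g x)"
proof -
  have "Ck_on k (\<lambda>x. f x * g x) U" if "smooth_on U f" "smooth_on U g" for k and f g :: "'a \<Rightarrow> real"
    using that
  proof (induction k arbitrary: f g)
    case 0
    then show ?case by (simp add: continuous_on_mult smooth_on_continuous)
  next
    case (Suc k)
    note d = smooth_on_differentiable[OF U Suc.prems(1)] smooth_on_differentiable[OF U Suc.prems(2)]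
    have "Ck_on k (\<lambda>x. fd (\<lambda>x. f x * g x) x v) U" for v
    proof (rule Ck_on_cong[OF U])
      show "Ck_on k (\<lambda>x. f x * fd g x v + fd f x v * g x) U"
        by (intro Ck_on_add[OF U] Suc.IH smooth_on_deriv Suc.prems)
    qed (simp add: frechet_derivative_mult_real d)
    moreover have "(\<lambda>x. f x * g x) differentiable at x" if "x \<in> U" for x
      using d(1)[OF that] d(2)[OF that] by (rule differentiable_mult)
    ultimately show ?case by (simp add: differentiable_on_open_iff[OF U])
  qed
  with fg show ?thesis unfolding smooth_on_def by simp
qed

lemma Ck_on_const: "Ck_on k (\<lambda>_. c) U"
  by (induction k arbitrary: c) (auto simp: differentiable_on_def)

lemma smooth_on_const: "smooth_on U (\<lambda>_. c)"
  unfolding smooth_on_def using Ck_on_const by blast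

lemma smooth_on_bounded_linear:
  assumes "bounded_linear f"
  shows "smooth_on U f"
  unfolding smooth_on_def
proof
  fix k
  have d: "(f has_derivative f) (at x)" for x
    using bounded_linear_imp_has_derivative[OF assms] .
  have eq: "(\<lambda>x. fd f x v) = (\<lambda>x. f v)" for v
    using frechet_derivative_eqI[OF d] by blast
  have "f differentiable_on U"
    using d unfolding differentiable_on_def differentiable_def by (meson has_derivative_at_withinI)
  moreover have "continuous_on U f"
    using linear_continuous_on[OF assms] .
  ultimately show "Ck_on k f U"
    by (cases k) (simp_all add: eq Ck_on_const)
qed

lemma smooth_on_cmult:
  fixes f :: "'a::euclidean_space \<Rightarrow> real"
  shows "open U \<Longrightarrow> smooth_on U f \<Longrightarrow> smooth_on U (\<lambda>x. c * f x)"
  by (intro smooth_on_mult smooth_on_const)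

lemma smooth_on_sum:
  "open U \<Longrightarrow> (\<And>i. i \<in> I \<Longrightarrow> smooth_on U (f i)) \<Longrightarrow> smooth_on U (\<lambda>x. \<Sum>i\<in>I. f i x)"
  by (induction I rule: infinite_finite_induct) (auto intro!: smooth_on_const smooth_on_add)

lemma has_derivative_norm_powr:
  fixes x :: "'a::euclidean_space"
  assumes "x \<noteq> 0"
  shows "((\<lambda>x. norm x powr \<beta>) has_derivative (\<lambda>v. \<beta> * norm x powr (\<beta> - 2) * (x \<bullet> v))) (at x)"
proof -
  have "((\<lambda>x. norm x powr \<beta>) has_derivative
    (\<lambda>v. norm x powr \<beta> * (0 * ln (norm x) + (v \<bullet> sgn x) * \<beta> / norm x))) (at x)"
    by (rule has_derivative_powr[OF has_derivative_norm[OF assms] has_derivative_const]) (use assms in auto)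
  moreover have "norm x powr \<beta> * (0 * ln (norm x) + (v \<bullet> sgn x) * \<beta> / norm x) = \<beta> * norm x powr (\<beta> - 2) * (x \<bullet> v)" for v
  proof -
    have "norm x powr (\<beta> - 2) = norm x powr \<beta> / (norm x * norm x)"
      using assms by (simp add: powr_diff powr_numeral power2_eq_square)
    then show ?thesis by (simp add: sgn_div_norm inner_commute field_simps)
  qed
  ultimately show ?thesis by simp
qed

lemma smooth_on_norm_powr: "smooth_on (- {0}) (\<lambda>x::'a::euclidean_space. norm x powr \<beta>)"
proof -
  have U: "open (- {0::'a})" by auto
  \<comment> \<open>Generalized to a smooth coefficient and any exponent: differentiation turns such
    a product into a sum of two, with exponents \<open>\<beta> - 2\<close> and
    \<open>\<beta>\<close>.\<close>
  have "Ck_on k (\<lambda>x::'a. c x * norm x powr \<beta>) (- {0})" if "smooth_on (- {0}) c" for k c \<beta>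
    using that
  proof (induction k arbitrary: c \<beta>)
    case 0
    then show ?case by (auto intro!: continuous_on_mult smooth_on_continuous[OF 0] continuous_on_powr continuous_intros)
  next
    case (Suc k)
    have d: "(\<lambda>x. norm x powr \<beta>) differentiable at x" if "x \<in> - {0}" for x :: 'a
      using has_derivative_norm_powr[of x \<beta>] that unfolding differentiable_def by blast
    have c: "c differentiable at x" if "x \<in> - {0}" for x
      using smooth_on_differentiable[OF U Suc.prems that] .
    have "Ck_on k (\<lambda>x. fd (\<lambda>x. c x * norm x powr \<beta>) x v) (- {0})" for v
    proof (rule Ck_on_cong[OF U])
      have lin: "smooth_on (- {0}) (\<lambda>x. x \<bullet> v)"
        by (rule smooth_on_bounded_linear) (rule bounded_linear_inner_left)
      show "Ck_on k (\<lambda>x. (\<beta> * (c x * (x \<bullet> v))) * norm x powr (\<beta> - 2) + fd c x v * norm x powr \<beta>) (- {0})"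
        by (intro Ck_on_add[OF U] Suc.IH smooth_on_mult[OF U] smooth_on_const lin Suc.prems smooth_on_deriv)
      fix x :: 'a assume x: "x \<in> - {0}"
      show "(\<beta> * (c x * (x \<bullet> v))) * norm x powr (\<beta> - 2) + fd c x v * norm x powr \<beta> =
         fd (\<lambda>x. c x * norm x powr \<beta>) x v"
        using frechet_derivative_mult_real[OF c[OF x] d[OF x], of v]
          frechet_derivative_eqI[OF has_derivative_norm_powr[of x \<beta>], of v] x by simp
    qed
    moreover have "(\<lambda>x. c x * norm x powr \<beta>) differentiable at x" if "x \<in> - {0}" for x
      using c[OF that] d[OF that] by (rule differentiable_mult)
    ultimately show ?case by (simp add: differentiable_on_open_iff[OF U])
  qed
  from this[OF smooth_on_const[of _ 1]] show ?thesis
    unfolding smooth_on_def by simp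
qed

lemma has_real_derivative_along_line:
  assumes "f differentiable at (x + t *\<^sub>R v)"
  shows "((\<lambda>t. f (x + t *\<^sub>R v)) has_real_derivative fd f (x + t *\<^sub>R v) v) (at t)"
proof -
  let ?D = "frechet_derivative f (at (x + t *\<^sub>R v))"
  have f: "(f has_derivative ?D) (at (x + t *\<^sub>R v))"
    using assms frechet_derivative_works by blast
  have "((\<lambda>t. x + t *\<^sub>R v) has_derivative (\<lambda>s. s *\<^sub>R v)) (at t)"
    by (auto intro!: derivative_eq_intros)
  from has_derivative_compose[OF this f]
  have "((\<lambda>t. f (x + t *\<^sub>R v)) has_derivative (\<lambda>s. ?D (s *\<^sub>R v))) (at t)" .
  moreover have "?D (s *\<^sub>R v) = ?D v * s" for s
    using linear_scale[OF has_derivative_linear[OF f], of s v] by simp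
  ultimately show ?thesis
    by (simp add: has_field_derivative_def)
qed

text \<open>The mean value theorem, applied first along \<open>v\<close> and then along
  \<open>w\<close>. The left-hand side is symmetric in \<open>v\<close> and \<open>w\<close>, which
  is what makes mixed derivatives commute.\<close>

lemma mixed_difference:
  fixes f :: "'a::euclidean_space \<Rightarrow> real"
  assumes f: "smooth_on (ball x d) f" and h: "h > 0" "h * (norm v + norm w) < d"
  obtains y where "norm (y - x) \<le> h * (norm v + norm w)"
    "f (x + h *\<^sub>R v + h *\<^sub>R w) - f (x + h *\<^sub>R v) - f (x + h *\<^sub>R w) + f x =
     h * h * fd (\<lambda>y. fd f y v) y w"
proof -
  have inside: "x + s *\<^sub>R v + t *\<^sub>R w \<in> ball x d" "norm (x + s *\<^sub>R v + t *\<^sub>R w - x) \<le> h * (norm v + norm w)"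
    if "0 \<le> s" "s \<le> h" "0 \<le> t" "t \<le> h" for s t
  proof -
    have "norm (s *\<^sub>R v + t *\<^sub>R w) \<le> s * norm v + t * norm w"
      using norm_triangle_ineq[of "s *\<^sub>R v" "t *\<^sub>R w"] that by simp
    also have "\<dots> \<le> h * norm v + h * norm w"
      using that by (intro add_mono mult_right_mono) auto
    finally show n: "norm (x + s *\<^sub>R v + t *\<^sub>R w - x) \<le> h * (norm v + norm w)"
      by (simp add: algebra_simps)
    show "x + s *\<^sub>R v + t *\<^sub>R w \<in> ball x d"
      using n h unfolding mem_ball dist_norm norm_minus_commute[of x] by linarith
  qed
  define Dv where "Dv y = fd f y v" for y
  have Dv: "smooth_on (ball x d) Dv"
    unfolding Dv_def by (rule smooth_on_deriv[OF f])
  have fd: "f differentiable at y" and Dd: "Dv differentiable at y" if "y \<in> ball x d" for y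
    using smooth_on_differentiable[OF open_ball f that] smooth_on_differentiable[OF open_ball Dv that] by auto
  define g where "g s = f (x + h *\<^sub>R w + s *\<^sub>R v) - f (x + s *\<^sub>R v)" for s
  have "\<exists>s>0. s < h \<and> g h - g 0 = (h - 0) * (Dv (x + h *\<^sub>R w + s *\<^sub>R v) - Dv (x + s *\<^sub>R v))"
  proof (rule MVT2[OF h(1)])
    fix s assume s: "0 \<le> s" "s \<le> h"
    have "x + h *\<^sub>R w + s *\<^sub>R v \<in> ball x d" "x + s *\<^sub>R v \<in> ball x d"
      using inside(1)[of s h] inside(1)[of s 0] s by (simp_all add: add_ac)
    then show "DERIV g s :> Dv (x + h *\<^sub>R w + s *\<^sub>R v) - Dv (x + s *\<^sub>R v)"
      unfolding g_def Dv_def by (intro DERIV_diff has_real_derivative_along_line fd)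
  qed
  then obtain s where s: "0 < s" "s < h" "g h - g 0 = h * (Dv (x + h *\<^sub>R w + s *\<^sub>R v) - Dv (x + s *\<^sub>R v))"
    by auto
  have "\<exists>t>0. t < h \<and> Dv (x + s *\<^sub>R v + h *\<^sub>R w) - Dv (x + s *\<^sub>R v + 0 *\<^sub>R w) =
     (h - 0) * fd Dv (x + s *\<^sub>R v + t *\<^sub>R w) w"
  proof (rule MVT2[OF h(1)])
    fix t assume t: "0 \<le> t" "t \<le> h"
    show "((\<lambda>t. Dv (x + s *\<^sub>R v + t *\<^sub>R w)) has_real_derivative fd Dv (x + s *\<^sub>R v + t *\<^sub>R w) w) (at t)"
      using inside(1)[of s t] s t by (intro has_real_derivative_along_line Dd) auto
  qed
  then obtain t where t: "0 < t" "t < h" "Dv (x + s *\<^sub>R v + h *\<^sub>R w) - Dv (x + s *\<^sub>R v) =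
     h * fd Dv (x + s *\<^sub>R v + t *\<^sub>R w) w"
    by auto
  show ?thesis
  proof (rule that)
    show "norm (x + s *\<^sub>R v + t *\<^sub>R w - x) \<le> h * (norm v + norm w)"
      using inside(2)[of s t] s t by simp
    have p: "x + h *\<^sub>R w + s *\<^sub>R v = x + s *\<^sub>R v + h *\<^sub>R w" "x + h *\<^sub>R w + h *\<^sub>R v = x + h *\<^sub>R v + h *\<^sub>R w"
      by simp_all
    have "f (x + h *\<^sub>R v + h *\<^sub>R w) - f (x + h *\<^sub>R v) - (f (x + h *\<^sub>R w + 0 *\<^sub>R v) - f (x + 0 *\<^sub>R v)) =
       h * (h * fd Dv (x + s *\<^sub>R v + t *\<^sub>R w) w)"
      using s(3) unfolding g_def p t(3) .
    then show "f (x + h *\<^sub>R v + h *\<^sub>R w) - f (x + h *\<^sub>R v) - f (x + h *\<^sub>R w) + f x =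
     h * h * fd (\<lambda>y. fd f y v) (x + s *\<^sub>R v + t *\<^sub>R w) w"
      unfolding Dv_def[abs_def] by simp
  qed
qed

lemma frechet_derivative_commute:
  fixes f :: "'a::euclidean_space \<Rightarrow> real"
  assumes U: "open U" and f: "smooth_on U f" and x: "x \<in> U"
  shows "fd (\<lambda>y. fd f y v) x w =
         fd (\<lambda>y. fd f y w) x v"
proof (rule ccontr)
  define A where "A v w y = fd (\<lambda>y. fd f y v) y w" for v w y
  assume "fd (\<lambda>y. fd f y v) x w \<noteq>
         fd (\<lambda>y. fd f y w) x v"
  then have ne: "A v w x \<noteq> A w v x" unfolding A_def .
  \<comment> \<open>Half the gap: the two mixed derivatives take equal values at points
    \<open>y\<close> and \<open>z\<close> close to \<open>x\<close>, yet each of these values is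
    within \<open>e\<close> of the one at \<open>x\<close>.\<close>
  define e where "e = \<bar>A v w x - A w v x\<bar> / 2"
  have e: "e > 0" using ne unfolding e_def by simp
  have cont: "continuous (at x) (A v w)" for v w
  proof -
    have "continuous_on U (A v w)"
      unfolding A_def by (intro smooth_on_continuous smooth_on_deriv f)
    then show ?thesis using U x continuous_on_eq_continuous_at by blast
  qed
  obtain d1 where d1: "d1 > 0" "\<And>y. dist y x < d1 \<Longrightarrow> dist (A v w y) (A v w x) < e"
    using cont[of v w, unfolded continuous_at_eps_delta] e by blast
  obtain d2 where d2: "d2 > 0" "\<And>y. dist y x < d2 \<Longrightarrow> dist (A w v y) (A w v x) < e"
    using cont[of w v, unfolded continuous_at_eps_delta] e by blast
  obtain d3 where d3: "d3 > 0" "ball x d3 \<subseteq> U"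
    using U x open_contains_ball by blast
  define d where "d = min d1 (min d2 d3)"
  have d: "d > 0" "ball x d \<subseteq> U" using d1 d2 d3 unfolding d_def by auto
  define M where "M = norm v + norm w + 1"
  define h where "h = d / (2 * M)"
  have M: "M > 0" unfolding M_def by (simp add: add_nonneg_pos)
  have h: "h > 0" using d M unfolding h_def by simp
  have "h * (norm v + norm w) \<le> h * M" using h unfolding M_def by simp
  also have "\<dots> = d / 2" unfolding h_def using M by simp
  finally have hd: "h * (norm v + norm w) < d" using d by simp
  have sm: "smooth_on (ball x d) f" using smooth_on_subset[OF f d(2)] .
  obtain y where y: "norm (y - x) \<le> h * (norm v + norm w)"
    "f (x + h *\<^sub>R v + h *\<^sub>R w) - f (x + h *\<^sub>R v) - f (x + h *\<^sub>R w) + f x = h * h * A v w y"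
    using mixed_difference[OF sm h hd] unfolding A_def by blast
  have hd': "h * (norm w + norm v) < d" using hd by (simp add: add.commute)
  obtain z where z: "norm (z - x) \<le> h * (norm w + norm v)"
    "f (x + h *\<^sub>R w + h *\<^sub>R v) - f (x + h *\<^sub>R w) - f (x + h *\<^sub>R v) + f x = h * h * A w v z"
    using mixed_difference[OF sm h hd'] unfolding A_def by blast
  have pe: "x + h *\<^sub>R w + h *\<^sub>R v = x + h *\<^sub>R v + h *\<^sub>R w" by simp
  have "h * h * A v w y = h * h * A w v z" using y(2) z(2)[unfolded pe] by linarith
  then have eq: "A v w y = A w v z" using h by simp
  have "dist y x < d1" "dist z x < d2"
    using y(1) z(1) hd hd' unfolding dist_norm d_def by linarith+
  then have "dist (A v w y) (A v w x) < e" "dist (A w v z) (A w v x) < e"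
    using d1 d2 by blast+
  then show False
    using eq unfolding e_def dist_real_def by (simp add: abs_if split: if_splits)
qed

subsection \<open>Homogeneous functions and the Laplacian of the sphere\<close>

abbreviation smooth0 :: "(real ^ 'm::finite \<Rightarrow> real) \<Rightarrow> bool" where
  "smooth0 \<equiv> smooth_on (- {0})"

definition pd :: "'m::finite \<Rightarrow> (real ^ 'm \<Rightarrow> real) \<Rightarrow> real ^ 'm \<Rightarrow> real" where
  "pd i F x = fd F x (axis i 1)"

definition lap :: "(real ^ 'm::finite \<Rightarrow> real) \<Rightarrow> real ^ 'm \<Rightarrow> real" where
  "lap F x = (\<Sum>i\<in>UNIV. pd i (pd i F) x)"

definition homog :: "real \<Rightarrow> (real ^ 'm::finite \<Rightarrow> real) \<Rightarrow> bool" where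
  "homog \<beta> F \<longleftrightarrow> (\<forall>x t. x \<noteq> 0 \<longrightarrow> t > 0 \<longrightarrow> F (t *\<^sub>R x) = t powr \<beta> * F x)"

lemma open_punctured: "open (- {0 :: real ^ 'm::finite})"
  by auto

lemma smooth0_diff: "smooth0 F \<Longrightarrow> x \<noteq> 0 \<Longrightarrow> F differentiable at x"
  by (rule smooth_on_differentiable[OF open_punctured]) auto

lemma smooth0_pd: "smooth0 F \<Longrightarrow> smooth0 (pd i F)"
  unfolding pd_def[abs_def] by (rule smooth_on_deriv)

lemma pd_cong: "(\<And>y. y \<noteq> 0 \<Longrightarrow> F y = G y) \<Longrightarrow> x \<noteq> 0 \<Longrightarrow> pd i F x = pd i G x"
  unfolding pd_def using frechet_derivative_cong_open[OF open_punctured, of x F G] by simp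

lemma lap_cong:
  assumes "\<And>y. y \<noteq> 0 \<Longrightarrow> F y = G y" "x \<noteq> 0"
  shows "lap F x = lap G x"
  unfolding lap_def using assms by (intro sum.cong refl pd_cong) auto

lemma smooth0_cong: "(\<And>y. y \<noteq> 0 \<Longrightarrow> F y = G y) \<Longrightarrow> smooth0 F \<Longrightarrow> smooth0 G"
  by (rule smooth_on_cong[OF open_punctured, of F G]) auto

lemma pd_const: "pd i (\<lambda>_. c) x = 0"
  unfolding pd_def using frechet_derivative_eqI[OF has_derivative_const] by simp

lemma pd_add:
  "F differentiable at x \<Longrightarrow> G differentiable at x \<Longrightarrow> pd i (\<lambda>x. F x + G x) x = pd i F x + pd i G x"
  unfolding pd_def by (rule frechet_derivative_add)

lemma pd_mult:
  "F differentiable at x \<Longrightarrow> G differentiable at x \<Longrightarrow>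
   pd i (\<lambda>x. F x * G x) x = F x * pd i G x + pd i F x * G x"
  unfolding pd_def by (rule frechet_derivative_mult_real)

lemma pd_cmult: "F differentiable at x \<Longrightarrow> pd i (\<lambda>x. c * F x) x = c * pd i F x"
  using pd_mult[of "\<lambda>_. c" x F i] by (simp add: pd_const)

lemma pd_sum:
  assumes "\<And>j. j \<in> J \<Longrightarrow> F j differentiable at x"
  shows "pd i (\<lambda>x. \<Sum>j\<in>J. F j x) x = (\<Sum>j\<in>J. pd i (F j) x)"
  using assms
proof (induction J rule: infinite_finite_induct)
  case (insert j J)
  have "(\<lambda>x. \<Sum>j\<in>J. F j x) differentiable at x"
    using insert by (intro differentiable_sum) auto
  then show ?case using insert pd_add[of "F j" x "\<lambda>x. \<Sum>j\<in>J. F j x" i] by simp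
qed (simp_all add: pd_const)

lemma pd_coord: "pd i (\<lambda>x. x $ j) x = (if i = j then 1 else 0)"
proof -
  have "((\<lambda>x. x $ j) has_derivative (\<lambda>x. x $ j)) (at x)"
    by (rule bounded_linear_imp_has_derivative) (rule bounded_linear_vec_nth)
  then show ?thesis
    unfolding pd_def by (simp add: frechet_derivative_eqI axis_def)
qed

lemma differentiable_coord: "(\<lambda>x :: real ^ 'm::finite. x $ j) differentiable at x"
  using bounded_linear_imp_differentiable bounded_linear_vec_nth by blast

lemma smooth_on_coord: "smooth_on U (\<lambda>x :: real ^ 'm::finite. x $ j)"
  by (rule smooth_on_bounded_linear) (rule bounded_linear_vec_nth)

lemma pd_norm_powr:
  assumes "x \<noteq> 0"
  shows "pd i (\<lambda>x. norm x powr \<beta>) x = \<beta> * norm x powr (\<beta> - 2) * x $ i"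
  unfolding pd_def frechet_derivative_eqI[OF has_derivative_norm_powr[OF assms]]
  by (simp add: inner_axis)

lemma frechet_derivative_expand:
  fixes F :: "real ^ 'm::finite \<Rightarrow> real"
  assumes "F differentiable at x"
  shows "fd F x v = (\<Sum>i\<in>UNIV. v $ i * pd i F x)"
proof -
  have lin: "linear (frechet_derivative F (at x))"
    using assms by (rule linear_frechet_derivative)
  have "fd F x v = fd F x (\<Sum>i\<in>UNIV. (v $ i) *\<^sub>R axis i 1)"
    using basis_expansion[of v] by (simp add: scalar_mult_eq_scaleR)
  also have "\<dots> = (\<Sum>i\<in>UNIV. v $ i * pd i F x)"
    by (simp add: linear_sum[OF lin] linear_scale[OF lin] pd_def)
  finally show ?thesis .
qed

lemma pd_commute: "smooth0 F \<Longrightarrow> x \<noteq> 0 \<Longrightarrow> pd i (pd j F) x = pd j (pd i F) x"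
  unfolding pd_def[abs_def]
  using frechet_derivative_commute[OF open_punctured, of F x] by auto

lemma homogD: "homog \<beta> F \<Longrightarrow> x \<noteq> 0 \<Longrightarrow> t > 0 \<Longrightarrow> F (t *\<^sub>R x) = t powr \<beta> * F x"
  unfolding homog_def by blast

lemma homog_pd:
  fixes F :: "real ^ 'm::finite \<Rightarrow> real"
  assumes F: "smooth0 F" and h: "homog \<beta> F"
  shows "homog (\<beta> - 1) (pd i F)"
  unfolding homog_def
proof (intro allI impI)
  fix x :: "real ^ 'm" and t :: real assume x: "x \<noteq> 0" and t: "t > 0"
  have tx: "t *\<^sub>R x \<noteq> 0" using x t by simp
  have d: "(F has_derivative frechet_derivative F (at (t *\<^sub>R x))) (at (t *\<^sub>R x))"
    using smooth0_diff[OF F tx] frechet_derivative_works by blast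
  have "((\<lambda>y. t *\<^sub>R y) has_derivative (\<lambda>y. t *\<^sub>R y)) (at x)"
    by (auto intro!: derivative_eq_intros)
  from has_derivative_compose[OF this d]
  have 1: "((\<lambda>y. F (t *\<^sub>R y)) has_derivative (\<lambda>y. fd F (t *\<^sub>R x) (t *\<^sub>R y))) (at x)" .
  have "frechet_derivative (\<lambda>y. F (t *\<^sub>R y)) (at x) = frechet_derivative (\<lambda>y. t powr \<beta> * F y) (at x)"
    by (rule frechet_derivative_cong_open[OF open_punctured]) (use x t homogD[OF h] in auto)
  then have "pd i (\<lambda>y. F (t *\<^sub>R y)) x = pd i (\<lambda>y. t powr \<beta> * F y) x"
    unfolding pd_def by simp
  moreover have "pd i (\<lambda>y. F (t *\<^sub>R y)) x = t * pd i F (t *\<^sub>R x)"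
    unfolding pd_def frechet_derivative_eqI[OF 1]
    using linear_scale[OF has_derivative_linear[OF d], of t] by simp
  moreover have "pd i (\<lambda>y. t powr \<beta> * F y) x = t powr \<beta> * pd i F x"
    by (rule pd_cmult[OF smooth0_diff[OF F x]])
  ultimately have "t * pd i F (t *\<^sub>R x) = t powr \<beta> * pd i F x" by simp
  then show "pd i F (t *\<^sub>R x) = t powr (\<beta> - 1) * pd i F x"
    using t by (simp add: powr_diff field_simps)
qed

lemma euler_homog:
  fixes F :: "real ^ 'm::finite \<Rightarrow> real"
  assumes F: "smooth0 F" and h: "homog \<beta> F" and x: "x \<noteq> 0"
  shows "(\<Sum>i\<in>UNIV. x $ i * pd i F x) = \<beta> * F x"
proof -
  have "((\<lambda>t. F (0 + t *\<^sub>R x)) has_real_derivative fd F (0 + 1 *\<^sub>R x) x) (at 1)"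
    by (rule has_real_derivative_along_line) (use smooth0_diff[OF F x] in simp)
  then have 1: "((\<lambda>t. F (t *\<^sub>R x)) has_real_derivative fd F x x) (at 1)"
    by simp
  have "((\<lambda>t. t powr \<beta> * F x) has_real_derivative \<beta> * F x) (at 1)"
    by (auto intro!: derivative_eq_intros)
  then have "((\<lambda>t. F (t *\<^sub>R x)) has_real_derivative \<beta> * F x) (at 1)"
    by (rule DERIV_cong_ev[OF refl _ refl, THEN iffD1, rotated])
       (use eventually_nhds_in_open[of "{0<..}" "1::real"] homogD[OF h x] in \<open>auto elim!: eventually_mono\<close>)
  with 1 have "fd F x x = \<beta> * F x"
    by (rule DERIV_unique)
  then show ?thesis
    using frechet_derivative_expand[OF smooth0_diff[OF F x], of x] by simp
qed

lemma lap_mult: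
  assumes F: "smooth0 F" and G: "smooth0 G" and x: "x \<noteq> 0"
  shows "lap (\<lambda>x. F x * G x) x = F x * lap G x + 2 * (\<Sum>i\<in>UNIV. pd i F x * pd i G x) + lap F x * G x"
proof -
  note d = smooth0_diff
  have "pd i (pd i (\<lambda>x. F x * G x)) x = F x * pd i (pd i G) x + 2 * (pd i F x * pd i G x) + pd i (pd i F) x * G x" for i
  proof -
    have "pd i (pd i (\<lambda>x. F x * G x)) x = pd i (\<lambda>x. F x * pd i G x + pd i F x * G x) x"
      using x by (intro pd_cong pd_mult d[OF F] d[OF G])
    also have "\<dots> = pd i (\<lambda>x. F x * pd i G x) x + pd i (\<lambda>x. pd i F x * G x) x"
      by (intro pd_add differentiable_mult d[OF F] d[OF G] d[OF smooth0_pd[OF F]] d[OF smooth0_pd[OF G]] x)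
    also have "pd i (\<lambda>x. F x * pd i G x) x = F x * pd i (pd i G) x + pd i F x * pd i G x"
      by (intro pd_mult d[OF F] d[OF smooth0_pd[OF G]] x)
    also have "pd i (\<lambda>x. pd i F x * G x) x = pd i F x * pd i G x + pd i (pd i F) x * G x"
      by (intro pd_mult d[OF G] d[OF smooth0_pd[OF F]] x)
    finally show ?thesis by simp
  qed
  then show ?thesis
    unfolding lap_def by (simp add: sum.distrib sum_distrib_left sum_distrib_right)
qed

lemma norm_sq_sum: "(\<Sum>i\<in>UNIV. x $ i * x $ i) = (norm (x :: real ^ 'm::finite))\<^sup>2"
  by (simp add: power2_norm_eq_inner inner_vec_def)

lemma lap_norm_powr:
  fixes x :: "real ^ 'm::finite"
  assumes x: "norm x = 1"
  shows "lap (\<lambda>x. norm x powr \<gamma>) x = \<gamma> * (\<gamma> - 2 + real CARD('m))"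
proof -
  have x0: "x \<noteq> 0" using x by auto
  have "pd i (pd i (\<lambda>x. norm x powr \<gamma>)) x = \<gamma> * (1 + (\<gamma> - 2) * (x $ i * x $ i))" for i
  proof -
    have dn: "(\<lambda>x. norm x powr \<beta>) differentiable at x" for \<beta>
      using has_derivative_norm_powr[OF x0] unfolding differentiable_def by blast
    have "pd i (pd i (\<lambda>x. norm x powr \<gamma>)) x = pd i (\<lambda>x. \<gamma> * (norm x powr (\<gamma> - 2) * x $ i)) x"
      using x0 by (intro pd_cong) (auto simp: pd_norm_powr)
    also have "\<dots> = \<gamma> * pd i (\<lambda>x. norm x powr (\<gamma> - 2) * x $ i) x"
      by (intro pd_cmult differentiable_mult dn differentiable_coord)
    also have "pd i (\<lambda>x. norm x powr (\<gamma> - 2) * x $ i) x = norm x powr (\<gamma> - 2) * pd i (\<lambda>x. x $ i) x + pd i (\<lambda>x. norm x powr (\<gamma> - 2)) x * x $ i"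
      by (intro pd_mult dn differentiable_coord)
    finally show ?thesis using x by (simp add: pd_coord pd_norm_powr[OF x0])
  qed
  then have "lap (\<lambda>x. norm x powr \<gamma>) x = \<gamma> * (real CARD('m) + (\<gamma> - 2) * (\<Sum>i\<in>UNIV. x $ i * x $ i))"
    unfolding lap_def by (simp add: sum.distrib flip: sum_distrib_left)
  then show ?thesis
    unfolding norm_sq_sum x by simp
qed

text \<open>In the product rule the cross term is \<open>- 2 * \<beta> * \<beta> * F x\<close> by
  Euler's identity, and the Laplacian of the norm power is
  \<open>\<beta> * (\<beta> + 2 - N)\<close> with \<open>N = CARD('m)\<close>. Their sum is the
  origin of the quadratic expression for the eigenvalues.\<close>

lemma lap_radial_normalization:
  fixes F :: "real ^ 'm::finite \<Rightarrow> real"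
  assumes F: "smooth0 F" and h: "homog \<beta> F" and x: "norm x = 1"
  shows "lap (\<lambda>x. norm x powr (- \<beta>) * F x) x = lap F x - \<beta> * (\<beta> + real CARD('m) - 2) * F x"
proof -
  have x0: "x \<noteq> 0" using x by auto
  have "(\<Sum>i\<in>UNIV. pd i (\<lambda>x. norm x powr (- \<beta>)) x * pd i F x) = - \<beta> * (\<Sum>i\<in>UNIV. x $ i * pd i F x)"
    using x by (simp add: pd_norm_powr[OF x0] sum_distrib_left mult.assoc sum_negf)
  also have "\<dots> = - \<beta> * (\<beta> * F x)"
    unfolding euler_homog[OF F h x0] ..
  finally show ?thesis
    unfolding lap_mult[OF smooth_on_norm_powr F x0] lap_norm_powr[OF x] using x by (simp add: algebra_simps)
qed

lemma sum_Basis_vec: "(\<Sum>b\<in>Basis. g b) = (\<Sum>i\<in>UNIV. g (axis i (1::real) :: real ^ 'm::finite))"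
proof -
  have B: "(Basis :: (real ^ 'm) set) = range (\<lambda>i. axis i 1)"
    by (auto simp: Basis_vec_def)
  have "inj (\<lambda>i. axis i (1::real) :: real ^ 'm)"
    by (auto simp: inj_on_def axis_eq_axis)
  then show ?thesis unfolding B by (subst sum.reindex) (auto simp: o_def)
qed

lemma sgn_scale_pos: "t > 0 \<Longrightarrow> sgn (t *\<^sub>R x) = sgn (x :: 'a::real_normed_vector)"
  by (simp add: sgn_scaleR)

lemma homog_eq_0:
  assumes "homog \<beta> F" "\<And>y. norm y = 1 \<Longrightarrow> F y = 0" "x \<noteq> 0"
  shows "F x = 0"
proof -
  have "F (norm x *\<^sub>R sgn x) = norm x powr \<beta> * F (sgn x)"
    using homogD[OF assms(1), of "sgn x" "norm x"] assms(3) by (simp add: sgn_zero_iff)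
  moreover have "F (sgn x) = 0" using assms by (simp add: norm_sgn)
  ultimately show ?thesis
    using assms(3) by (simp add: sgn_div_norm)
qed

lemma radial_ext_homog: "homog 0 (radial_ext u)"
  unfolding homog_def radial_ext_def by (simp add: sgn_scale_pos)

text \<open>The gradient of \<open>r\<close> has degree \<open>- 1\<close>, so its radial extension
  is the gradient multiplied by the norm. On the sphere the divergence of this field is
  \<open>lap r\<close> plus the radial derivative of \<open>r\<close>, which vanishes by Euler's
  identity in degree \<open>0\<close>.\<close>

lemma sphere_laplacian_eq_lap:
  fixes u :: "real ^ 'm::finite \<Rightarrow> real"
  assumes u: "u \<in> smooth_sphere" and x: "norm x = 1"
  shows "sphere_laplacian u x = - lap (radial_ext u) x"
proof -
  define r where "r = radial_ext u"
  have r: "smooth0 r" using u unfolding smooth_sphere_def r_def by simp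
  have hr: "homog 0 r" unfolding r_def by (rule radial_ext_homog)
  have x0: "x \<noteq> 0" using x by auto
  define h where "h i y = norm y powr 1 * pd i r y" for i y
  have h: "smooth0 (h i)" for i
    unfolding h_def by (intro smooth_on_mult open_punctured smooth_on_norm_powr smooth0_pd r)
  define V where "V y = (\<Sum>i\<in>UNIV. h i y *\<^sub>R axis i (1::real) :: real ^ 'm)" for y
  have eq: "radial_ext (sphere_grad u) y = V y" if "y \<noteq> 0" for y
  proof -
    have "pd i r (sgn y) = h i y" for i
    proof -
      have "pd i r (sgn y) = (inverse (norm y)) powr (0 - 1) * pd i r y"
        using homogD[OF homog_pd[OF r hr] that, of "inverse (norm y)" i] that by (simp add: sgn_div_norm)
      then show ?thesis using that by (simp add: h_def powr_minus)
    qed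
    then show ?thesis
      unfolding radial_ext_def[of "sphere_grad u"] sphere_grad_def sum_Basis_vec V_def
      by (simp add: pd_def r_def)
  qed
  have hd: "(h i has_derivative frechet_derivative (h i) (at x)) (at x)" for i
    using smooth0_diff[OF h x0] frechet_derivative_works by blast
  have Vd: "(V has_derivative (\<lambda>v. \<Sum>i\<in>UNIV. fd (h i) x v *\<^sub>R axis i 1)) (at x)"
    unfolding V_def by (intro has_derivative_sum has_derivative_scaleR_left hd)
  have "frechet_derivative (radial_ext (sphere_grad u)) (at x) = frechet_derivative V (at x)"
    by (rule frechet_derivative_cong_open[OF open_punctured]) (use x0 eq in auto)
  then have "fd (radial_ext (sphere_grad u)) x (axis j 1) \<bullet> axis j 1 = pd j (h j) x" for j
    unfolding pd_def by (simp add: frechet_derivative_eqI[OF Vd] inner_sum_left inner_axis_axis if_distrib cong: if_cong)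
  then have "sphere_div (sphere_grad u) x = (\<Sum>j\<in>UNIV. pd j (h j) x)"
    unfolding sphere_div_def sum_Basis_vec by simp
  also have "pd j (h j) x = pd j (pd j r) x + x $ j * pd j r x" for j
  proof -
    have "pd j (h j) x = norm x powr 1 * pd j (pd j r) x + pd j (\<lambda>y. norm y powr 1) x * pd j r x"
      unfolding h_def
      by (intro pd_mult smooth0_diff[OF smooth_on_norm_powr x0] smooth0_diff[OF smooth0_pd[OF r] x0])
    from this[unfolded pd_norm_powr[OF x0]] show ?thesis using x by simp
  qed
  then have "(\<Sum>j\<in>UNIV. pd j (h j) x) = lap r x"
    using euler_homog[OF r hr x0] by (simp add: lap_def sum.distrib)
  finally show ?thesis
    using x unfolding sphere_laplacian_def r_def by simp
qed

definition sphere_restrict :: "(real ^ 'm::finite \<Rightarrow> real) \<Rightarrow> real ^ 'm \<Rightarrow> real" where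
  "sphere_restrict F x = (if norm x = 1 then F x else 0)"

lemma radial_ext_restrict:
  assumes "homog \<beta> F" "x \<noteq> 0"
  shows "radial_ext (sphere_restrict F) x = norm x powr (- \<beta>) * F x"
proof -
  have "norm (sgn x) = 1" using assms by (simp add: norm_sgn)
  moreover have "F (sgn x) = inverse (norm x) powr \<beta> * F x"
    using homogD[OF assms, of "inverse (norm x)"] assms by (simp add: sgn_div_norm)
  moreover have "inverse (norm x) powr \<beta> = norm x powr (- \<beta>)"
    using assms by (simp add: inverse_powr powr_minus)
  ultimately show ?thesis
    unfolding radial_ext_def sphere_restrict_def by simp
qed

lemma restrict_smooth_sphere:
  assumes "smooth0 F" "homog \<beta> F"
  shows "sphere_restrict F \<in> smooth_sphere"
proof -
  have "smooth0 (\<lambda>x. norm x powr (- \<beta>) * F x)"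
    by (intro smooth_on_mult open_punctured smooth_on_norm_powr assms)
  then have "smooth0 (radial_ext (sphere_restrict F))"
    by (rule smooth0_cong[rotated]) (simp add: radial_ext_restrict[OF assms(2)])
  then show ?thesis
    unfolding smooth_sphere_def by (auto simp: sphere_restrict_def)
qed

lemma sphere_laplacian_restrict:
  fixes F :: "real ^ 'm::finite \<Rightarrow> real"
  assumes F: "smooth0 F" and h: "homog \<beta> F" and x: "norm x = 1"
  shows "sphere_laplacian (sphere_restrict F) x = \<beta> * (\<beta> + real CARD('m) - 2) * F x - lap F x"
proof -
  have x0: "x \<noteq> 0" using x by auto
  have "lap (radial_ext (sphere_restrict F)) x = lap (\<lambda>x. norm x powr (- \<beta>) * F x) x"
    by (rule lap_cong[OF radial_ext_restrict[OF h] x0])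
  then show ?thesis
    unfolding sphere_laplacian_eq_lap[OF restrict_smooth_sphere[OF F h] x]
    by (simp add: lap_radial_normalization[OF F h x])
qed

definition harm :: "real \<Rightarrow> (real ^ 'm::finite \<Rightarrow> real) \<Rightarrow> bool" where
  "harm \<beta> F \<longleftrightarrow> smooth0 F \<and> homog \<beta> F \<and> (\<forall>x. x \<noteq> 0 \<longrightarrow> lap F x = 0)"

lemma homog_lap:
  assumes "smooth0 F" "homog \<beta> F"
  shows "homog (\<beta> - 2) (lap F)"
proof -
  have "homog (\<beta> - 1 - 1) (pd i (pd i F))" for i
    by (intro homog_pd smooth0_pd assms)
  then show ?thesis
    unfolding homog_def lap_def by (simp add: sum_distrib_left)
qed

lemma harm_of_eigenfunction:
  fixes u :: "real ^ 'm::finite \<Rightarrow> real"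
  assumes u: "u \<in> eigenspace smooth_sphere sphere_laplacian \<nu>"
    and \<beta>: "\<beta> * (\<beta> + real CARD('m) - 2) = \<nu>"
  obtains F where "harm \<beta> F" "u = sphere_restrict F"
proof -
  have us: "u \<in> smooth_sphere" and ul: "\<And>x. sphere_laplacian u x = \<nu> * u x"
    using u unfolding eigenspace_def by (auto simp: fun_eq_iff)
  define F where "F x = norm x powr \<beta> * radial_ext u x" for x
  have r: "smooth0 (radial_ext u)" using us unfolding smooth_sphere_def by simp
  have F: "smooth0 F"
    unfolding F_def by (intro smooth_on_mult open_punctured smooth_on_norm_powr r)
  have h: "homog \<beta> F"
    unfolding homog_def F_def
    using homogD[OF radial_ext_homog[of u]] by (simp add: powr_mult)
  have uF: "u = sphere_restrict F"
  proof
    fix x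
    show "u x = sphere_restrict F x"
    proof (cases "norm x = 1")
      case True
      then have "sgn x = x" by (simp add: sgn_div_norm)
      then show ?thesis using True by (simp add: sphere_restrict_def F_def radial_ext_def)
    next
      case False
      then show ?thesis using us by (simp add: sphere_restrict_def smooth_sphere_def)
    qed
  qed
  have 1: "lap F x = 0" if "norm x = 1" for x
    using sphere_laplacian_restrict[OF F h that] ul[of x] that \<beta> unfolding uF[symmetric]
    by (simp add: uF sphere_restrict_def)
  \<comment> \<open>\<open>lap F\<close> is homogeneous of degree \<open>\<beta> - 2\<close>, so its
    vanishing on the sphere suffices.\<close>
  have "lap F x = 0" if "x \<noteq> 0" for x
    by (rule homog_eq_0[OF homog_lap[OF F h] 1 that])
  with F h have "harm \<beta> F" unfolding harm_def by blast
  then show ?thesis using uF that by blast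
qed

lemma eigenfunction_of_harm:
  fixes F :: "real ^ 'm::finite \<Rightarrow> real"
  assumes F: "harm \<beta> F" and \<beta>: "\<beta> * (\<beta> + real CARD('m) - 2) = \<nu>"
  shows "sphere_restrict F \<in> eigenspace smooth_sphere sphere_laplacian \<nu>"
proof -
  have F': "smooth0 F" "homog \<beta> F" "\<And>x. x \<noteq> 0 \<Longrightarrow> lap F x = 0"
    using F unfolding harm_def by auto
  have "sphere_laplacian (sphere_restrict F) x = \<nu> * sphere_restrict F x" for x
  proof (cases "norm x = 1")
    case True
    then have "x \<noteq> 0" by auto
    then show ?thesis
      using sphere_laplacian_restrict[OF F'(1,2) True] F'(3) \<beta> True by (simp add: sphere_restrict_def)
  next
    case False
    then show ?thesis by (simp add: sphere_restrict_def sphere_laplacian_def)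
  qed
  then show ?thesis
    using restrict_smooth_sphere[OF F'(1,2)] unfolding eigenspace_def by auto
qed

section \<open>Behaviour of the Laplacian at a maximum on the sphere\<close>

lemma second_derivative_at_max:
  fixes r :: "real ^ 'm::finite \<Rightarrow> real"
  assumes r: "smooth0 r" and x: "x \<noteq> 0" and max: "\<And>y. y \<noteq> 0 \<Longrightarrow> r y \<le> r x"
  shows "pd i (pd i r) x \<le> 0"
proof (rule ccontr)
  assume "\<not> pd i (pd i r) x \<le> 0"
  then have pos: "pd i (pd i r) x > 0" by simp
  define e where "e = (axis i 1 :: real ^ 'm)"
  have ne: "norm e = 1" unfolding e_def by simp
  have nz: "x + t *\<^sub>R e \<noteq> 0" if "\<bar>t\<bar> < norm x" for t
  proof
    assume "x + t *\<^sub>R e = 0"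
    then have "x = - (t *\<^sub>R e)" by (simp add: eq_neg_iff_add_eq_0)
    then have "norm x = \<bar>t\<bar>" using ne by simp
    then show False using that by simp
  qed
  define g where "g t = r (x + t *\<^sub>R e)" for t
  define g' where "g' t = pd i r (x + t *\<^sub>R e)" for t
  have dg: "(g has_real_derivative g' t) (at t)" if "\<bar>t\<bar> < norm x" for t
    unfolding g_def g'_def pd_def e_def[symmetric]
    by (intro has_real_derivative_along_line smooth0_diff[OF r] nz that)
  have "(g' has_real_derivative pd i (pd i r) (x + 0 *\<^sub>R e)) (at 0)"
    unfolding g'_def pd_def[of i "pd i r"] e_def[symmetric]
    by (intro has_real_derivative_along_line smooth0_diff[OF smooth0_pd[OF r]] nz) (use x in simp)
  then have dg': "(g' has_real_derivative pd i (pd i r) x) (at 0)" by simp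
  have "g' 0 = 0"
  proof (rule DERIV_local_max[OF dg])
    show "0 < norm x" using x by simp
    show "\<forall>y. \<bar>0 - y\<bar> < norm x \<longrightarrow> g y \<le> g 0"
      using max nz unfolding g_def by simp
  qed (use x in simp)
  obtain d where d: "d > 0" "\<And>h. 0 < h \<Longrightarrow> h < d \<Longrightarrow> g' 0 < g' (0 + h)"
    using DERIV_pos_inc_right[OF dg' pos] by auto
  define h where "h = min d (norm x) / 2"
  have "norm x > 0" using x by simp
  then have h: "0 < h" "h < d" "h < norm x" using d(1) unfolding h_def by linarith+
  have "\<exists>z>0. z < h \<and> g h - g 0 = (h - 0) * g' z"
    by (rule MVT2[OF h(1)]) (use h dg in auto)
  then obtain z where z: "0 < z" "z < h" "g h - g 0 = h * g' z" by auto
  have "g' z > 0"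
    using d(2)[of z] z h \<open>g' 0 = 0\<close> by simp
  then have "h * g' z > 0" using h(1) by (rule mult_pos_pos[rotated])
  then have "g h > g 0" using z(3) by linarith
  moreover have "g h \<le> g 0"
    using max[OF nz[of h]] h unfolding g_def by simp
  ultimately show False by simp
qed

text \<open>Normalized to degree \<open>0\<close>, the function attains at \<open>x\<close> its
  maximum over the whole punctured space, where all pure second derivatives are nonpositive.\<close>

lemma lap_at_max:
  fixes F :: "real ^ 'm::finite \<Rightarrow> real"
  assumes F: "smooth0 F" and h: "homog \<beta> F" and x: "norm x = 1"
    and max: "\<And>y. norm y = 1 \<Longrightarrow> F y \<le> F x"
  shows "lap F x \<le> \<beta> * (\<beta> + real CARD('m) - 2) * F x"
proof -
  have x0: "x \<noteq> 0" using x by auto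
  define r where "r y = norm y powr (- \<beta>) * F y" for y
  have r: "smooth0 r"
    unfolding r_def by (intro smooth_on_mult open_punctured smooth_on_norm_powr F)
  have rF: "r y = F (sgn y)" if "y \<noteq> 0" for y
    using radial_ext_restrict[OF h that] that
    by (simp add: r_def radial_ext_def sphere_restrict_def norm_sgn)
  have "sgn x = x" using x by (simp add: sgn_div_norm)
  then have "r y \<le> r x" if "y \<noteq> 0" for y
    using rF[OF that] rF[OF x0] max[of "sgn y"] that by (simp add: norm_sgn)
  then have "lap r x \<le> 0"
    unfolding lap_def by (intro sum_nonpos second_derivative_at_max[OF r x0]) auto
  then show ?thesis
    using lap_radial_normalization[OF F h x] unfolding r_def by simp
qed

lemma sphere_max:
  fixes F :: "real ^ 'm::finite \<Rightarrow> real"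
  assumes "smooth0 F"
  obtains x where "norm x = 1" "\<And>y. norm y = 1 \<Longrightarrow> F y \<le> F x"
proof -
  have "continuous_on (sphere 0 1) F"
    using smooth_on_continuous[OF assms] by (rule continuous_on_subset) auto
  moreover have "sphere 0 1 \<noteq> ({} :: (real ^ 'm) set)"
  proof -
    have "(axis undefined 1 :: real ^ 'm) \<in> sphere 0 1" by simp
    then show ?thesis by blast
  qed
  ultimately obtain x where "x \<in> sphere 0 1" "\<forall>y\<in>sphere 0 1. F y \<le> F x"
    using continuous_attains_sup[of "sphere 0 1" F] by auto
  then show ?thesis using that by auto
qed

lemma homog_nonpos:
  assumes "homog \<beta> F" "\<And>y. norm y = 1 \<Longrightarrow> F y \<le> 0" "x \<noteq> 0"
  shows "F x \<le> 0"
proof -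
  have "F (norm x *\<^sub>R sgn x) = norm x powr \<beta> * F (sgn x)"
    using homogD[OF assms(1), of "sgn x" "norm x"] assms(3) by (simp add: sgn_zero_iff)
  moreover have "F (sgn x) \<le> 0" using assms by (simp add: norm_sgn)
  ultimately show ?thesis
    using assms(3) by (simp add: sgn_div_norm mult_nonneg_nonpos)
qed

subsection \<open>Homogeneous harmonic functions\<close>

lemma lap_cmult:
  assumes F: "smooth0 F" and x: "x \<noteq> 0"
  shows "lap (\<lambda>x. c * F x) x = c * lap F x"
proof -
  have "pd i (pd i (\<lambda>x. c * F x)) x = c * pd i (pd i F) x" for i
  proof -
    have "pd i (pd i (\<lambda>x. c * F x)) x = pd i (\<lambda>x. c * pd i F x) x"
      using x by (intro pd_cong pd_cmult smooth0_diff[OF F])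
    also have "\<dots> = c * pd i (pd i F) x"
      by (intro pd_cmult smooth0_diff[OF smooth0_pd[OF F]] x)
    finally show ?thesis .
  qed
  then show ?thesis unfolding lap_def by (simp add: sum_distrib_left)
qed

lemma lap_sum:
  assumes F: "\<And>j. j \<in> J \<Longrightarrow> smooth0 (F j)" and x: "x \<noteq> 0"
  shows "lap (\<lambda>x. \<Sum>j\<in>J. F j x) x = (\<Sum>j\<in>J. lap (F j) x)"
proof -
  have "pd i (pd i (\<lambda>x. \<Sum>j\<in>J. F j x)) x = (\<Sum>j\<in>J. pd i (pd i (F j)) x)" for i
  proof -
    have "pd i (pd i (\<lambda>x. \<Sum>j\<in>J. F j x)) x = pd i (\<lambda>x. \<Sum>j\<in>J. pd i (F j) x) x"
      using x by (intro pd_cong pd_sum smooth0_diff[OF F])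
    also have "\<dots> = (\<Sum>j\<in>J. pd i (pd i (F j)) x)"
      by (intro pd_sum smooth0_diff[OF smooth0_pd[OF F]] x)
    finally show ?thesis .
  qed
  then show ?thesis unfolding lap_def by (subst sum.swap) simp
qed

lemma harmD:
  assumes "harm \<beta> F"
  shows "smooth0 F" "homog \<beta> F" "x \<noteq> 0 \<Longrightarrow> lap F x = 0"
  using assms unfolding harm_def by auto

lemma harm_pd:
  assumes "harm \<beta> F"
  shows "harm (\<beta> - 1) (pd i F)"
proof -
  note F = harmD[OF assms]
  have "lap (pd i F) x = 0" if x: "x \<noteq> 0" for x
  proof -
    have "pd j (pd j (pd i F)) x = pd i (pd j (pd j F)) x" for j
    proof -
      have "pd j (pd j (pd i F)) x = pd j (pd i (pd j F)) x"
        using x by (intro pd_cong pd_commute F(1))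
      also have "\<dots> = pd i (pd j (pd j F)) x"
        by (rule pd_commute[OF smooth0_pd[OF F(1)] x])
      finally show ?thesis .
    qed
    then have "lap (pd i F) x = pd i (\<lambda>x. \<Sum>j\<in>UNIV. pd j (pd j F) x) x"
      unfolding lap_def
      by (simp add: pd_sum[OF smooth0_diff[OF smooth0_pd[OF smooth0_pd[OF F(1)]] x]])
    also have "\<dots> = pd i (\<lambda>_. 0) x"
      using x F(3) by (intro pd_cong) (simp_all add: lap_def)
    finally show ?thesis by (simp add: pd_const)
  qed
  then show ?thesis
    unfolding harm_def using smooth0_pd[OF F(1)] homog_pd[OF F(1,2)] by blast
qed

text \<open>At the maximum point the two expressions for the Laplacian show that a positive multiple
  of \<open>F x\<close> is nonpositive. Used with \<open>\<mu> = 0\<close> for harmonic functions of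
  degree strictly between \<open>2 - N\<close> and \<open>0\<close>, \<open>N = CARD('m)\<close>,
  and with \<open>\<beta> = 0\<close> for negative eigenvalues.\<close>

lemma maximum_principle:
  fixes F :: "real ^ 'm::finite \<Rightarrow> real"
  assumes F: "smooth0 F" "homog \<beta> F" and lap: "\<And>x. norm x = 1 \<Longrightarrow> lap F x = \<mu> * F x"
    and \<mu>: "\<beta> * (\<beta> + real CARD('m) - 2) < \<mu>" and y: "y \<noteq> 0"
  shows "F y \<le> 0"
proof -
  obtain x where x: "norm x = 1" "\<And>y. norm y = 1 \<Longrightarrow> F y \<le> F x"
    using sphere_max[OF F(1)] by blast
  have "\<mu> * F x \<le> \<beta> * (\<beta> + real CARD('m) - 2) * F x"
    using lap_at_max[OF F x] lap[OF x(1)] by simp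
  then have "(\<mu> - \<beta> * (\<beta> + real CARD('m) - 2)) * F x \<le> 0"
    by (simp add: algebra_simps)
  then have "F x \<le> 0" using \<mu> by (simp add: mult_le_0_iff)
  then show ?thesis
    using homog_nonpos[OF F(2) _ y] x(2) order_trans by blast
qed

lemma maximum_principle_zero:
  fixes F :: "real ^ 'm::finite \<Rightarrow> real"
  assumes F: "smooth0 F" "homog \<beta> F" and lap: "\<And>x. norm x = 1 \<Longrightarrow> lap F x = \<mu> * F x"
    and \<mu>: "\<beta> * (\<beta> + real CARD('m) - 2) < \<mu>" and y: "y \<noteq> 0"
  shows "F y = 0"
proof -
  have "(- 1) * F y \<le> 0"
  proof (rule maximum_principle[where F = "\<lambda>x. (- 1) * F x", OF _ _ _ \<mu> y])
    show "smooth0 (\<lambda>x. (- 1) * F x)" by (intro smooth_on_cmult open_punctured F)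
    show "homog \<beta> (\<lambda>x. (- 1) * F x)" using F(2) by (simp add: homog_def)
    show "lap (\<lambda>x. (- 1) * F x) x = \<mu> * ((- 1) * F x)" if "norm x = 1" for x
    proof -
      have "x \<noteq> 0" using that by auto
      then show ?thesis using lap_cmult[OF F(1), of x "- 1"] lap[OF that] by simp
    qed
  qed
  moreover have "F y \<le> 0" by (rule maximum_principle[OF F lap \<mu> y])
  ultimately show ?thesis by simp
qed

lemma harm_eq_0_of_neg:
  fixes F :: "real ^ 'm::finite \<Rightarrow> real"
  assumes "harm \<beta> F" "\<beta> * (\<beta> + real CARD('m) - 2) < 0" "x \<noteq> 0"
  shows "F x = 0"
proof (rule maximum_principle_zero[OF harmD(1,2)[OF assms(1)] _ assms(2,3)])
  show "lap F x = 0 * F x" if "norm x = 1" for x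
  proof -
    have "x \<noteq> 0" using that by auto
    then show ?thesis using harmD(3)[OF assms(1)] by simp
  qed
qed

text \<open>
  Bochner's argument: the squared gradient of a harmonic function of degree zero attains its maximum
  over the sphere, and there the Ricci curvature of the sphere forces it to vanish.
\<close>

lemma harm_0_pd_bochner:
  fixes F :: "real ^ 'm::finite \<Rightarrow> real"
  assumes H: "harm 0 F" and N: "CARD('m) \<ge> 3" and y: "y \<noteq> 0"
  shows "pd k F y = 0"
proof -
  note F = harmD[OF H]
  define w where "w i = pd i F" for i
  have wh: "harm (- 1) (w i)" for i
    using harm_pd[OF H, of i] unfolding w_def by simp
  note w = harmD[OF wh]
  define G where "G y = (\<Sum>i\<in>UNIV. w i y * w i y)" for y
  have G: "smooth0 G"
    unfolding G_def by (intro smooth_on_sum smooth_on_mult open_punctured w)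
  have hG: "homog (- 2) G"
    unfolding homog_def G_def
  proof (intro allI impI)
    fix x :: "real ^ 'm" and t :: real assume x: "x \<noteq> 0" and t: "t > 0"
    have "t powr (- 1) * t powr (- 1) = t powr (- 2)" by (subst powr_add[symmetric]) simp
    then have "w i (t *\<^sub>R x) * w i (t *\<^sub>R x) = t powr (- 2) * (w i x * w i x)" for i
      unfolding homogD[OF w(2) x t] by (metis mult.commute mult.left_commute)
    then show "(\<Sum>i\<in>UNIV. w i (t *\<^sub>R x) * w i (t *\<^sub>R x)) = t powr (- 2) * (\<Sum>i\<in>UNIV. w i x * w i x)"
      by (simp add: sum_distrib_left)
  qed
  obtain x where x: "norm x = 1" "\<And>y. norm y = 1 \<Longrightarrow> G y \<le> G x"
    using sphere_max[OF G] by blast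
  have x0: "x \<noteq> 0" using x by auto
  define h where "h i j = pd j (w i) x" for i j
  have sym: "h i j = h j i" for i j
    unfolding h_def w_def by (rule pd_commute[OF F(1) x0])
  have e1: "(\<Sum>j\<in>UNIV. x $ j * h i j) = - w i x" for i
    using euler_homog[OF w(1,2) x0] unfolding h_def by simp
  have e0: "(\<Sum>i\<in>UNIV. x $ i * w i x) = 0"
    using euler_homog[OF F(1,2) x0] unfolding w_def by simp
  have xx: "(\<Sum>i\<in>UNIV. x $ i * x $ i) = 1" unfolding norm_sq_sum x(1) by simp
  \<comment> \<open>The \<open>w i\<close> are harmonic, so only the gradient terms of the product
    rule remain.\<close>
  have lapG: "lap G x = 2 * (\<Sum>i\<in>UNIV. \<Sum>j\<in>UNIV. h i j * h i j)"
  proof -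
    have "lap G x = (\<Sum>i\<in>UNIV. lap (\<lambda>y. w i y * w i y) x)"
      unfolding G_def by (intro lap_sum smooth_on_mult open_punctured w x0)
    also have "\<dots> = (\<Sum>i\<in>UNIV. 2 * (\<Sum>j\<in>UNIV. h i j * h i j))"
      by (intro sum.cong refl) (simp add: lap_mult[OF w(1) w(1) x0] w(3)[OF x0] h_def)
    finally show ?thesis by (simp add: sum_distrib_left)
  qed
  have s1: "(\<Sum>i\<in>UNIV. \<Sum>j\<in>UNIV. h i j * (x $ j * w i x)) = - G x"
  proof -
    have "(\<Sum>j\<in>UNIV. h i j * (x $ j * w i x)) = w i x * (\<Sum>j\<in>UNIV. x $ j * h i j)" for i
      by (simp add: sum_distrib_left mult_ac)
    then show ?thesis unfolding e1 G_def by (simp add: sum_negf)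
  qed
  have s2: "(\<Sum>i\<in>UNIV. \<Sum>j\<in>UNIV. h i j * (x $ i * w j x)) = - G x"
    using s1 by (subst sum.swap) (simp add: sym)
  have s3: "(\<Sum>i\<in>UNIV. \<Sum>j\<in>UNIV. (x $ i * w j x) * (x $ i * w j x)) = G x"
  proof -
    have "(\<Sum>j\<in>UNIV. (x $ i * w j x) * (x $ i * w j x)) = (x $ i * x $ i) * G x" for i
      unfolding G_def by (simp add: sum_distrib_left mult_ac)
    then show ?thesis using xx by (simp flip: sum_distrib_right)
  qed
  have s4: "(\<Sum>i\<in>UNIV. \<Sum>j\<in>UNIV. (x $ j * w i x) * (x $ j * w i x)) = G x"
    using s3 by (subst sum.swap) simp
  have s5: "(\<Sum>i\<in>UNIV. \<Sum>j\<in>UNIV. (x $ i * w j x) * (x $ j * w i x)) = 0"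
  proof -
    have "(\<Sum>j\<in>UNIV. (x $ i * w j x) * (x $ j * w i x)) = (x $ i * w i x) * (\<Sum>j\<in>UNIV. x $ j * w j x)" for i
      by (simp add: sum_distrib_left mult_ac)
    then show ?thesis unfolding e0 by simp
  qed
  \<comment> \<open>By \<open>e1\<close>, \<open>e0\<close> and \<open>xx\<close> this matrix
    annihilates \<open>x\<close>: it is the Hessian with its radial part removed. The radial part
    contributes \<open>2 * G x\<close> to the squared norm of \<open>h\<close>.\<close>
  have "0 \<le> (\<Sum>i\<in>UNIV. \<Sum>j\<in>UNIV. (h i j + x $ i * w j x + x $ j * w i x) * (h i j + x $ i * w j x + x $ j * w i x))"
    by (intro sum_nonneg) auto
  also have "\<dots> = (\<Sum>i\<in>UNIV. \<Sum>j\<in>UNIV. h i j * h i j + 2 * (h i j * (x $ i * w j x)) + 2 * (h i j * (x $ j * w i x)) +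
      (x $ i * w j x) * (x $ i * w j x) + (x $ j * w i x) * (x $ j * w i x) + 2 * ((x $ i * w j x) * (x $ j * w i x)))"
    by (intro sum.cong refl) (simp add: algebra_simps)
  also have "\<dots> = (\<Sum>i\<in>UNIV. \<Sum>j\<in>UNIV. h i j * h i j) - 2 * G x"
    unfolding sum.distrib sum_distrib_left[symmetric] s1 s2 s3 s4 s5 by simp
  finally have "4 * G x \<le> lap G x" unfolding lapG by simp
  \<comment> \<open>\<open>G\<close> has degree \<open>- 2\<close>. The comparison with
    \<open>4 * G x\<close> leaves the factor \<open>2 * N - 4\<close>, \<open>N = CARD('m)\<close>;
    it vanishes for \<open>N = 2\<close>, so the circle needs its own argument.\<close>
  also have "\<dots> \<le> - 2 * (- 2 + real CARD('m) - 2) * G x"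
    by (rule lap_at_max[OF G hG x])
  finally have "(2 * real CARD('m) - 4) * G x \<le> 0" by (simp add: algebra_simps)
  moreover have "2 * real CARD('m) - 4 > 0" using N by simp
  ultimately have "G x \<le> 0" by (simp add: mult_le_0_iff)
  then have "G y \<le> 0"
    using homog_nonpos[OF hG _ y] x(2) order_trans by blast
  moreover have "w k y * w k y \<le> G y"
    unfolding G_def by (rule member_le_sum) auto
  ultimately have "w k y * w k y \<le> 0" by simp
  then show ?thesis unfolding w_def by (metis mult_eq_0_iff order_antisym zero_le_square)
qed

section \<open>Harmonic functions in the plane, through their restriction to the circle\<close>

context
  fixes i j :: "'m::finite"
  assumes ij: "i \<noteq> j" "UNIV = {i, j}"
begin

definition circle :: "real \<Rightarrow> real ^ 'm" where
  "circle \<theta> = cos \<theta> *\<^sub>R axis i 1 + sin \<theta> *\<^sub>R axis j 1"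

lemma circle_nth: "circle \<theta> $ i = cos \<theta>" "circle \<theta> $ j = sin \<theta>"
  using ij(1) by (auto simp: circle_def axis_def)

lemma sum_pair: "(\<Sum>l\<in>UNIV. f l) = f i + f j" for f :: "'m \<Rightarrow> real"
  unfolding ij(2) using ij(1) by simp

lemma norm_circle: "norm (circle \<theta>) = 1"
proof -
  have "(norm (circle \<theta>))\<^sup>2 = 1"
    unfolding norm_sq_sum[symmetric] sum_pair circle_nth
    using sin_cos_squared_add[of \<theta>] by (simp add: power2_eq_square)
  then show ?thesis by (simp add: power2_eq_1_iff) (metis norm_ge_zero neg_0_le_iff_le not_one_le_zero)
qed

lemma circle_nonzero: "circle \<theta> \<noteq> 0"
  using norm_circle[of \<theta>] by auto

lemma circle_exhaust:
  assumes "norm x = 1"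
  obtains \<theta> where "x = circle \<theta>"
proof -
  have "(x $ i)\<^sup>2 + (x $ j)\<^sup>2 = 1"
    using norm_sq_sum[of x] assms unfolding sum_pair by (simp add: power2_eq_square)
  then obtain \<theta> where "x $ i = cos \<theta>" "x $ j = sin \<theta>"
    using sincos_total_2pi by metis
  then have "x = circle \<theta>"
    using ij(2) by (simp add: vec_eq_iff circle_nth) (metis UNIV_I circle_nth insertE singletonD)
  then show ?thesis using that by blast
qed

lemma circle_derivative:
  fixes F :: "real ^ 'm \<Rightarrow> real"
  assumes "smooth0 F"
  shows "((\<lambda>\<theta>. F (circle \<theta>)) has_real_derivative
     - sin \<theta> * pd i F (circle \<theta>) + cos \<theta> * pd j F (circle \<theta>)) (at \<theta>)"
proof -
  have d: "F differentiable at (circle \<theta>)"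
    by (rule smooth0_diff[OF assms circle_nonzero])
  define v where "v = (- sin \<theta>) *\<^sub>R axis i 1 + cos \<theta> *\<^sub>R (axis j 1 :: real ^ 'm)"
  have "(circle has_derivative (\<lambda>s. s *\<^sub>R v)) (at \<theta>)"
    unfolding circle_def[abs_def] v_def
    by (auto intro!: derivative_eq_intros simp: algebra_simps)
  from has_derivative_compose[OF this d[unfolded frechet_derivative_works]]
  have "((\<lambda>\<theta>. F (circle \<theta>)) has_derivative (\<lambda>s. fd F (circle \<theta>) (s *\<^sub>R v))) (at \<theta>)" .
  moreover have "fd F (circle \<theta>) (s *\<^sub>R v) =
     (- sin \<theta> * pd i F (circle \<theta>) + cos \<theta> * pd j F (circle \<theta>)) * s" for s
    unfolding frechet_derivative_expand[OF d] sum_pair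
    using ij(1) by (simp add: v_def axis_def algebra_simps)
  ultimately show ?thesis by (simp add: has_field_derivative_def)
qed

text \<open>Laplace's equation in polar coordinates for degree \<open>\<alpha>\<close>. Euler's
  identities for \<open>F\<close> and its partial derivatives eliminate the radial derivatives, and
  \<open>A + C = 0\<close> removes the rest.\<close>

lemma harm_circle_ode:
  fixes F :: "real ^ 'm \<Rightarrow> real"
  assumes H: "harm \<alpha> F"
  shows "((\<lambda>\<theta>. - sin \<theta> * pd i F (circle \<theta>) + cos \<theta> * pd j F (circle \<theta>)) has_real_derivative
     - (\<alpha> * \<alpha>) * F (circle \<theta>)) (at \<theta>)"
proof -
  note F = harmD[OF H]
  let ?x = "circle \<theta>"
  let ?s = "sin \<theta>" and ?c = "cos \<theta>"
  define A where "A = pd i (pd i F) ?x"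
  define B where "B = pd j (pd i F) ?x"
  define C where "C = pd j (pd j F) ?x"
  have B': "pd i (pd j F) ?x = B"
    unfolding B_def by (rule pd_commute[OF F(1) circle_nonzero])
  have e: "?c * pd i F ?x + ?s * pd j F ?x = \<alpha> * F ?x"
    using euler_homog[OF F(1,2) circle_nonzero] unfolding sum_pair circle_nth .
  have ei: "?c * A + ?s * B = (\<alpha> - 1) * pd i F ?x"
    using euler_homog[OF smooth0_pd[OF F(1)] homog_pd[OF F(1,2)] circle_nonzero]
    unfolding sum_pair circle_nth A_def B_def .
  have ej: "?c * B + ?s * C = (\<alpha> - 1) * pd j F ?x"
    using euler_homog[OF smooth0_pd[OF F(1)] homog_pd[OF F(1,2)] circle_nonzero]
    unfolding sum_pair circle_nth B'[symmetric] C_def .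
  have l: "A + C = 0"
    using F(3)[OF circle_nonzero] unfolding lap_def sum_pair A_def C_def .
  have sc: "?s * ?s + ?c * ?c = 1"
    using sin_cos_squared_add[of \<theta>] by (simp add: power2_eq_square)
  have "((\<lambda>\<theta>. - sin \<theta> * pd i F (circle \<theta>) + cos \<theta> * pd j F (circle \<theta>)) has_real_derivative
     (- ?c * pd i F ?x + (- ?s * A + ?c * B) * (- ?s)) + (- ?s * pd j F ?x + (- ?s * B + ?c * C) * ?c)) (at \<theta>)"
  proof (intro DERIV_add DERIV_mult)
    show "((\<lambda>\<theta>. pd i F (circle \<theta>)) has_real_derivative - ?s * A + ?c * B) (at \<theta>)"
      using circle_derivative[OF smooth0_pd[OF F(1)], of i \<theta>] unfolding A_def B_def .
    show "((\<lambda>\<theta>. pd j F (circle \<theta>)) has_real_derivative - ?s * B + ?c * C) (at \<theta>)"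
      using circle_derivative[OF smooth0_pd[OF F(1)], of j \<theta>] unfolding B' C_def .
  qed (auto intro!: derivative_eq_intros)
  moreover have "(- ?c * pd i F ?x + (- ?s * A + ?c * B) * (- ?s)) + (- ?s * pd j F ?x + (- ?s * B + ?c * C) * ?c)
     = - (\<alpha> * \<alpha>) * F ?x"
  proof -
    have "(- ?c * pd i F ?x + (- ?s * A + ?c * B) * (- ?s)) + (- ?s * pd j F ?x + (- ?s * B + ?c * C) * ?c)
      = - (?c * pd i F ?x + ?s * pd j F ?x) + (?s * ?s + ?c * ?c) * (A + C) - (?c * (?c * A + ?s * B) + ?s * (?c * B + ?s * C))"
    proof -
      have "(- c * p + (- s * A + c * B) * (- s)) + (- s * q + (- s * B + c * C) * c)
        = - (c * p + s * q) + (s * s + c * c) * (A + C) - (c * (c * A + s * B) + s * (c * B + s * C))"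
        for s c p q :: real by (simp add: algebra_simps)
      then show ?thesis .
    qed
    also have "?c * (?c * A + ?s * B) + ?s * (?c * B + ?s * C) = (\<alpha> - 1) * (?c * pd i F ?x + ?s * pd j F ?x)"
      unfolding ei ej by (simp add: algebra_simps)
    finally show ?thesis unfolding e l sc by (simp add: algebra_simps)
  qed
  ultimately show ?thesis by simp
qed

text \<open>Here \<open>g''\<close> is zero, so \<open>g1\<close> is constant, and periodicity of
  \<open>g\<close> makes it vanish somewhere. The tangential derivative is thus zero, and the radial
  one is zero by Euler's identity in degree \<open>0\<close>.\<close>

lemma harm_0_pd_circle:
  fixes F :: "real ^ 'm \<Rightarrow> real"
  assumes H: "harm 0 F" and x: "x \<noteq> 0"
  shows "pd k F x = 0"
proof -
  note F = harmD[OF H]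
  define g where "g \<theta> = F (circle \<theta>)" for \<theta>
  define g1 where "g1 \<theta> = - sin \<theta> * pd i F (circle \<theta>) + cos \<theta> * pd j F (circle \<theta>)" for \<theta>
  have d: "(g has_real_derivative g1 \<theta>) (at \<theta>)" for \<theta>
    unfolding g_def g1_def by (rule circle_derivative[OF F(1)])
  have "(g1 has_real_derivative 0) (at \<theta>)" for \<theta>
    unfolding g1_def using harm_circle_ode[OF H, of \<theta>] by simp
  then have c: "g1 \<theta> = g1 0" for \<theta>
    using DERIV_isconst_all by blast
  have "\<exists>z>0. z < 2 * pi \<and> g (2 * pi) - g 0 = (2 * pi - 0) * g1 z"
    by (rule MVT2) (use d in auto)
  then obtain z where "g (2 * pi) - g 0 = 2 * pi * g1 z" by auto
  moreover have "g (2 * pi) = g 0" unfolding g_def circle_def by simp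
  ultimately have "g1 z = 0" by simp
  then have z: "g1 \<theta> = 0" for \<theta> using c[of \<theta>] c[of z] by simp
  have 0: "pd k F y = 0" if "norm y = 1" for y :: "real ^ 'm" and k
  proof -
    note ny = that
    obtain \<theta> where y: "y = circle \<theta>" using circle_exhaust[OF ny] by blast
    let ?s = "sin \<theta>" and ?c = "cos \<theta>"
    have e: "?c * pd i F y + ?s * pd j F y = 0"
      using euler_homog[OF F(1,2) circle_nonzero, of \<theta>] unfolding sum_pair circle_nth y by simp
    have t: "- ?s * pd i F y + ?c * pd j F y = 0"
      using z[of \<theta>] unfolding g1_def y .
    have sc: "?s * ?s + ?c * ?c = 1"
      using sin_cos_squared_add[of \<theta>] by (simp add: power2_eq_square)
    have alg: "(s * s + c * c) * p = c * (c * p + s * q) - s * (- s * p + c * q)"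
      "(s * s + c * c) * q = s * (c * p + s * q) + c * (- s * p + c * q)" for s c p q :: real
      by (simp_all add: algebra_simps)
    have "pd i F y = 0" using alg(1)[of ?s ?c "pd i F y" "pd j F y"] unfolding e t sc by simp
    moreover have "pd j F y = 0" using alg(2)[of ?s ?c "pd j F y" "pd i F y"] unfolding e t sc by simp
    ultimately show ?thesis using ij(2) by (metis UNIV_I insertE singletonD)
  qed
  show ?thesis by (rule homog_eq_0[OF homog_pd[OF F(1,2)] 0 x])
qed

lemma harm_nonint_circle:
  fixes F :: "real ^ 'm \<Rightarrow> real"
  assumes H: "harm \<alpha> F" and \<alpha>: "\<alpha> > 0" "\<alpha> \<notin> \<nat>" and x: "x \<noteq> 0"
  shows "F x = 0"
proof -
  note F = harmD[OF H]
  define g where "g \<theta> = F (circle \<theta>)" for \<theta>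
  define g1 where "g1 \<theta> = - sin \<theta> * pd i F (circle \<theta>) + cos \<theta> * pd j F (circle \<theta>)" for \<theta>
  have d: "(g has_real_derivative g1 \<theta>) (at \<theta>)" for \<theta>
    unfolding g_def g1_def by (rule circle_derivative[OF F(1)])
  have d1: "(g1 has_real_derivative - (\<alpha> * \<alpha>) * g \<theta>) (at \<theta>)" for \<theta>
    unfolding g1_def g_def by (rule harm_circle_ode[OF H])
  \<comment> \<open>First integrals of the oscillator equation: \<open>(h1, h2)\<close> is the
    vector \<open>(g, g1 / \<alpha>)\<close> rotated back by the angle
    \<open>\<alpha> * \<theta>\<close>.\<close>
  define h1 where "h1 \<theta> = g \<theta> * cos (\<alpha> * \<theta>) - g1 \<theta> * sin (\<alpha> * \<theta>) / \<alpha>" for \<theta>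
  define h2 where "h2 \<theta> = g \<theta> * sin (\<alpha> * \<theta>) + g1 \<theta> * cos (\<alpha> * \<theta>) / \<alpha>" for \<theta>
  have "(h1 has_real_derivative 0) (at \<theta>)" for \<theta>
    unfolding h1_def using \<alpha> by (auto intro!: derivative_eq_intros d d1 simp: field_simps)
  then have c1: "h1 \<theta> = h1 0" for \<theta> using DERIV_isconst_all by blast
  have "(h2 has_real_derivative 0) (at \<theta>)" for \<theta>
    unfolding h2_def using \<alpha> by (auto intro!: derivative_eq_intros d d1 simp: field_simps)
  then have c2: "h2 \<theta> = h2 0" for \<theta> using DERIV_isconst_all by blast
  define P where "P = g 0"
  define Q where "Q = g1 0 / \<alpha>"
  have per: "g (2 * pi) = P" "g1 (2 * pi) = \<alpha> * Q"
    using \<alpha>(1) unfolding g_def g1_def circle_def P_def Q_def by simp_all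
  have z: "h1 0 = P" "h2 0 = Q" unfolding h1_def h2_def P_def Q_def by simp_all
  define C where "C = cos (\<alpha> * (2 * pi))"
  define S where "S = sin (\<alpha> * (2 * pi))"
  have CS: "C * C + S * S = 1"
    using sin_cos_squared_add2[of "\<alpha> * (2 * pi)"] unfolding C_def S_def by (simp add: power2_eq_square)
  have eq1: "P * C - Q * S = P"
    using c1[of "2 * pi"] per z \<alpha>(1) unfolding h1_def[of "2 * pi"] C_def S_def by simp
  have eq2: "P * S + Q * C = Q"
    using c2[of "2 * pi"] per z \<alpha>(1) unfolding h2_def[of "2 * pi"] C_def S_def by simp
  \<comment> \<open>By periodicity \<open>(P, Q)\<close> is fixed by the rotation through
    \<open>2 * pi * \<alpha>\<close>. The determinant of that rotation minus the identity is
    \<open>2 - 2 * C\<close>, nonzero unless \<open>\<alpha>\<close> is an integer.\<close>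
  have "C \<noteq> 1"
  proof
    assume "C = 1"
    then obtain n :: int where "\<alpha> * (2 * pi) = of_int n * 2 * pi"
      unfolding C_def using cos_one_2pi_int by blast
    then have "\<alpha> = of_int n" by simp
    then have "\<alpha> = of_nat (nat n)" using \<alpha>(1) by simp
    then show False using \<alpha>(2) by auto
  qed
  then have "2 - 2 * C \<noteq> 0" by simp
  moreover have "(2 - 2 * C) * P = 0"
  proof -
    have "(2 - 2 * C) * P = (C * C + S * S + 1 - 2 * C) * P" unfolding CS by simp
    also have "\<dots> = (C - 1) * (P * C - Q * S - P) + S * (P * S + Q * C - Q)"
      by (simp add: algebra_simps)
    finally show ?thesis unfolding eq1 eq2 by simp
  qed
  moreover have "(2 - 2 * C) * Q = 0"
  proof -
    have "(2 - 2 * C) * Q = (C * C + S * S + 1 - 2 * C) * Q" unfolding CS by simp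
    also have "\<dots> = (C - 1) * (P * S + Q * C - Q) - S * (P * C - Q * S - P)"
      by (simp add: algebra_simps)
    finally show ?thesis unfolding eq1 eq2 by simp
  qed
  ultimately have PQ: "P = 0" "Q = 0" by auto
  have "g \<theta> = 0" for \<theta>
  proof -
    have h: "h1 \<theta> = 0" "h2 \<theta> = 0" using c1[of \<theta>] c2[of \<theta>] z PQ by auto
    have "g \<theta> * (cos (\<alpha> * \<theta>) * cos (\<alpha> * \<theta>) + sin (\<alpha> * \<theta>) * sin (\<alpha> * \<theta>)) = h1 \<theta> * cos (\<alpha> * \<theta>) + h2 \<theta> * sin (\<alpha> * \<theta>)"
    proof -
      have "a * (c * c + s * s) = (a * c - b * s / \<alpha>) * c + (a * s + b * c / \<alpha>) * s" for a b c s :: real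
        by (simp add: algebra_simps)
      then show ?thesis unfolding h1_def h2_def .
    qed
    then show ?thesis
      using h sin_cos_squared_add2[of "\<alpha> * \<theta>"] by (simp add: power2_eq_square)
  qed
  then have 0: "F y = 0" if "norm y = 1" for y :: "real ^ 'm"
    using circle_exhaust[OF that] unfolding g_def by metis
  show ?thesis by (rule homog_eq_0[OF F(2) 0 x])
qed

end

lemma harm_0_pd:
  fixes F :: "real ^ 'm::finite \<Rightarrow> real"
  assumes "harm 0 F" "CARD('m) \<ge> 2" "x \<noteq> 0"
  shows "pd k F x = 0"
proof (cases "CARD('m) \<ge> 3")
  case True
  then show ?thesis using harm_0_pd_bochner assms by blast
next
  case False
  then have "CARD('m) = 2" using assms by simp
  then obtain i j :: 'm where "i \<noteq> j" "UNIV = {i, j}"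
    by (auto simp: card_2_iff)
  then show ?thesis using harm_0_pd_circle assms by blast
qed

text \<open>Differentiation lowers the degree into \<open>(- 1, 0)\<close>, where for
  \<open>N = CARD('m) \<ge> 3\<close> the product \<open>\<beta> * (\<beta> + N - 2)\<close> is
  negative and the maximum principle applies; Euler's identity carries the vanishing back up. In the
  plane that product is a square, so the circle argument takes over.\<close>

lemma harm_nonint:
  fixes F :: "real ^ 'm::finite \<Rightarrow> real"
  assumes "harm \<alpha> F" "CARD('m) \<ge> 2" "\<alpha> > 0" "\<alpha> \<notin> \<nat>" "x \<noteq> 0"
  shows "F x = 0"
proof (cases "CARD('m) \<ge> 3")
  case False
  then have "CARD('m) = 2" using assms by simp
  then obtain i j :: 'm where "i \<noteq> j" "UNIV = {i, j}"
    by (auto simp: card_2_iff)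
  then show ?thesis using harm_nonint_circle assms by blast
next
  case N: True
  have "\<forall>\<alpha> (F :: real ^ 'm \<Rightarrow> real) x. harm \<alpha> F \<longrightarrow> \<alpha> > 0 \<longrightarrow> \<alpha> \<notin> \<nat> \<longrightarrow> \<alpha> < real k + 1 \<longrightarrow> x \<noteq> 0 \<longrightarrow> F x = 0" for k
  proof (induction k)
    case 0
    show ?case
    proof (intro allI impI)
      fix \<alpha> and F :: "real ^ 'm \<Rightarrow> real" and x :: "real ^ 'm"
      assume *: "harm \<alpha> F" "\<alpha> > 0" "\<alpha> \<notin> \<nat>" "\<alpha> < real 0 + 1" "x \<noteq> 0"
      have neg: "(\<alpha> - 1) * (\<alpha> - 1 + real CARD('m) - 2) < 0"
        using * N by (intro mult_neg_pos) auto
      have "pd i F x = 0" for i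
        by (rule harm_eq_0_of_neg[OF harm_pd[OF *(1)] neg *(5)])
      then show "F x = 0"
        using euler_homog[OF harmD(1,2)[OF *(1)] *(5)] *(2) by simp
    qed
  next
    case (Suc k)
    show ?case
    proof (intro allI impI)
      fix \<alpha> and F :: "real ^ 'm \<Rightarrow> real" and x :: "real ^ 'm"
      assume *: "harm \<alpha> F" "\<alpha> > 0" "\<alpha> \<notin> \<nat>" "\<alpha> < real (Suc k) + 1" "x \<noteq> 0"
      show "F x = 0"
      proof (cases "\<alpha> < real k + 1")
        case True
        then show ?thesis using Suc.IH * by blast
      next
        case False
        have "\<alpha> - 1 \<notin> \<nat>"
          using *(3) Nats_add[of "\<alpha> - 1" 1] by auto
        moreover have "\<alpha> \<noteq> 1" using *(3) by auto
        then have "\<alpha> - 1 > 0" using False by (cases k) auto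
        moreover have "\<alpha> - 1 < real k + 1" using *(4) by simp
        ultimately have "pd i F x = 0" for i
          using Suc.IH harm_pd[OF *(1), of i] *(5) by blast
        then show ?thesis
          using euler_homog[OF harmD(1,2)[OF *(1)] *(5)] *(2) by simp
      qed
    qed
  qed
  moreover obtain k where "\<alpha> < real k" using reals_Archimedean2 by blast
  then have "\<alpha> < real k + 1" by simp
  ultimately show ?thesis using assms by blast
qed

subsection \<open>Harmonic polynomials and multiplicities\<close>

text \<open>
  The homogeneous polynomial of degree \<open>k\<close> whose partial derivative of order \<open>k\<close> with respect to the
  indices in the multiset \<open>M\<close> is \<open>c M\<close>.
\<close>

primrec hp :: "nat \<Rightarrow> ('m::finite multiset \<Rightarrow> real) \<Rightarrow> real ^ 'm \<Rightarrow> real" where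
  "hp 0 c x = c {#}"
| "hp (Suc k) c x = (1 / real (Suc k)) * (\<Sum>i\<in>UNIV. x $ i * hp k (\<lambda>M. c (add_mset i M)) x)"

lemma smooth0_hp: "smooth0 (hp k c)"
proof (induction k arbitrary: c)
  case 0
  show ?case by (simp add: smooth_on_const)
next
  case (Suc k)
  have "smooth0 (\<lambda>x. (1 / real (Suc k)) * (\<Sum>i\<in>UNIV. x $ i * hp k (\<lambda>M. c (add_mset i M)) x))"
    by (intro smooth_on_mult smooth_on_const smooth_on_sum smooth_on_coord open_punctured Suc)
  then show ?case by simp
qed

lemma homog_hp: "homog (real k) (hp k c)"
proof (induction k arbitrary: c)
  case 0
  show ?case by (simp add: homog_def)
next
  case (Suc k)
  show ?case
    unfolding homog_def
  proof (intro allI impI)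
    fix x :: "real ^ 'a" and t :: real assume x: "x \<noteq> 0" and t: "t > 0"
    have "t powr real (Suc k) = t * t powr real k"
      using t by (simp add: powr_add)
    then show "hp (Suc k) c (t *\<^sub>R x) = t powr real (Suc k) * hp (Suc k) c x"
      by (simp add: homogD[OF Suc x t] sum_distrib_left mult_ac)
  qed
qed

text \<open>Multisets make the coefficients symmetric, so the index of differentiation can be moved
  outermost. The induction hypothesis then yields \<open>Suc k\<close> copies of the claimed
  derivative and the coordinate factor one more, which cancels the normalization.\<close>

lemma pd_hp:
  assumes x: "x \<noteq> 0"
  shows "pd j (hp (Suc k) c) x = hp k (\<lambda>M. c (add_mset j M)) x"
proof (induction k arbitrary: c)
  case 0
  have "hp (Suc 0) c = (\<lambda>x. \<Sum>i\<in>UNIV. c {#i#} * x $ i)"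
    by (simp add: fun_eq_iff mult.commute)
  then have "pd j (hp (Suc 0) c) x = pd j (\<lambda>x. \<Sum>i\<in>UNIV. c {#i#} * x $ i) x"
    by simp
  also have "\<dots> = (\<Sum>i\<in>UNIV. pd j (\<lambda>x. c {#i#} * x $ i) x)"
    by (intro pd_sum differentiable_mult differentiable_const differentiable_coord)
  also have "\<dots> = c {#j#}"
    by (simp add: pd_cmult[OF differentiable_coord] pd_coord if_distrib cong: if_cong)
  finally show ?case by (simp only: hp.simps(1))
next
  case (Suc k)
  note d = smooth0_diff[OF smooth0_hp x]
  let ?c = "\<lambda>i M. c (add_mset i M)"
  have "pd j (hp (Suc (Suc k)) c) x =
     pd j (\<lambda>x. (1 / real (Suc (Suc k))) * (\<Sum>i\<in>UNIV. x $ i * hp (Suc k) (?c i) x)) x"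
    by (simp only: hp.simps(2)[of "Suc k" c, abs_def])
  also have "\<dots> = (1 / real (Suc (Suc k))) * pd j (\<lambda>x. \<Sum>i\<in>UNIV. x $ i * hp (Suc k) (?c i) x) x"
    by (intro pd_cmult differentiable_sum ballI differentiable_mult differentiable_coord d finite)
  also have "pd j (\<lambda>x. \<Sum>i\<in>UNIV. x $ i * hp (Suc k) (?c i) x) x = (\<Sum>i\<in>UNIV. pd j (\<lambda>x. x $ i * hp (Suc k) (?c i) x) x)"
    by (intro pd_sum differentiable_mult differentiable_coord d)
  also have "\<dots> = (\<Sum>i\<in>UNIV. x $ i * hp k (\<lambda>M. ?c i (add_mset j M)) x + (if j = i then 1 else 0) * hp (Suc k) (?c i) x)"
    by (intro sum.cong refl) (simp only: pd_mult[OF differentiable_coord d] Suc.IH pd_coord)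
  also have "\<dots> = (\<Sum>i\<in>UNIV. x $ i * hp k (\<lambda>M. ?c j (add_mset i M)) x) + hp (Suc k) (?c j) x"
    by (simp add: sum.distrib add_mset_commute if_distrib[of "\<lambda>y. y * _"] cong: if_cong del: hp.simps)
  also have "(\<Sum>i\<in>UNIV. x $ i * hp k (\<lambda>M. ?c j (add_mset i M)) x) = real (Suc k) * hp (Suc k) (?c j) x"
    by (simp del: of_nat_Suc)
  also have "(1 / real (Suc (Suc k))) * (real (Suc k) * hp (Suc k) (?c j) x + hp (Suc k) (?c j) x) = hp (Suc k) (?c j) x"
  proof -
    have "real (Suc k) * y + y = real (Suc (Suc k)) * y" for y by (simp add: algebra_simps)
    then show ?thesis by (simp only: mult.assoc[symmetric]) simp
  qed
  finally show ?case .
qed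

lemma hp_cong:
  "(\<And>M. size M = k \<Longrightarrow> c M = c' M) \<Longrightarrow> hp k c x = hp k c' x"
proof (induction k arbitrary: c c')
  case (Suc k)
  have "hp k (\<lambda>M. c (add_mset i M)) x = hp k (\<lambda>M. c' (add_mset i M)) x" for i
    by (rule Suc.IH) (simp add: Suc.prems)
  then show ?case by simp
qed simp

lemma hp_sum: "hp k (\<lambda>M. \<Sum>a\<in>A. b a * e a M) x = (\<Sum>a\<in>A. b a * hp k (e a) x)"
proof (induction k arbitrary: e)
  case (Suc k)
  have "hp (Suc k) (\<lambda>M. \<Sum>a\<in>A. b a * e a M) x =
     (1 / real (Suc k)) * (\<Sum>i\<in>UNIV. \<Sum>a\<in>A. x $ i * (b a * hp k (\<lambda>M. e a (add_mset i M)) x))"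
    by (simp add: Suc sum_distrib_left)
  also have "\<dots> = (\<Sum>a\<in>A. b a * hp (Suc k) (e a) x)"
    by (subst sum.swap) (simp add: sum_distrib_left mult_ac)
  finally show ?case .
qed simp

lemma hp_diff: "hp k (\<lambda>M. c M - c' M) x = hp k c x - hp k c' x"
  by (induction k arbitrary: c c') (simp_all add: right_diff_distrib sum_subtractf diff_divide_distrib)

lemma exists_nonzero_vec: "\<exists>x :: real ^ 'm::finite. norm x = 1 \<and> x \<noteq> 0"
  by (rule exI[of _ "axis undefined 1"]) simp

text \<open>Differentiating successively along the indices in \<open>M\<close> recovers
  \<open>c M\<close>.\<close>

lemma hp_eq_0D:
  assumes "\<And>x. x \<noteq> 0 \<Longrightarrow> hp k c x = 0" "size M = k"
  shows "c M = 0"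
  using assms
proof (induction k arbitrary: c M)
  case 0
  then show ?case using exists_nonzero_vec by auto
next
  case (Suc k)
  obtain i L where M: "M = add_mset i L" using Suc.prems(2) by (metis size_eq_Suc_imp_eq_union)
  have "hp k (\<lambda>M. c (add_mset i M)) x = 0" if x: "x \<noteq> 0" for x
  proof -
    have "pd i (hp (Suc k) c) x = pd i (\<lambda>_. 0) x"
      using x Suc.prems(1) by (intro pd_cong) auto
    then show ?thesis by (simp add: pd_hp[OF x] pd_const del: hp.simps)
  qed
  then show ?case using Suc.IH[of "\<lambda>M. c (add_mset i M)" L] Suc.prems(2) M by simp
qed

text \<open>Harmonicity of \<open>hp k c\<close> in terms of its coefficients, by
  \<open>lap_hp\<close>; the condition is void for \<open>k < 2\<close>.\<close>

definition tracefree :: "nat \<Rightarrow> ('m::finite multiset \<Rightarrow> real) \<Rightarrow> bool" where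
  "tracefree k c \<longleftrightarrow> (\<forall>M. size M + 2 = k \<longrightarrow> (\<Sum>i\<in>UNIV. c (add_mset i (add_mset i M))) = 0)"

lemma lap_hp:
  assumes x: "x \<noteq> 0"
  shows "lap (hp (Suc (Suc k)) c) x = hp k (\<lambda>M. \<Sum>i\<in>UNIV. c (add_mset i (add_mset i M))) x"
proof -
  have "pd i (pd i (hp (Suc (Suc k)) c)) x = hp k (\<lambda>M. c (add_mset i (add_mset i M))) x" for i
  proof -
    have "pd i (pd i (hp (Suc (Suc k)) c)) x = pd i (hp (Suc k) (\<lambda>M. c (add_mset i M))) x"
      by (rule pd_cong[OF pd_hp x])
    then show ?thesis by (simp only: pd_hp[OF x])
  qed
  then show ?thesis
    unfolding lap_def using hp_sum[of k "\<lambda>_. 1" "\<lambda>i M. c (add_mset i (add_mset i M))" UNIV x] by simp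
qed

lemma lap_hp_low:
  assumes x: "x \<noteq> 0" and k: "k < 2"
  shows "lap (hp k c) x = 0"
proof -
  have hp0: "hp 0 c = (\<lambda>_. c {#})" for c :: "'a multiset \<Rightarrow> real"
    by (simp add: fun_eq_iff)
  have "pd i (pd i (hp k c)) x = 0" for i
  proof -
    consider "k = 0" | "k = Suc 0" using k by linarith
    then obtain a where "pd i (pd i (hp k c)) x = pd i (\<lambda>_. a) x"
    proof cases
      case 1
      then have "pd i (pd i (hp k c)) x = pd i (\<lambda>_. 0) x"
        by (intro pd_cong x) (simp add: hp0 pd_const)
      then show ?thesis using that by blast
    next
      case 2
      then have "pd i (pd i (hp k c)) x = pd i (\<lambda>_. c {#i#}) x"
        by (intro pd_cong x) (simp add: pd_hp del: hp.simps(2))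
      then show ?thesis using that by blast
    qed
    then show ?thesis by (simp add: pd_const)
  qed
  then show ?thesis unfolding lap_def by simp
qed

lemma harm_hp:
  assumes "tracefree k c"
  shows "harm (real k) (hp k c)"
proof -
  have "lap (hp k c) x = 0" if x: "x \<noteq> 0" for x
  proof (cases "k < 2")
    case True
    then show ?thesis using lap_hp_low[OF x] by blast
  next
    case False
    then obtain l where l: "k = Suc (Suc l)" by (metis One_nat_def Suc_1 less_Suc_eq not_less_eq old.nat.exhaust zero_less_Suc)
    \<comment> \<open>The zero coefficient system is written as an empty sum so that
      \<open>hp_sum\<close> evaluates it.\<close>
    have "hp l (\<lambda>M. \<Sum>i\<in>UNIV. c (add_mset i (add_mset i M))) x = hp l (\<lambda>M. \<Sum>i\<in>({} :: nat set). 0 * 0) x"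
      using assms unfolding tracefree_def l by (intro hp_cong) auto
    also have "\<dots> = 0" by (subst hp_sum) simp
    finally show ?thesis unfolding l lap_hp[OF x] .
  qed
  then show ?thesis
    unfolding harm_def using smooth0_hp homog_hp by blast
qed

lemma tracefree_of_harm:
  assumes "\<And>x. x \<noteq> 0 \<Longrightarrow> lap (hp k c) x = 0"
  shows "tracefree k c"
  unfolding tracefree_def
proof (intro allI impI)
  fix M :: "'a multiset" assume M: "size M + 2 = k"
  then have k: "k = Suc (Suc (size M))" by simp
  have "hp (size M) (\<lambda>M. \<Sum>i\<in>UNIV. c (add_mset i (add_mset i M))) x = 0" if "x \<noteq> 0" for x
    using assms[OF that] unfolding k lap_hp[OF that] .
  then show "(\<Sum>i\<in>UNIV. c (add_mset i (add_mset i M))) = 0"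
    by (rule hp_eq_0D[of "size M"]) auto
qed

lemma connected_punctured_vec:
  assumes "CARD('m::finite) \<ge> 2"
  shows "connected (- {0 :: real ^ 'm})"
  using assms by (intro connected_punctured_universe) simp

text \<open>Euler's identity recovers \<open>F\<close> from its partial derivatives, which are
  polynomials by induction; commuting derivatives let their coefficient systems \<open>C i\<close>
  merge into one. In degree \<open>0\<close> the gradient vanishes and the punctured space is
  connected.\<close>

lemma harm_imp_hp:
  fixes F :: "real ^ 'm::finite \<Rightarrow> real"
  assumes N: "CARD('m) \<ge> 2" and F: "harm (real k) F"
  shows "\<exists>c. \<forall>x. x \<noteq> 0 \<longrightarrow> F x = hp k c x"
  using F
proof (induction k arbitrary: F)
  case 0
  have F: "harm 0 F" using 0 by simp
  obtain e :: "real ^ 'm" where e: "e \<noteq> 0" using exists_nonzero_vec by blast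
  have "F x = F e" if x: "x \<noteq> 0" for x
  proof (rule has_derivative_zero_unique_connected[OF open_punctured connected_punctured_vec[OF N]])
    fix y :: "real ^ 'm" assume "y \<in> - {0}"
    then have y: "y \<noteq> 0" by simp
    note d = smooth0_diff[OF harmD(1)[OF F] y]
    have "frechet_derivative F (at y) = (\<lambda>x. 0)"
      by (rule ext) (simp add: frechet_derivative_expand[OF d] harm_0_pd[OF F N y])
    then show "(F has_derivative (\<lambda>x. 0)) (at y)"
      using d unfolding frechet_derivative_works by simp
  qed (use x e in auto)
  then show ?case by (intro exI[of _ "\<lambda>_. F e"]) simp
next
  case (Suc k)
  note F = harmD[OF Suc.prems]
  have "\<forall>i. \<exists>c. \<forall>x. x \<noteq> 0 \<longrightarrow> pd i F x = hp k c x"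
  proof
    fix i
    have "harm (real k) (pd i F)" using harm_pd[OF Suc.prems, of i] by simp
    then show "\<exists>c. \<forall>x. x \<noteq> 0 \<longrightarrow> pd i F x = hp k c x" by (rule Suc.IH)
  qed
  then obtain C where "\<forall>i x. x \<noteq> 0 \<longrightarrow> pd i F x = hp k (C i) x"
    by (rule choice[THEN exE])
  then have C: "\<And>i x. x \<noteq> 0 \<Longrightarrow> pd i F x = hp k (C i) x" by blast
  have compat: "C i (add_mset j L) = C j (add_mset i L)" if L: "Suc (size L) = k" for i j L
  proof -
    have k: "k = Suc (size L)" using L by simp
    have "hp (size L) (\<lambda>M. C i (add_mset j M) - C j (add_mset i M)) x = 0" if x: "x \<noteq> 0" for x
    proof -
      have "pd j (pd i F) x = pd j (hp k (C i)) x" for i j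
        by (rule pd_cong[OF _ x]) (rule C)
      then have "hp (size L) (\<lambda>M. C i (add_mset j M)) x = hp (size L) (\<lambda>M. C j (add_mset i M)) x"
        using pd_commute[OF F(1) x, of i j] unfolding k by (simp only: pd_hp[OF x])
      then show ?thesis by (simp add: hp_diff)
    qed
    then have "C i (add_mset j L) - C j (add_mset i L) = 0"
      by (rule hp_eq_0D[of "size L"]) auto
    then show ?thesis by simp
  qed
  \<comment> \<open>An arbitrary index of \<open>M\<close> is split off; \<open>compat\<close> shows
    that the choice is immaterial.\<close>
  define c where "c M = (let i = SOME i. i \<in># M in C i (M - {#i#}))" for M
  have c: "c (add_mset i M) = C i M" if M: "size M = k" for i M
  proof -
    define j where "j = (SOME j. j \<in># add_mset i M)"
    have j: "j \<in># add_mset i M" unfolding j_def by (rule someI[of _ i]) simp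
    have cj: "c (add_mset i M) = C j (add_mset i M - {#j#})"
      unfolding c_def j_def Let_def ..
    show ?thesis
    proof (cases "j = i")
      case True
      then show ?thesis unfolding cj by simp
    next
      case False
      then obtain L where L: "M = add_mset j L" using j by (auto dest: multi_member_split)
      then have "add_mset i M - {#j#} = add_mset i L" using False by (simp add: add_mset_commute)
      with cj have "c (add_mset i M) = C j (add_mset i L)" by simp
      also have "\<dots> = C i (add_mset j L)"
        by (rule compat) (use M L in simp)
      finally show ?thesis unfolding L .
    qed
  qed
  have "F x = hp (Suc k) c x" if x: "x \<noteq> 0" for x
  proof -
    have "hp k (\<lambda>M. c (add_mset i M)) x = pd i F x" for i
      unfolding C[OF x] by (rule hp_cong[OF c])
    then show ?thesis
      using euler_homog[OF F(1,2) x] by simp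
  qed
  then show ?case by blast
qed

text \<open>
  A trace-free coefficient system is determined by its values on the multisets that contain the
  distinguished index at most once, and these values can be prescribed.
\<close>

function trace_ext :: "'m::finite \<Rightarrow> ('m multiset \<Rightarrow> real) \<Rightarrow> 'm multiset \<Rightarrow> real" where
  "trace_ext m b M = (if count M m \<le> 1 then b M
     else - (\<Sum>i\<in>UNIV - {m}. trace_ext m b (add_mset i (add_mset i (M - {#m, m#})))))"
  by auto
termination
  \<comment> \<open>Each call trades two copies of \<open>m\<close> for two copies of another
    index.\<close>
  by (relation "Wellfounded.measure (\<lambda>(m, b, M). count M m)") auto

declare trace_ext.simps [simp del]

definition basis_msets :: "'m::finite \<Rightarrow> nat \<Rightarrow> 'm multiset set" where
  "basis_msets m k = {M. size M = k \<and> count M m \<le> 1}"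

lemma finite_basis_msets: "finite (basis_msets m k)"
  by (rule finite_subset[OF _ finite_multisets_of_size[OF finite[of UNIV], of k]])
     (auto simp: basis_msets_def multisets_of_size_def)

text \<open>The family dual to the evaluations at the multisets in \<open>basis_msets\<close>; it
  spans the trace-free systems by \<open>tracefree_expand\<close>.\<close>

definition ext_basis :: "'m::finite \<Rightarrow> 'm multiset \<Rightarrow> 'm multiset \<Rightarrow> real" where
  "ext_basis m L = trace_ext m (\<lambda>M. if M = L then 1 else 0)"

lemma tracefree_ext: "tracefree k (trace_ext m b)"
  unfolding tracefree_def
proof (intro allI impI)
  fix M :: "'a multiset"
  have "trace_ext m b (add_mset m (add_mset m M)) = - (\<Sum>i\<in>UNIV - {m}. trace_ext m b (add_mset i (add_mset i M)))"
    by (subst trace_ext.simps) simp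
  then show "(\<Sum>i\<in>UNIV. trace_ext m b (add_mset i (add_mset i M))) = 0"
    by (subst sum.remove[of UNIV m]) auto
qed

lemma ext_basis_apply: "M \<in> basis_msets m k \<Longrightarrow> ext_basis m L M = (if M = L then 1 else 0)"
  unfolding ext_basis_def basis_msets_def by (subst trace_ext.simps) simp

lemma tracefree_sum:
  fixes e :: "'i \<Rightarrow> 'm::finite multiset \<Rightarrow> real"
  assumes "\<And>a. a \<in> A \<Longrightarrow> tracefree k (e a)"
  shows "tracefree k (\<lambda>M. \<Sum>a\<in>A. b a * e a M)"
  unfolding tracefree_def
proof (intro allI impI)
  fix M :: "'m multiset" assume "size M + 2 = k"
  then have "(\<Sum>i\<in>UNIV. e a (add_mset i (add_mset i M))) = 0" if "a \<in> A" for a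
    using assms[OF that] unfolding tracefree_def by blast
  then show "(\<Sum>i\<in>UNIV. \<Sum>a\<in>A. b a * e a (add_mset i (add_mset i M))) = 0"
    by (subst sum.swap) (simp flip: sum_distrib_left)
qed

lemma tracefree_diff:
  "tracefree k c \<Longrightarrow> tracefree k c' \<Longrightarrow> tracefree k (\<lambda>M. c M - c' M)"
  unfolding tracefree_def by (simp add: sum_subtractf)

text \<open>The trace condition expresses a value at a multiset with at least two copies of
  \<open>m\<close> through values at multisets with two copies fewer.\<close>

lemma tracefree_eq_0:
  assumes c: "tracefree k c" and 0: "\<And>M. M \<in> basis_msets m k \<Longrightarrow> c M = 0" and M: "size M = k"
  shows "c M = 0"
  using M
proof (induction "count M m" arbitrary: M rule: less_induct)
  case less
  show ?case
  proof (cases "count M m \<le> 1")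
    case True
    then show ?thesis using 0 less.prems by (simp add: basis_msets_def)
  next
    case False
    then have "{#m, m#} \<subseteq># M"
      by (simp add: subseteq_mset_def)
    then obtain L where L: "M = add_mset m (add_mset m L)"
      by (metis add_mset_add_single mset_subset_eq_exists_conv union_commute union_mset_add_mset_left)
    have s: "size L + 2 = k" using L less.prems by simp
    have "c (add_mset i (add_mset i L)) = 0" if "i \<noteq> m" for i
      by (rule less.hyps) (use that L s in auto)
    moreover have "(\<Sum>i\<in>UNIV. c (add_mset i (add_mset i L))) = 0"
      using c s unfolding tracefree_def by blast
    ultimately show ?thesis
      unfolding L by (subst (asm) sum.remove[of UNIV m]) auto
  qed
qed

lemma tracefree_expand:
  assumes c: "tracefree k c" and M: "size M = k"
  shows "c M = (\<Sum>L\<in>basis_msets m k. c L * ext_basis m L M)"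
proof -
  have "tracefree k (\<lambda>M. c M - (\<Sum>L\<in>basis_msets m k. c L * ext_basis m L M))"
    by (intro tracefree_diff c tracefree_sum) (simp add: ext_basis_def tracefree_ext)
  then have "c M - (\<Sum>L\<in>basis_msets m k. c L * ext_basis m L M) = 0"
    by (rule tracefree_eq_0[where m = m, OF _ _ M])
       (simp add: ext_basis_apply finite_basis_msets if_distrib cong: if_cong)
  then show ?thesis by simp
qed

section \<open>Dimensions of the eigenspaces\<close>

lemma card_basis_msets_0: "card (basis_msets m 0) = 1"
proof -
  have "basis_msets m 0 = {{#}}" by (auto simp: basis_msets_def)
  then show ?thesis by simp
qed

text \<open>Removing \<open>m\<close> if it occurs leaves multisets of size \<open>j + 1\<close> or
  \<open>j\<close> over the other \<open>n\<close> indices. By Pascal's rule the total is the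
  classical difference of \<open>(n + k) choose n\<close> and \<open>(n + k - 2) choose n\<close>
  for \<open>k = j + 1\<close>.\<close>

lemma card_basis_msets_Suc:
  assumes "CARD('m::finite) = n + 1" "n \<ge> 1"
  shows "card (basis_msets (m :: 'm) (Suc j)) = ((j + n) choose (n - 1)) + ((j + n - 1) choose (n - 1))"
proof -
  let ?A = "UNIV - {m}"
  have A: "card ?A = n" using assms by simp
  have fin: "finite (multisets_of_size ?A l)" for l
    by (rule finite_multisets_of_size) simp
  have eq: "basis_msets m (Suc j) = multisets_of_size ?A (Suc j) \<union> add_mset m ` multisets_of_size ?A j"
  proof (intro equalityI subsetI)
    fix M assume "M \<in> basis_msets m (Suc j)"
    then have M: "size M = Suc j" "count M m \<le> 1" by (auto simp: basis_msets_def)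
    show "M \<in> multisets_of_size ?A (Suc j) \<union> add_mset m ` multisets_of_size ?A j"
    proof (cases "m \<in># M")
      case True
      then obtain L where L: "M = add_mset m L" by (metis multi_member_split)
      then have "m \<notin># L" using M by (simp add: not_in_iff)
      then have "L \<in> multisets_of_size ?A j" using L M by (auto simp: multisets_of_size_def)
      then show ?thesis using L by blast
    next
      case False
      then show ?thesis using M by (auto simp: multisets_of_size_def)
    qed
  next
    fix M assume "M \<in> multisets_of_size ?A (Suc j) \<union> add_mset m ` multisets_of_size ?A j"
    then show "M \<in> basis_msets m (Suc j)"
      by (auto simp: basis_msets_def multisets_of_size_def subset_iff not_in_iff[symmetric])
         (metis DiffE count_eq_zero_iff le_SucI le_zero_eq singletonI)+
  qed
  have "card (basis_msets m (Suc j)) = card (multisets_of_size ?A (Suc j)) + card (add_mset m ` multisets_of_size ?A j)"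
    unfolding eq
    by (rule card_Un_disjoint[OF fin finite_imageI[OF fin]]) (auto simp: multisets_of_size_def)
  also have "card (add_mset m ` multisets_of_size ?A j) = card (multisets_of_size ?A j)"
    by (rule card_image) (auto simp: inj_on_def)
  finally have "card (basis_msets m (Suc j)) = ((n + Suc j - 1) choose Suc j) + ((n + j - 1) choose j)"
    unfolding card_multisets_of_size[OF finite[of ?A]] A .
  moreover have "(n + Suc j - 1) choose Suc j = (j + n) choose (n - 1)"
    using assms(2) binomial_symmetric[of "Suc j" "n + j"] by (simp add: add.commute)
  moreover have "(n + j - 1) choose j = (j + n - 1) choose (n - 1)"
    using assms(2) binomial_symmetric[of j "n + j - 1"] by (simp add: add.commute)
  ultimately show ?thesis by simp
qed

lemma sum_fun_apply: "(\<Sum>a\<in>A. f a) x = (\<Sum>a\<in>A. f a x)"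
  by (induction A rule: infinite_finite_induct) auto

text \<open>Independence is assumed for coefficient families over \<open>T\<close>. This also forces
  \<open>\<phi>\<close> to be injective, without which its image could have fewer elements than
  \<open>T\<close>.\<close>

lemma dim_eq_card_of_parametrization:
  fixes \<phi> :: "'i \<Rightarrow> 'a \<Rightarrow> real"
  assumes T: "finite T" and E: "E = {u. \<exists>b. u = (\<lambda>x. \<Sum>M\<in>T. b M * \<phi> M x)}"
    and indep: "\<And>b. (\<And>x. (\<Sum>M\<in>T. b M * \<phi> M x) = 0) \<Longrightarrow> \<forall>M\<in>T. b M = 0"
  shows "vector_space.dim (\<lambda>(c::real) u x. c * u x) E = card T"
proof -
  interpret V: vector_space "\<lambda>(c::real) (u::'a \<Rightarrow> real) x. c * u x"
    by (rule vector_space_fun)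
  have inj: "inj_on \<phi> T"
  proof (rule inj_onI, rule ccontr)
    fix L M assume LM: "L \<in> T" "M \<in> T" "\<phi> L = \<phi> M" "L \<noteq> M"
    define b where "b K = (if K = L then 1 else 0) - (if K = M then 1 else (0::real))" for K
    have "(\<Sum>K\<in>T. b K * \<phi> K x) = 0" for x
      using LM T by (simp add: b_def left_diff_distrib sum_subtractf if_distrib[of "\<lambda>y. y * _"] cong: if_cong)
    from indep[of b, OF this] show False using LM by (auto simp: b_def)
  qed
  show ?thesis
  proof (rule V.dim_unique)
    show "\<phi> ` T \<subseteq> E"
    proof
      fix u assume "u \<in> \<phi> ` T"
      then obtain L where L: "L \<in> T" "u = \<phi> L" by blast
      then have "u = (\<lambda>x. \<Sum>M\<in>T. (if M = L then 1 else 0) * \<phi> M x)"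
        using T by (simp add: fun_eq_iff if_distrib[of "\<lambda>y. y * _"] cong: if_cong)
      then show "u \<in> E" unfolding E mem_Collect_eq by (rule exI[of _ "\<lambda>M. if M = L then 1 else 0"])
    qed
    show "E \<subseteq> V.span (\<phi> ` T)"
    proof
      fix u assume "u \<in> E"
      then obtain b where b: "u = (\<lambda>x. \<Sum>M\<in>T. b M * \<phi> M x)" unfolding E by blast
      have "u = (\<Sum>M\<in>T. (\<lambda>x. b M * \<phi> M x))"
        unfolding b by (simp add: fun_eq_iff sum_fun_apply)
      also have "\<dots> \<in> V.span (\<phi> ` T)"
        by (intro V.span_sum V.span_scale V.span_base) auto
      finally show "u \<in> V.span (\<phi> ` T)" .
    qed
    show "V.independent (\<phi> ` T)"
      unfolding V.dependent_finite[OF finite_imageI[OF T]]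
    proof
      assume "\<exists>u. (\<exists>v\<in>\<phi> ` T. u v \<noteq> 0) \<and> (\<Sum>v\<in>\<phi> ` T. (\<lambda>x. u v * v x)) = 0"
      then obtain u where u: "\<exists>v\<in>\<phi> ` T. u v \<noteq> 0" "(\<Sum>v\<in>\<phi> ` T. (\<lambda>x. u v * v x)) = 0" by blast
      have "(\<Sum>M\<in>T. u (\<phi> M) * \<phi> M x) = 0" for x
        using fun_cong[OF u(2), of x] by (simp add: sum_fun_apply sum.reindex[OF inj])
      from indep[of "\<lambda>M. u (\<phi> M)", OF this] show False using u(1) by auto
    qed
    show "card (\<phi> ` T) = card T" by (rule card_image[OF inj])
  qed
qed

text \<open>The harmonic polynomials with coefficient systems \<open>ext_basis m M\<close>,
  restricted to the sphere, form a basis of the eigenspace. Restriction loses nothing, because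
  homogeneous functions are determined by their values on the sphere.\<close>

lemma multiplicity_sphere_laplacian:
  fixes m :: "'m::finite"
  assumes N: "CARD('m) \<ge> 2" and \<nu>: "\<nu> = real k * (real k + real CARD('m) - 2)"
  shows "multiplicity_of smooth_sphere (sphere_laplacian :: (real ^ 'm \<Rightarrow> real) \<Rightarrow> _) \<nu> = card (basis_msets m k)"
    and "\<exists>u \<in> eigenspace smooth_sphere (sphere_laplacian :: (real ^ 'm \<Rightarrow> real) \<Rightarrow> _) \<nu>. u \<noteq> (\<lambda>x. 0)"
proof -
  let ?E = "eigenspace smooth_sphere (sphere_laplacian :: (real ^ 'm \<Rightarrow> real) \<Rightarrow> _) \<nu>"
  let ?T = "basis_msets m k"
  define \<phi> where "\<phi> M = sphere_restrict (hp k (ext_basis m M))" for M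
  have comb: "(\<lambda>x. \<Sum>M\<in>?T. b M * \<phi> M x) = sphere_restrict (hp k (\<lambda>L. \<Sum>M\<in>?T. b M * ext_basis m M L))" for b
    by (rule ext) (simp add: \<phi>_def sphere_restrict_def hp_sum)
  have tf: "tracefree k (\<lambda>L. \<Sum>M\<in>?T. b M * ext_basis m M L)" for b
    by (intro tracefree_sum) (simp add: ext_basis_def tracefree_ext)
  have E: "?E = {u. \<exists>b. u = (\<lambda>x. \<Sum>M\<in>?T. b M * \<phi> M x)}"
  proof (intro equalityI subsetI)
    fix u assume "u \<in> ?E"
    then obtain F where F: "harm (real k) F" "u = sphere_restrict F"
      by (rule harm_of_eigenfunction) (use \<nu> in auto)
    obtain c where c: "\<And>x. x \<noteq> 0 \<Longrightarrow> F x = hp k c x"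
      using harm_imp_hp[OF N F(1)] by blast
    have "lap (hp k c) x = 0" if x: "x \<noteq> 0" for x
      using lap_cong[OF c x] harmD(3)[OF F(1) x] by simp
    then have tc: "tracefree k c" by (rule tracefree_of_harm)
    have "u = (\<lambda>x. \<Sum>M\<in>?T. c M * \<phi> M x)"
      unfolding comb
    proof
      fix x
      have "hp k c x = hp k (\<lambda>L. \<Sum>M\<in>?T. c M * ext_basis m M L) x"
        by (rule hp_cong) (rule tracefree_expand[OF tc])
      then show "u x = sphere_restrict (hp k (\<lambda>L. \<Sum>M\<in>?T. c M * ext_basis m M L)) x"
        unfolding F(2) sphere_restrict_def using c[of x] by (cases "x = 0") auto
    qed
    then show "u \<in> {u. \<exists>b. u = (\<lambda>x. \<Sum>M\<in>?T. b M * \<phi> M x)}" by blast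
  next
    fix u assume "u \<in> {u. \<exists>b. u = (\<lambda>x. \<Sum>M\<in>?T. b M * \<phi> M x)}"
    then obtain b where b: "u = (\<lambda>x. \<Sum>M\<in>?T. b M * \<phi> M x)" by blast
    show "u \<in> ?E"
      unfolding b comb by (rule eigenfunction_of_harm[OF harm_hp[OF tf]]) (simp add: \<nu>)
  qed
  have indep: "\<forall>M\<in>?T. b M = 0" if b: "\<And>x. (\<Sum>M\<in>?T. b M * \<phi> M x) = 0" for b
  proof
    fix L assume L: "L \<in> ?T"
    have z: "sphere_restrict (hp k (\<lambda>L. \<Sum>M\<in>?T. b M * ext_basis m M L)) x = 0" for x
      using b[of x] fun_cong[OF comb[of b], of x] by simp
    have "hp k (\<lambda>L. \<Sum>M\<in>?T. b M * ext_basis m M L) y = 0" if "norm y = 1" for y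
      using z[of y] that by (simp add: sphere_restrict_def)
    then have "hp k (\<lambda>L. \<Sum>M\<in>?T. b M * ext_basis m M L) x = 0" if "x \<noteq> 0" for x
      using homog_eq_0[OF homog_hp _ that] by blast
    moreover have "size L = k" using L by (simp add: basis_msets_def)
    ultimately have "(\<Sum>M\<in>?T. b M * ext_basis m M L) = 0"
      by (rule hp_eq_0D)
    then show "b L = 0"
      using L by (simp add: ext_basis_apply[OF L] finite_basis_msets if_distrib cong: if_cong)
  qed
  show "multiplicity_of smooth_sphere (sphere_laplacian :: (real ^ 'm \<Rightarrow> real) \<Rightarrow> _) \<nu> = card ?T"
    unfolding multiplicity_of_def
    by (rule dim_eq_card_of_parametrization[OF finite_basis_msets E indep])
  have "\<exists>M. M \<in> ?T"
  proof -
    have "CARD('m) \<noteq> card {m}" using N by simp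
    then obtain i where "i \<noteq> m" by (metis UNIV_I UNIV_eq_I singletonI)
    \<comment> \<open>An index other than \<open>m\<close> shows that the basis is nonempty in every
      degree \<open>k\<close>, so the eigenvalue really occurs.\<close>
    then have "replicate_mset k i \<in> ?T" by (simp add: basis_msets_def)
    then show ?thesis by blast
  qed
  then obtain M where M: "M \<in> ?T" by blast
  show "\<exists>u \<in> ?E. u \<noteq> (\<lambda>x. 0)"
  proof (rule ccontr)
    assume "\<not> ?thesis"
    then have all: "u = (\<lambda>x. 0)" if "u \<in> ?E" for u using that by blast
    have "(\<lambda>x. \<Sum>M\<in>?T. 1 * \<phi> M x) \<in> ?E" unfolding E by (rule CollectI, rule exI[of _ "\<lambda>_. 1"]) (rule refl)
    from all[OF this] have "(\<Sum>M\<in>?T. 1 * \<phi> M x) = 0" for x by (rule fun_cong)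
    from indep[of "\<lambda>_. 1", OF this] show False using M by simp
  qed
qed

text \<open>Negative \<open>\<nu>\<close> falls to the maximum principle for the extension of degree
  \<open>0\<close>. Positive \<open>\<nu>\<close> corresponds to a positive degree that is not a
  natural number, where \<open>harm_nonint\<close> applies; \<open>\<nu> = 0\<close> is in the
  list.\<close>

lemma eigenspace_sphere_laplacian_trivial:
  fixes u :: "real ^ 'm::finite \<Rightarrow> real"
  assumes N: "CARD('m) \<ge> 2" and \<nu>: "\<And>k. \<nu> \<noteq> real k * (real k + real CARD('m) - 2)"
    and u: "u \<in> eigenspace smooth_sphere sphere_laplacian \<nu>"
  shows "u = (\<lambda>x. 0)"
proof -
  have us: "u \<in> smooth_sphere" and ul: "\<And>x. sphere_laplacian u x = \<nu> * u x"
    using u unfolding eigenspace_def by (auto simp: fun_eq_iff)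
  consider "\<nu> < 0" | "\<nu> > 0" using \<nu>[of 0] by fastforce
  then show ?thesis
  proof cases
    case 1
    have r: "smooth0 (radial_ext u)" using us unfolding smooth_sphere_def by simp
    have ru: "radial_ext u x = u x" if "norm x = 1" for x
      using that by (simp add: radial_ext_def sgn_div_norm)
    have l: "lap (radial_ext u) x = - \<nu> * radial_ext u x" if "norm x = 1" for x
      using sphere_laplacian_eq_lap[OF us that] ul[of x] ru[OF that] by simp
    show ?thesis
    proof
      fix x
      show "u x = 0"
      proof (cases "norm x = 1")
        case True
        then have x0: "x \<noteq> 0" by auto
        have "0 * (0 + real CARD('m) - 2) < - \<nu>" using 1 by simp
        from maximum_principle_zero[OF r radial_ext_homog l this x0]
        show ?thesis using ru[OF True] by simp
      next
        case False
        then show ?thesis using us by (simp add: smooth_sphere_def)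
      qed
    qed
  next
    case 2
    define p where "p = real CARD('m) - 2"
    \<comment> \<open>The positive root of \<open>\<alpha> * (\<alpha> + p) = \<nu>\<close>.\<close>
    define \<alpha> where "\<alpha> = (- p + sqrt (p * p + 4 * \<nu>)) / 2"
    have p: "p \<ge> 0" using N unfolding p_def by simp
    have "\<alpha> * (\<alpha> + p) = ((sqrt (p * p + 4 * \<nu>)) * (sqrt (p * p + 4 * \<nu>)) - p * p) / 4"
      unfolding \<alpha>_def by (simp add: field_simps)
    also have "\<dots> = \<nu>" using 2 by simp
    finally have a: "\<alpha> * (\<alpha> + real CARD('m) - 2) = \<nu>" unfolding p_def by (simp add: algebra_simps)
    have "sqrt (p * p) < sqrt (p * p + 4 * \<nu>)" using 2 by (intro real_sqrt_less_mono) simp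
    then have a0: "\<alpha> > 0" using p unfolding \<alpha>_def by simp
    have aN: "\<alpha> \<notin> \<nat>"
    proof
      assume "\<alpha> \<in> \<nat>"
      then obtain k where "\<alpha> = real k" by (auto elim: Nats_cases)
      then show False using \<nu>[of k] a by simp
    qed
    obtain F where F: "harm \<alpha> F" "u = sphere_restrict F"
      using harm_of_eigenfunction[OF u a] by blast
    show ?thesis
    proof
      fix x
      show "u x = 0"
        using harm_nonint[OF F(1) N a0 aN, of x] unfolding F(2) sphere_restrict_def by (cases "x = 0") auto
    qed
  qed
qed

subsection \<open>Determinants\<close>

lemma eigenspace_conformal_laplacian:
  "eigenspace smooth_sphere (conformal_laplacian :: (real ^ 'm::finite \<Rightarrow> real) \<Rightarrow> _) \<mu> =
   eigenspace smooth_sphere sphere_laplacian (\<mu> - (real CARD('m) - 1) * (real CARD('m) - 3) / 4)"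
  unfolding eigenspace_def
  by (auto simp: fun_eq_iff conformal_laplacian_def Let_def algebra_simps)

text \<open>Treats both operators at once: \<open>s = h\<close> gives the Laplacian,
  \<open>s = 1/2\<close> the conformal one. Completing the square turns the eigenvalues into
  \<open>(k + h)\<^sup>2 - s\<^sup>2\<close>, and \<open>s < h + 1\<close> makes all of them
  positive except possibly the one for \<open>k = 0\<close>.\<close>

lemma operator_det_shifted_sphere_laplacian:
  fixes A :: "(real ^ 'm::finite \<Rightarrow> real) \<Rightarrow> real ^ 'm \<Rightarrow> real" and s :: real and n :: nat
  defines "h \<equiv> (real n - 1) / 2"
  assumes n: "n \<ge> 1" "CARD('m) = n + 1" and s: "0 \<le> s" "s < h + 1"
    and A: "\<And>\<mu>. eigenspace smooth_sphere A \<mu> = eigenspace smooth_sphere sphere_laplacian (\<mu> - (h\<^sup>2 - s\<^sup>2))"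
  shows "operator_det smooth_sphere A =
     (if h\<^sup>2 - s\<^sup>2 > 0 then of_real (h\<^sup>2 - s\<^sup>2) else 1) *
     (barnes_value (f_exponent n (of_real s)) n (of_real (h + 1 + s)) (of_real (h + 1 - s)))"
proof -
  have h: "h \<ge> 0" unfolding h_def using n by simp
  have N: "CARD('m) \<ge> 2" using n by simp
  define e where "e k = (real k + h)\<^sup>2 - s\<^sup>2" for k
  have e\<nu>: "e k - (h\<^sup>2 - s\<^sup>2) = real k * (real k + real CARD('m) - 2)" for k
    unfolding e_def n(2) h_def by (simp add: power2_eq_square field_simps)
  \<comment> \<open>The operator zeta function runs over the set of eigenvalues, so passing to a
    series over \<open>k\<close> requires that no value is repeated.\<close>
  have inj: "inj e"
  proof (rule injI)
    fix k l assume "e k = e l"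
    then have "(real k + h)\<^sup>2 = (real l + h)\<^sup>2" by (simp add: e_def)
    then have "real k + h = real l + h" using h by (subst (asm) power2_eq_iff_nonneg) auto
    then show "k = l" by simp
  qed
  have pos: "e (Suc k) > 0" for k
  proof -
    have "s < real (Suc k) + h" using s(2) by simp
    then show ?thesis unfolding e_def using s(1) by (simp add: power_strict_mono)
  qed
  \<comment> \<open>Any index may serve as the distinguished one.\<close>
  define m where "m = (undefined :: 'm)"
  have mult: "multiplicity_of smooth_sphere A (e k) = card (basis_msets m k)" for k
    using multiplicity_sphere_laplacian(1)[OF N e\<nu>[of k], of m]
    unfolding multiplicity_of_def A .
  have ex: "\<exists>u \<in> eigenspace smooth_sphere A (e k). u \<noteq> (\<lambda>x. 0)" for k
    using multiplicity_sphere_laplacian(2)[OF N e\<nu>[of k]] unfolding A .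
  have spec: "\<mu> \<in> range e" if u: "u \<in> eigenspace smooth_sphere A \<mu>" "u \<noteq> (\<lambda>x. 0)" for u \<mu>
  proof (rule ccontr)
    assume *: "\<mu> \<notin> range e"
    have "\<mu> - (h\<^sup>2 - s\<^sup>2) \<noteq> real k * (real k + real CARD('m) - 2)" for k
    proof
      assume "\<mu> - (h\<^sup>2 - s\<^sup>2) = real k * (real k + real CARD('m) - 2)"
      then have "\<mu> = e k" using e\<nu>[of k] by linarith
      then show False using * by blast
    qed
    from eigenspace_sphere_laplacian_trivial[OF N this u(1)[unfolded A]] u(2) show False by simp
  qed
  have P: "positive_eigenvalues smooth_sphere A = {\<mu>. \<mu> > 0 \<and> \<mu> \<in> range e}"
    unfolding positive_eigenvalues_def using ex spec by auto
  define g where "g \<mu> w = of_nat (multiplicity_of smooth_sphere A \<mu>) * of_real \<mu> powr (- w)" for \<mu> and w :: complex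
  obtain D where D:
    "zeta_deriv UNIV (\<lambda>k w. of_nat (((k + n) choose (n - 1)) + ((k + n - 1) choose (n - 1))) *
        of_real ((real k + 1 + h) ^ 2 - s ^ 2) powr (- w)) D"
    "exp (- D) = barnes_value (f_exponent n (of_real s)) n (of_real (h + 1 + s)) (of_real (h + 1 - s))"
    unfolding h_def by (rule zeta_regularized_product[OF n(1) s[unfolded h_def]])
  have c0: "zeta_deriv (range (\<lambda>k. e (Suc k))) g D"
    using D(1)
  proof (rule zeta_deriv_transfer)
    fix w S :: complex
    assume sum: "((\<lambda>k. of_nat (((k + n) choose (n - 1)) + ((k + n - 1) choose (n - 1))) *
        of_real ((real k + 1 + h) ^ 2 - s ^ 2) powr (- w)) has_sum S) UNIV"
    have eq: "of_nat (((k + n) choose (n - 1)) + ((k + n - 1) choose (n - 1))) *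
        of_real ((real k + 1 + h) ^ 2 - s ^ 2) powr (- w) = g (e (Suc k)) w" for k
    proof -
      have "real k + 1 + h = real (Suc k) + h" by simp
      then show ?thesis
        unfolding g_def mult card_basis_msets_Suc[OF n(2,1)] unfolding e_def by (simp only: of_nat_add)
    qed
    have "inj (\<lambda>k. e (Suc k))" using inj by (auto simp: inj_on_def)
    then have bij: "bij_betw (\<lambda>k. e (Suc k)) UNIV (range (\<lambda>k. e (Suc k)))"
      by (rule inj_on_imp_bij_betw)
    show "((\<lambda>\<mu>. g \<mu> w) has_sum S) (range (\<lambda>k. e (Suc k)))"
      using sum unfolding eq has_sum_reindex_bij_betw[OF bij, of "\<lambda>\<mu>. g \<mu> w"] .
  qed
  have range_e: "range e = insert (e 0) (range (\<lambda>k. e (Suc k)))"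
    by (auto simp: image_iff) (metis not0_implies_Suc)
  have e0: "e 0 = h\<^sup>2 - s\<^sup>2" unfolding e_def by simp
  have det: "operator_det smooth_sphere A = exp (- D')"
    if "zeta_deriv (positive_eigenvalues smooth_sphere A) g D'" for D'
    using zeta_deriv_series_continuation[OF that]
    unfolding operator_det_def operator_zeta_def g_def[abs_def] by simp
  show ?thesis
  proof (cases "h\<^sup>2 - s\<^sup>2 > 0")
    case False
    then have "positive_eigenvalues smooth_sphere A = range (\<lambda>k. e (Suc k))"
      unfolding P range_e using e0 pos by auto
    then show ?thesis using det[of D] c0 D(2) False by simp
  next
    case True
    have e0pos: "e 0 > 0" using True e0 by simp
    from True have PI: "positive_eigenvalues smooth_sphere A = insert (e 0) (range (\<lambda>k. e (Suc k)))"
      unfolding P range_e using e0 pos by auto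
    have "e 0 \<notin> range (\<lambda>k. e (Suc k))" using inj by (auto simp: inj_on_def)
    \<comment> \<open>The constants contribute a simple eigenvalue; its term has derivative
      \<open>- ln (e 0)\<close> at \<open>0\<close>, which becomes the factor \<open>e 0\<close> of
      the determinant.\<close>
    moreover have "(g (e 0) has_field_derivative - of_real (ln (e 0)) * of_real (e 0) powr (- w)) (at w)" for w
    proof -
      have powr: "of_real x powr (- w) = exp (- w * of_real (ln x))" if "x > 0" for x and w :: complex
        using that by (simp add: powr_def Ln_of_real)
      note pe = powr[OF e0pos]
      have "g (e 0) = (\<lambda>w. exp (- w * of_real (ln (e 0))))"
        unfolding g_def[abs_def] mult card_basis_msets_0 pe by simp
      moreover have "of_real (e 0) powr (- w) = exp (- w * of_real (ln (e 0)))"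
        by (rule pe)
      ultimately show ?thesis
        by (auto intro!: derivative_eq_intros)
    qed
    ultimately have "zeta_deriv (positive_eigenvalues smooth_sphere A) g
        (D + (- of_real (ln (e 0)) * of_real (e 0) powr (- 0)))"
      unfolding PI by (rule zeta_deriv_insert[OF c0])
    then have "operator_det smooth_sphere A = exp (- (D + (- of_real (ln (e 0)) * of_real (e 0) powr (- 0))))"
      by (rule det)
    also have "\<dots> = exp (of_real (ln (e 0))) * exp (- D)"
      using e0pos by (simp add: exp_add[symmetric])
    also have "exp (of_real (ln (e 0))) = complex_of_real (e 0)"
      using e0pos by (simp add: exp_of_real)
    finally show ?thesis using True D(2) e0 by simp
  qed
qed

theorem corollary1p2:
  fixes n :: nat
  assumes "n \<ge> 1" and "CARD('m::finite) = n + 1"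
  shows "operator_det smooth_sphere (sphere_laplacian :: (real ^ 'm \<Rightarrow> real) \<Rightarrow> _) =
           exp (f_exponent n (check n)) *
           (\<Prod>l=1..<n. inverse (barnes_Gamma l (of_nat n) * barnes_Gamma l 1)) *
           inverse ((barnes_Gamma n (of_nat n) * barnes_Gamma n 1) ^ 2) \<and>
         operator_det smooth_sphere (conformal_laplacian :: (real ^ 'm \<Rightarrow> real) \<Rightarrow> _) =
           (of_nat n * (of_nat n - 2) / 4) ^ (if n \<ge> 3 then 1 else 0) *
           exp (f_exponent n (1 / 2)) *
           (\<Prod>l=1..<n. inverse (barnes_Gamma l (of_nat n / 2 + 1) * barnes_Gamma l (of_nat n / 2))) *
           inverse ((barnes_Gamma n (of_nat n / 2 + 1) * barnes_Gamma n (of_nat n / 2)) ^ 2)"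
proof
  define h where "h = (real n - 1) / 2"
  have h: "h \<ge> 0" using assms(1) unfolding h_def by simp
  have "of_real (h + 1 + h) = (of_nat n :: complex)" "of_real (h + 1 - h) = (1 :: complex)"
       "of_real h = check n"
    unfolding h_def check_def by simp_all
  \<comment> \<open>With \<open>s = h\<close> the shift is zero, so the constants have eigenvalue
    \<open>0\<close> and contribute no prefactor.\<close>
  with operator_det_shifted_sphere_laplacian[OF assms(1) assms(2), of h sphere_laplacian] h
  show "operator_det smooth_sphere (sphere_laplacian :: (real ^ 'm \<Rightarrow> real) \<Rightarrow> _) =
           exp (f_exponent n (check n)) *
           (\<Prod>l=1..<n. inverse (barnes_Gamma l (of_nat n) * barnes_Gamma l 1)) *
           inverse ((barnes_Gamma n (of_nat n) * barnes_Gamma n 1) ^ 2)"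
    unfolding h_def[symmetric] by simp
  have c: "h\<^sup>2 - (1 / 2)\<^sup>2 = real n * (real n - 2) / 4"
    unfolding h_def by (simp add: power2_eq_square field_simps)
  have c': "(real CARD('m) - 1) * (real CARD('m) - 3) / 4 = h\<^sup>2 - (1 / 2)\<^sup>2"
    unfolding c assms(2) by simp
  have r: "of_real (h + 1 + 1 / 2) = (of_nat n / 2 + 1 :: complex)" "of_real (h + 1 - 1 / 2) = (of_nat n / 2 :: complex)"
    unfolding h_def by (simp_all add: field_simps)
  have f: "(if h\<^sup>2 - (1 / 2)\<^sup>2 > 0 then of_real (h\<^sup>2 - (1 / 2)\<^sup>2) else 1) =
     (of_nat n * (of_nat n - 2) / 4 :: complex) ^ (if n \<ge> 3 then 1 else 0)"
  proof (cases "n \<ge> 3")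
    case True
    then have "real n * (real n - 2) / 4 > 0" by simp
    then show ?thesis using True unfolding c by simp
  next
    case False
    \<comment> \<open>For \<open>n = 1\<close> and \<open>n = 2\<close> the eigenvalue of the
      constants is not positive and stays out of the zeta function.\<close>
    then have "real n * (real n - 2) / 4 \<le> 0" by (simp add: mult_nonneg_nonpos)
    then show ?thesis using False unfolding c by simp
  qed
  have A: "eigenspace smooth_sphere (conformal_laplacian :: (real ^ 'm \<Rightarrow> real) \<Rightarrow> _) \<mu> =
      eigenspace smooth_sphere sphere_laplacian (\<mu> - (h\<^sup>2 - (1 / 2)\<^sup>2))" for \<mu>
    unfolding c'[symmetric] by (rule eigenspace_conformal_laplacian)
  have s: "0 \<le> (1 / 2 :: real)" "1 / 2 < h + 1" using h by auto
  show "operator_det smooth_sphere (conformal_laplacian :: (real ^ 'm \<Rightarrow> real) \<Rightarrow> _) =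
           (of_nat n * (of_nat n - 2) / 4) ^ (if n \<ge> 3 then 1 else 0) *
           exp (f_exponent n (1 / 2)) *
           (\<Prod>l=1..<n. inverse (barnes_Gamma l (of_nat n / 2 + 1) * barnes_Gamma l (of_nat n / 2))) *
           inverse ((barnes_Gamma n (of_nat n / 2 + 1) * barnes_Gamma n (of_nat n / 2)) ^ 2)"
    using operator_det_shifted_sphere_laplacian[OF assms s[unfolded h_def] A[unfolded h_def], folded h_def]
    unfolding f r by (simp add: mult.assoc)
qed

end
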